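(* Let $Z$ be a real generalized stochastic process (GeSP) over $\mathbb{R}^d$. Then there exist a linear and weak-continuous operator $\mathcal{L} : L^{2}(\mathbb{R}^d)\,(=L^{2}(\mathbb{R}^d)') \to \mathscr{S}'(\mathbb{R}^d)$ and a real White Noise $W$ over $\mathbb{R}^d$ such that $$Z = \mathcal{L}W .$$
   Context: Fix a probability space $(\Omega,\mathcal{A},\mathbb{P})$, assumed rich enough to support the additional random variables needed (if necessary it is replaced by a product with another probability space). All random variables have zero mean. $L^{2}(\Omega,\mathcal{A},\mathbb{P})$ is the space of complex square-integrable random variables. Equality of two stochastic processes means that one is a modification of the other (almost sure equality at each index). $\mathscr{S}(\mathbb{R}^d)$ is the Schwartz space of complex functions with its usual topology, and $\mathscr{S}'(\mathbb{R}^d)$ is the space of tempered distributions. A GeSP over $\mathbb{R}^d$ is a linear continuous mapping $Z:\mathscr{S}(\mathbb{R}^d)\to L^{2}(\Omega,\mathcal{A},\mathbb{P})$; it is real if $Z(\varphi)$ is a real random variable for every real $\varphi$. A real White Noise over $\mathbb{R}^d$ is a real GeSP $W$ with $\mathbb{E}(W(\varphi)\overline{W(\phi)})=\int_{\mathbb{R}^d}\varphi(x)\overline{\phi(x)}\,dx$ for all $\varphi,\phi\in\mathscr{S}(\mathbb{R}^d)$. It extends uniquely to a continuous linear map $W:L^{2}(\mathbb{R}^d)\to L^{2}(\Omega,\mathcal{A},\mathbb{P})$. Here $L^{2}(\mathbb{R}^d)$ is identified with its dual through the bilinear pairing $\langle f,h\rangle=\int_{\mathbb{R}^d} f(x)h(x)\,dx$,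 and weak-continuous means continuous when $L^2(\mathbb{R}^d)'$ and $\mathscr{S}'(\mathbb{R}^d)$ both carry their weak-$*$ topologies (pointwise convergence). Such an $\mathcal{L}$ is the adjoint of a continuous linear operator $\mathcal{R}:\mathscr{S}(\mathbb{R}^d)\to L^{2}(\mathbb{R}^d)$, i.e. $\langle \mathcal{L}f,\varphi\rangle=\langle f,\mathcal{R}\varphi\rangle$. The process $\mathcal{L}W$ is the GeSP defined by $(\mathcal{L}W)(\varphi):=W(\mathcal{R}\varphi)$ for $\varphi\in\mathscr{S}(\mathbb{R}^d)$. *)

theory Defs
  imports "HOL-Probability.Probability"
begin

section \<open>Topologies generated by seminorms\<close>

definition seminorm_topology ::
    "('a \<Rightarrow> complex) set \<Rightarrow> (('a \<Rightarrow> complex) \<Rightarrow> real) set \<Rightarrow> ('a \<Rightarrow> complex) topology" where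
  "seminorm_topology A P = topology_generated_by
     {{g \<in> A. p (\<lambda>x. g x - f x) < e} | f p e. f \<in> A \<and> p \<in> P \<and> 0 < e}"

lemma topspace_seminorm_topology:
  assumes "p \<in> P" and "p (\<lambda>x. 0) = 0"
  shows "topspace (seminorm_topology A P) = A"
proof
  show "topspace (seminorm_topology A P) \<subseteq> A"
    unfolding seminorm_topology_def topology_generated_by_topspace by auto
  show "A \<subseteq> topspace (seminorm_topology A P)"
  proof
    fix f assume f: "f \<in> A"
    then have "f \<in> {g \<in> A. p (\<lambda>x. g x - f x) < 1}"
      using assms(2) by simp
    then show "f \<in> topspace (seminorm_topology A P)"
      unfolding seminorm_topology_def topology_generated_by_topspace
      using f assms(1) zero_less_one by blast
  qed
qed


section \<open>Square-integrable functions\<close>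

text \<open>Elements are functions, not equivalence classes; identities in \<open>L\<^sup>2\<close> are stated almost
  everywhere. Almost everywhere equal functions cannot be separated by the topologies below.\<close>

definition L2 :: "'a measure \<Rightarrow> ('a \<Rightarrow> complex) set" where
  "L2 M = {f \<in> borel_measurable M. integrable M (\<lambda>x. (cmod (f x))\<^sup>2)}"

definition L2_norm :: "'a measure \<Rightarrow> ('a \<Rightarrow> complex) \<Rightarrow> real" where
  "L2_norm M f = sqrt (LINT x|M. (cmod (f x))\<^sup>2)"

definition L2_topology :: "'a measure \<Rightarrow> ('a \<Rightarrow> complex) topology" where
  "L2_topology M = seminorm_topology (L2 M) {L2_norm M}"

lemma topspace_L2_topology: "topspace (L2_topology M) = L2 M"
  unfolding L2_topology_def
  by (rule topspace_seminorm_topology[of "L2_norm M"]) (auto simp: L2_norm_def)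

definition pairing :: "('a::euclidean_space \<Rightarrow> complex) \<Rightarrow> ('a \<Rightarrow> complex) \<Rightarrow> complex" where
  "pairing f h = (LINT x|lborel. f x * h x)"

text \<open>The weak-* topology of the dual of \<open>L\<^sup>2\<close>, transported to \<open>L\<^sup>2\<close> along the
  bilinear (not sesquilinear) pairing.\<close>

definition L2_weak_topology :: "('a::euclidean_space \<Rightarrow> complex) topology" where
  "L2_weak_topology = seminorm_topology (L2 lborel) {\<lambda>f. cmod (pairing f h) | h. h \<in> L2 lborel}"

lemma topspace_L2_weak_topology:
  "topspace (L2_weak_topology :: ('a::euclidean_space \<Rightarrow> complex) topology) = L2 lborel"
  unfolding L2_weak_topology_def
  by (rule topspace_seminorm_topology[of "\<lambda>f. cmod (pairing f (\<lambda>x. 0))"])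
     (auto simp: pairing_def L2_def intro!: exI[of _ "\<lambda>x. 0"])


section \<open>Schwartz functions and tempered distributions\<close>

text \<open>\<open>iter_partial [i\<^sub>1, \<dots>, i\<^sub>k] f\<close> is the mixed partial derivative of \<open>f\<close> in the directions
  \<open>i\<^sub>1, \<dots>, i\<^sub>k\<close>. All orders of differentiation are kept, instead of one representative per
  multi-index; for smooth \<open>f\<close> the order is irrelevant.\<close>

fun iter_partial :: "'d list \<Rightarrow> (real^'d::finite \<Rightarrow> complex) \<Rightarrow> real^'d \<Rightarrow> complex" where
  "iter_partial [] f = f"
| "iter_partial (i # is) f = (\<lambda>x. frechet_derivative (iter_partial is f) (at x) (axis i 1))"

definition smooth :: "(real^'d::finite \<Rightarrow> complex) \<Rightarrow> bool" where
  "smooth f \<longleftrightarrow> (\<forall>is x. iter_partial is f differentiable (at x))"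

definition schwartz_weight ::
    "('d::finite \<Rightarrow> nat) \<Rightarrow> 'd list \<Rightarrow> (real^'d \<Rightarrow> complex) \<Rightarrow> real^'d \<Rightarrow> real" where
  "schwartz_weight \<alpha> is f x = \<bar>\<Prod>j\<in>UNIV. (x $ j) ^ \<alpha> j\<bar> * cmod (iter_partial is f x)"

definition schwartz :: "(real^'d::finite \<Rightarrow> complex) set" where
  "schwartz = {f. smooth f \<and> (\<forall>\<alpha> is. bdd_above (range (schwartz_weight \<alpha> is f)))}"

definition schwartz_seminorm ::
    "('d::finite \<Rightarrow> nat) \<Rightarrow> 'd list \<Rightarrow> (real^'d \<Rightarrow> complex) \<Rightarrow> real" where
  "schwartz_seminorm \<alpha> is f = (SUP x. schwartz_weight \<alpha> is f x)"

definition schwartz_topology :: "(real^'d::finite \<Rightarrow> complex) topology" where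
  "schwartz_topology = seminorm_topology schwartz {schwartz_seminorm \<alpha> is | \<alpha> is. True}"

lemma topspace_schwartz_topology:
  "topspace (schwartz_topology :: (real^'d::finite \<Rightarrow> complex) topology) = schwartz"
  unfolding schwartz_topology_def
  by (rule topspace_seminorm_topology[of "schwartz_seminorm (\<lambda>_. 0) []"])
     (auto simp: schwartz_seminorm_def schwartz_weight_def)

text \<open>A distribution is a function on all functions of which only the values on \<open>schwartz\<close> matter.\<close>

definition tempered_distributions :: "((real^'d::finite \<Rightarrow> complex) \<Rightarrow> complex) set" where
  "tempered_distributions = {u.
     (\<forall>\<phi>\<in>schwartz. \<forall>\<psi>\<in>schwartz. \<forall>a b. u (\<lambda>x. a * \<phi> x + b * \<psi> x) = a * u \<phi> + b * u \<psi>) \<and>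
     continuous_map schwartz_topology euclidean u}"

definition tempered_weak_topology :: "((real^'d::finite \<Rightarrow> complex) \<Rightarrow> complex) topology" where
  "tempered_weak_topology =
     seminorm_topology tempered_distributions {\<lambda>u. cmod (u \<phi>) | \<phi>. \<phi> \<in> schwartz}"

lemma topspace_tempered_weak_topology:
  "topspace (tempered_weak_topology :: ((real^'d::finite \<Rightarrow> complex) \<Rightarrow> complex) topology)
     = tempered_distributions"
proof -
  have [simp]: "iter_partial is (\<lambda>x::real^'d. 0) = (\<lambda>x. 0)" for "is"
    by (induction "is") auto
  have "(\<lambda>x::real^'d. 0) \<in> schwartz"
    by (auto simp: schwartz_def smooth_def schwartz_weight_def)
  then show ?thesis
    unfolding tempered_weak_topology_def
    by (intro topspace_seminorm_topology[of "\<lambda>u. cmod (u (\<lambda>x. 0))"]) auto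
qed


section \<open>Operators\<close>

text \<open>Linear continuous maps from the topological vector space \<open>X\<close> of functions into \<open>L\<^sup>2\<close>;
  linearity is equality in \<open>L\<^sup>2\<close>, hence almost everywhere. Continuity includes that the values
  lie in \<open>L2 M\<close>.\<close>

definition linear_continuous_L2 ::
    "('a \<Rightarrow> complex) topology \<Rightarrow> 'w measure \<Rightarrow> (('a \<Rightarrow> complex) \<Rightarrow> 'w \<Rightarrow> complex) \<Rightarrow> bool" where
  "linear_continuous_L2 X M T \<longleftrightarrow>
     (\<forall>f\<in>topspace X. \<forall>g\<in>topspace X. \<forall>a b.
        AE \<omega> in M. T (\<lambda>x. a * f x + b * g x) \<omega> = a * T f \<omega> + b * T g \<omega>) \<and>
     continuous_map X (L2_topology M) T"

text \<open>Weak continuity forces the distribution \<open>L f\<close> to depend only on the almost everywhere class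
  of \<open>f\<close>.\<close>

definition linear_weak_continuous ::
    "((real^'d::finite \<Rightarrow> complex) \<Rightarrow> (real^'d \<Rightarrow> complex) \<Rightarrow> complex) \<Rightarrow> bool" where
  "linear_weak_continuous L \<longleftrightarrow>
     (\<forall>f\<in>L2 lborel. \<forall>g\<in>L2 lborel. \<forall>a b. \<forall>\<phi>\<in>schwartz.
        L (\<lambda>x. a * f x + b * g x) \<phi> = a * L f \<phi> + b * L g \<phi>) \<and>
     continuous_map L2_weak_topology tempered_weak_topology L"

text \<open>The operator whose adjoint is \<open>L\<close>; each \<open>predual_operator L \<phi>\<close> is determined
  up to equality almost everywhere.\<close>

definition predual_operator ::
    "((real^'d::finite \<Rightarrow> complex) \<Rightarrow> (real^'d \<Rightarrow> complex) \<Rightarrow> complex) \<Rightarrow>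
      (real^'d \<Rightarrow> complex) \<Rightarrow> real^'d \<Rightarrow> complex" where
  "predual_operator L = (SOME R. linear_continuous_L2 schwartz_topology lborel R \<and>
     (\<forall>f\<in>L2 lborel. \<forall>\<phi>\<in>schwartz. L f \<phi> = pairing f (R \<phi>)))"


section \<open>Generalized stochastic processes\<close>

text \<open>The condition on the expectation is the standing convention that all random variables have
  zero mean.\<close>

definition gesp ::
    "'w measure \<Rightarrow> ((real^'d::finite \<Rightarrow> complex) \<Rightarrow> 'w \<Rightarrow> complex) \<Rightarrow> bool" where
  "gesp M Z \<longleftrightarrow> linear_continuous_L2 schwartz_topology M Z \<and>
     (\<forall>\<phi>\<in>schwartz. (LINT \<omega>|M. Z \<phi> \<omega>) = 0)"

definition real_gesp ::
    "'w measure \<Rightarrow> ((real^'d::finite \<Rightarrow> complex) \<Rightarrow> 'w \<Rightarrow> complex) \<Rightarrow> bool" where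
  "real_gesp M Z \<longleftrightarrow> gesp M Z \<and>
     (\<forall>\<phi>\<in>schwartz. (\<forall>x. \<phi> x \<in> \<real>) \<longrightarrow> (AE \<omega> in M. Z \<phi> \<omega> \<in> \<real>))"

definition real_white_noise ::
    "'w measure \<Rightarrow> ((real^'d::finite \<Rightarrow> complex) \<Rightarrow> 'w \<Rightarrow> complex) \<Rightarrow> bool" where
  "real_white_noise M W \<longleftrightarrow> real_gesp M W \<and>
     (\<forall>\<phi>\<in>schwartz. \<forall>\<psi>\<in>schwartz.
        (LINT \<omega>|M. W \<phi> \<omega> * cnj (W \<psi> \<omega>)) = (LINT x|lborel. \<phi> x * cnj (\<psi> x)))"

text \<open>The continuous linear extension of \<open>W\<close> from \<open>schwartz\<close> to \<open>L\<^sup>2\<close>, determined up to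
  modification because \<open>schwartz\<close> is dense in \<open>L\<^sup>2\<close>.\<close>

definition L2_extension ::
    "'w measure \<Rightarrow> ((real^'d::finite \<Rightarrow> complex) \<Rightarrow> 'w \<Rightarrow> complex) \<Rightarrow>
      (real^'d \<Rightarrow> complex) \<Rightarrow> 'w \<Rightarrow> complex" where
  "L2_extension M W = (SOME V. linear_continuous_L2 (L2_topology lborel) M V \<and>
     (\<forall>\<phi>\<in>schwartz. AE \<omega> in M. V \<phi> \<omega> = W \<phi> \<omega>))"

text \<open>The process \<open>L W\<close>.\<close>

definition operator_noise ::
    "'w measure \<Rightarrow> ((real^'d::finite \<Rightarrow> complex) \<Rightarrow> (real^'d \<Rightarrow> complex) \<Rightarrow> complex) \<Rightarrow>
      ((real^'d \<Rightarrow> complex) \<Rightarrow> 'w \<Rightarrow> complex) \<Rightarrow> (real^'d \<Rightarrow> complex) \<Rightarrow> 'w \<Rightarrow> complex" where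
  "operator_noise M L W \<phi> = L2_extension M W (predual_operator L \<phi>)"

definition modification ::
    "'w measure \<Rightarrow> ((real^'d::finite \<Rightarrow> complex) \<Rightarrow> 'w \<Rightarrow> complex) \<Rightarrow>
      ((real^'d \<Rightarrow> complex) \<Rightarrow> 'w \<Rightarrow> complex) \<Rightarrow> bool" where
  "modification M Z Y \<longleftrightarrow> (\<forall>\<phi>\<in>schwartz. AE \<omega> in M. Z \<phi> \<omega> = Y \<phi> \<omega>)"

end

theory Submission
  imports Defs
begin

text \<open>The image of \<open>Z\<close> spans a separable real Hilbert space of centred random variables. It therefore
  has a countable orthonormal basis \<open>X\<close>, possibly finite, and it can be copied isometrically into
  \<open>L\<^sup>2(\<real>\<^sup>d)\<close>, which has a countably infinite real orthonormal basis \<open>e\<close>. Expanding along \<open>X\<close> and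
  summing the same coefficients along \<open>e\<close> gives an operator
  \<open>R \<phi> = \<Sum>k. E(Z \<phi> * X k) * e k\<close> from Schwartz space to \<open>L\<^sup>2(\<real>\<^sup>d)\<close>; it is continuous since
  its norm is bounded by that of \<open>Z \<phi>\<close>, and \<open>L\<close> is its adjoint. On a product space the missing
  vectors of \<open>X\<close> are supplied by independent signs, which gives an infinite orthonormal sequence \<open>\<xi>\<close>
  of real centred variables. The isometry \<open>W f = \<Sum>k. \<langle>f, e k\<rangle> * \<xi> k\<close> is a real white noise, and
  \<open>W (R \<phi>) = \<Sum>k. E(Z \<phi> * X k) * \<xi> k = Z \<phi>\<close>, because the coefficients vanish wherever \<open>\<xi>\<close>
  differs from \<open>X\<close>.

  Three facts carry the argument. The first is separability (\<open>schwartz_separable_image\<close>): by continuity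
  of \<open>Z\<close> only finitely many Schwartz seminorms matter at a given tolerance, and in these a function is
  determined, up to a small error, by its rounded values on a finite grid. Hence countably many
  Schwartz functions suffice, and Gram--Schmidt applies. The second is density of Schwartz functions in
  \<open>L\<^sup>2(\<real>\<^sup>d)\<close> (\<open>schwartz_dense\<close>): indicators of boxes are limits of products of functions
  \<open>exp (- t ^ (2 * m))\<close>, and Dynkin's theorem passes from boxes to Borel sets. It yields the basis \<open>e\<close>
  and makes the extension of \<open>W\<close> to \<open>L\<^sup>2(\<real>\<^sup>d)\<close> unique up to modification. The third is completeness
  of \<open>L\<^sup>2\<close> (\<open>L2_complete\<close>), by which the series converge.\<close>


section \<open>Topologies generated by seminorms\<close>

text \<open>The topology is given by a subbasis only; the triangle inequality turns this into
  neighbourhood bases of finite intersections of balls centred at the given point.\<close>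

lemma openin_seminorm_topology_nbhd:
  assumes tri: "\<And>p f g h. p \<in> P \<Longrightarrow> f \<in> A \<Longrightarrow> g \<in> A \<Longrightarrow> h \<in> A \<Longrightarrow>
      p (\<lambda>x. g x - h x) \<le> p (\<lambda>x. g x - f x) + p (\<lambda>x. f x - h x)"
    and "openin (seminorm_topology A P) U" "f \<in> U"
  shows "\<exists>F e. finite F \<and> F \<subseteq> P \<and> 0 < e \<and>
      (\<forall>g\<in>A. (\<forall>p\<in>F. p (\<lambda>x. g x - f x) < e) \<longrightarrow> g \<in> U)"
proof -
  let ?S = "{{g \<in> A. p (\<lambda>x. g x - f x) < e} | f p e. f \<in> A \<and> p \<in> P \<and> 0 < e}"
  have "generate_topology_on ?S U"
    using assms(2) by (simp add: seminorm_topology_def openin_topology_generated_by_iff)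
  then show ?thesis using \<open>f \<in> U\<close>
  proof induction
    case Empty
    then show ?case by simp
  next
    case (Int a b)
    then have "f \<in> a" "f \<in> b" by auto
    obtain F e where F: "finite F" "F \<subseteq> P" "0 < e"
        "\<forall>g\<in>A. (\<forall>p\<in>F. p (\<lambda>x. g x - f x) < e) \<longrightarrow> g \<in> a"
      using Int.IH(1)[OF \<open>f \<in> a\<close>] by (elim exE conjE)
    obtain G d where G: "finite G" "G \<subseteq> P" "0 < d"
        "\<forall>g\<in>A. (\<forall>p\<in>G. p (\<lambda>x. g x - f x) < d) \<longrightarrow> g \<in> b"
      using Int.IH(2)[OF \<open>f \<in> b\<close>] by (elim exE conjE)
    show ?case
      by (rule exI[of _ "F \<union> G"], rule exI[of _ "min e d"]) (use F G in simp)
  next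
    case (UN K)
    then obtain k where "k \<in> K" "f \<in> k" by blast
    from UN.IH[OF this] obtain F e where F: "finite F" "F \<subseteq> P" "0 < e"
        "\<forall>g\<in>A. (\<forall>p\<in>F. p (\<lambda>x. g x - f x) < e) \<longrightarrow> g \<in> k"
      by (elim exE conjE)
    show ?case
      by (rule exI[of _ F], rule exI[of _ e]) (use F \<open>k \<in> K\<close> in blast)
  next
    case (Basis s)
    then obtain h p e where s: "s = {g \<in> A. p (\<lambda>x. g x - h x) < e}" and h: "h \<in> A" "p \<in> P" "0 < e"
      by blast
    have f: "f \<in> A" "p (\<lambda>x. f x - h x) < e" using s Basis by auto
    have "g \<in> s" if "g \<in> A" "p (\<lambda>x. g x - f x) < e - p (\<lambda>x. f x - h x)" for g
      using tri[OF h(2) f(1) that(1) h(1)] that by (simp add: s)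
    then show ?case
      by (intro exI[of _ "{p}"] exI[of _ "e - p (\<lambda>x. f x - h x)"]) (use f h in auto)
  qed
qed

lemma openin_seminorm_ball:
  "f \<in> A \<Longrightarrow> p \<in> P \<Longrightarrow> 0 < e \<Longrightarrow> openin (seminorm_topology A P) {g \<in> A. p (\<lambda>x. g x - f x) < e}"
  unfolding seminorm_topology_def by (rule topology_generated_by_Basis) blast

lemma continuous_map_seminorm_topology:
  assumes tri: "\<And>q f g h. q \<in> Q \<Longrightarrow> f \<in> B \<Longrightarrow> g \<in> B \<Longrightarrow> h \<in> B \<Longrightarrow>
      q (\<lambda>x. g x - h x) \<le> q (\<lambda>x. g x - f x) + q (\<lambda>x. f x - h x)"
    and zero: "\<And>q. q \<in> Q \<Longrightarrow> q (\<lambda>x. 0) = 0" and "Q \<noteq> {}"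
  shows "continuous_map X (seminorm_topology B Q) T \<longleftrightarrow>
      (\<forall>x\<in>topspace X. T x \<in> B) \<and>
      (\<forall>x\<in>topspace X. \<forall>q\<in>Q. \<forall>e>0. \<exists>U. openin X U \<and> x \<in> U \<and>
         (\<forall>y\<in>U. q (\<lambda>z. T y z - T x z) < e))" (is "?L = (?R1 \<and> ?R2)")
proof -
  obtain q0 where q0: "q0 \<in> Q" using \<open>Q \<noteq> {}\<close> by blast
  have top: "topspace (seminorm_topology B Q) = B"
    by (rule topspace_seminorm_topology[OF q0 zero[OF q0]])
  show ?thesis
  proof safe
    fix x assume "?L" "x \<in> topspace X"
    then show "T x \<in> B" using continuous_map_image_subset_topspace top by fastforce
    fix q and e :: real assume q: "q \<in> Q" "0 < e"
    let ?V = "{g \<in> B. q (\<lambda>z. g z - T x z) < e}"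
    have "openin X {y \<in> topspace X. T y \<in> ?V}"
      by (rule openin_continuous_map_preimage[OF \<open>?L\<close> openin_seminorm_ball]) (use q \<open>T x \<in> B\<close> in auto)
    then show "\<exists>U. openin X U \<and> x \<in> U \<and> (\<forall>y\<in>U. q (\<lambda>z. T y z - T x z) < e)"
      using \<open>x \<in> topspace X\<close> \<open>T x \<in> B\<close> q zero[OF q(1)]
      by (intro exI[of _ "{y \<in> topspace X. T y \<in> ?V}"]) auto
  next
    assume R: "?R1" "?R2"
    show "?L"
      unfolding seminorm_topology_def
    proof (rule continuous_on_generated_topo)
      fix U assume "U \<in> {{g \<in> B. q (\<lambda>x. g x - f x) < e} | f q e. f \<in> B \<and> q \<in> Q \<and> 0 < e}"
      then obtain f q e where U: "U = {g \<in> B. q (\<lambda>x. g x - f x) < e}" "f \<in> B" "q \<in> Q" "0 < e"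
        by blast
      show "openin X (T -` U \<inter> topspace X)"
      proof (subst openin_subopen, safe)
        fix x assume x: "T x \<in> U" "x \<in> topspace X"
        define d where "d = e - q (\<lambda>z. T x z - f z)"
        have "0 < d" using x U by (simp add: d_def)
        from R(2)[rule_format, OF x(2) U(3) this]
        obtain V where V: "openin X V" "x \<in> V" "\<forall>y\<in>V. q (\<lambda>z. T y z - T x z) < d"
          by (elim exE conjE)
        have "T y \<in> U" if "y \<in> V" for y
        proof -
          have y: "T y \<in> B" using R(1) V(1) that openin_subset by blast
          have "q (\<lambda>z. T y z - f z) \<le> q (\<lambda>z. T y z - T x z) + q (\<lambda>z. T x z - f z)"
            by (rule tri) (use U R x y in auto)
          also have "\<dots> < e" using V(3) that by (force simp: d_def)
          finally show ?thesis using y U by simp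
        qed
        then show "\<exists>V. openin X V \<and> x \<in> V \<and> V \<subseteq> T -` U \<inter> topspace X"
          using V(1,2) openin_subset[OF V(1)] by (intro exI[of _ V]) auto
      qed
    next
      have "T f \<in> {g \<in> B. q0 (\<lambda>x. g x - T f x) < 1}" if "f \<in> topspace X" for f
        using R(1) that zero[OF q0] by simp
      then show "T ` topspace X \<subseteq> \<Union> {{g \<in> B. q (\<lambda>x. g x - f x) < e} | f q e. f \<in> B \<and> q \<in> Q \<and> 0 < e}"
        using R(1) q0 zero_less_one by blast
    qed
  qed
qed

lemma continuous_map_complex:
  fixes u :: "'b \<Rightarrow> complex"
  assumes "\<And>x e. x \<in> topspace X \<Longrightarrow> 0 < e \<Longrightarrow>
    \<exists>U. openin X U \<and> x \<in> U \<and> (\<forall>y\<in>U. cmod (u y - u x) < e)"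
  shows "continuous_map X euclidean u"
  unfolding continuous_map_def
proof safe
  fix V :: "complex set" assume "openin euclidean V"
  then have V: "open V" by simp
  show "openin X {x \<in> topspace X. u x \<in> V}"
  proof (subst openin_subopen, safe)
    fix x assume x: "x \<in> topspace X" "u x \<in> V"
    obtain e where e: "e > 0" "ball (u x) e \<subseteq> V" using V x(2) open_contains_ball by blast
    from assms[OF x(1) e(1)] obtain U where U: "openin X U" "x \<in> U" "\<forall>y\<in>U. cmod (u y - u x) < e"
      by blast
    have "u y \<in> V" if "y \<in> U" for y 
    proof -
      have "u y \<in> ball (u x) e" using U(3) that by (simp add: dist_norm norm_minus_commute[of "u x"])
      then show ?thesis using e(2) by blast
    qed
    then show "\<exists>T. openin X T \<and> x \<in> T \<and> T \<subseteq> {x \<in> topspace X. u x \<in> V}"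
      using U(1,2) openin_subset[OF U(1)] by blast
  qed
qed simp


section \<open>The pre-Hilbert space of square-integrable functions\<close>

text \<open>The sesquilinear product, linear in the first argument. Elements are functions, so it is
  definite only up to equality almost everywhere.\<close>

definition L2_inner :: "'a measure \<Rightarrow> ('a \<Rightarrow> complex) \<Rightarrow> ('a \<Rightarrow> complex) \<Rightarrow> complex" where
  "L2_inner M f g = (LINT x|M. f x * cnj (g x))"

lemma L2_integrable_square: "f \<in> L2 M \<Longrightarrow> integrable M (\<lambda>x. (cmod (f x))\<^sup>2)"
  by (simp add: L2_def)

lemma L2_I:
  assumes "f \<in> borel_measurable M" "integrable M g" "\<And>x. (cmod (f x))\<^sup>2 \<le> g x"
  shows "f \<in> L2 M"
  unfolding L2_def using assms
  by (auto intro!: Bochner_Integration.integrable_bound[OF assms(2)] simp: order_trans[OF _ abs_ge_self])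

lemma L2_integrable_mult:
  assumes "f \<in> L2 M" "g \<in> L2 M"
  shows "integrable M (\<lambda>x. f x * g x)"
proof (rule Bochner_Integration.integrable_bound)
  show "integrable M (\<lambda>x. (cmod (f x))\<^sup>2 + (cmod (g x))\<^sup>2)"
    using assms by (auto simp: L2_def)
  show "(\<lambda>x. f x * g x) \<in> borel_measurable M" using assms by (auto simp: L2_def)
  have "a * b \<le> a\<^sup>2 + b\<^sup>2" if "a \<ge> 0" "b \<ge> 0" for a b :: real
    using sum_squares_bound[of a b] mult_nonneg_nonneg[OF that] by linarith
  then show "AE x in M. norm (f x * g x) \<le> norm ((cmod (f x))\<^sup>2 + (cmod (g x))\<^sup>2)"
    by (simp add: norm_mult)
qed

lemma L2_zero [simp]: "(\<lambda>x. 0) \<in> L2 M"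
  by (simp add: L2_def)

lemma borel_measurable_cnj [measurable (raw)]:
  "f \<in> borel_measurable M \<Longrightarrow> (\<lambda>x. cnj (f x)) \<in> borel_measurable M"
  by (rule measurable_compose[OF _ borel_measurable_continuous_onI]) (auto intro: continuous_intros)

lemma L2_cnj: "f \<in> L2 M \<Longrightarrow> (\<lambda>x. cnj (f x)) \<in> L2 M"
  by (auto simp: L2_def)

lemma L2_scale: "f \<in> L2 M \<Longrightarrow> (\<lambda>x. c * f x) \<in> L2 M"
  by (auto simp: L2_def norm_mult power_mult_distrib)

lemma L2_add: assumes "f \<in> L2 M" "g \<in> L2 M" shows "(\<lambda>x. f x + g x) \<in> L2 M"
proof (rule L2_I)
  show "(\<lambda>x. f x + g x) \<in> borel_measurable M" using assms by (auto simp: L2_def)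
  show "integrable M (\<lambda>x. 2 * (cmod (f x))\<^sup>2 + 2 * (cmod (g x))\<^sup>2)"
    using assms by (auto simp: L2_def)
  fix x
  have "(cmod (f x + g x))\<^sup>2 \<le> (cmod (f x) + cmod (g x))\<^sup>2"
    by (intro power_mono norm_triangle_ineq) auto
  also have "\<dots> \<le> 2 * (cmod (f x))\<^sup>2 + 2 * (cmod (g x))\<^sup>2"
    using sum_squares_bound[of "cmod (f x)" "cmod (g x)"] by (simp add: power2_sum)
  finally show "(cmod (f x + g x))\<^sup>2 \<le> \<dots>" .
qed

lemma L2_diff: "f \<in> L2 M \<Longrightarrow> g \<in> L2 M \<Longrightarrow> (\<lambda>x. f x - g x) \<in> L2 M"
  using L2_add[OF _ L2_scale[of g M "-1"], of f] by simp

lemma L2_sum: "(\<And>k. k \<in> F \<Longrightarrow> f k \<in> L2 M) \<Longrightarrow> (\<lambda>x. \<Sum>k\<in>F. f k x) \<in> L2 M"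
  by (induction F rule: infinite_finite_induct) (auto intro: L2_add)

lemma L2_inner_commute: "L2_inner M g f = cnj (L2_inner M f g)"
  unfolding L2_inner_def by (subst Bochner_Integration.integral_cnj[symmetric]) (simp add: mult.commute)

lemma L2_inner_add_left:
  "f \<in> L2 M \<Longrightarrow> g \<in> L2 M \<Longrightarrow> h \<in> L2 M \<Longrightarrow>
    L2_inner M (\<lambda>x. f x + g x) h = L2_inner M f h + L2_inner M g h"
  by (simp add: L2_inner_def distrib_right L2_integrable_mult L2_cnj)

lemma L2_inner_scale_left: "L2_inner M (\<lambda>x. c * f x) h = c * L2_inner M f h"
  by (simp add: L2_inner_def mult.assoc)

lemma L2_inner_diff_left:
  "f \<in> L2 M \<Longrightarrow> g \<in> L2 M \<Longrightarrow> h \<in> L2 M \<Longrightarrow>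
    L2_inner M (\<lambda>x. f x - g x) h = L2_inner M f h - L2_inner M g h"
  by (simp add: L2_inner_def left_diff_distrib L2_integrable_mult L2_cnj)

lemma L2_inner_sum_left:
  "(\<And>k. k \<in> F \<Longrightarrow> f k \<in> L2 M) \<Longrightarrow> h \<in> L2 M \<Longrightarrow>
    L2_inner M (\<lambda>x. \<Sum>k\<in>F. f k x) h = (\<Sum>k\<in>F. L2_inner M (f k) h)"
proof (induction F rule: infinite_finite_induct)
  case (insert k F)
  then show ?case by (simp add: L2_inner_add_left L2_sum)
qed (simp_all add: L2_inner_def)

lemma L2_inner_diff_right:
  "f \<in> L2 M \<Longrightarrow> g \<in> L2 M \<Longrightarrow> h \<in> L2 M \<Longrightarrow>
    L2_inner M h (\<lambda>x. f x - g x) = L2_inner M h f - L2_inner M h g"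
  using L2_inner_diff_left[of f M g h] L2_inner_commute[of M h] by simp

lemma L2_inner_add_right:
  "f \<in> L2 M \<Longrightarrow> g \<in> L2 M \<Longrightarrow> h \<in> L2 M \<Longrightarrow>
    L2_inner M h (\<lambda>x. f x + g x) = L2_inner M h f + L2_inner M h g"
  using L2_inner_add_left[of f M g h] L2_inner_commute[of M h] by simp

lemma L2_inner_scale_right: "L2_inner M h (\<lambda>x. c * f x) = cnj c * L2_inner M h f"
  using L2_inner_scale_left[of M c f h] L2_inner_commute[of M h] by simp

lemma L2_inner_sum_right:
  "(\<And>k. k \<in> F \<Longrightarrow> f k \<in> L2 M) \<Longrightarrow> h \<in> L2 M \<Longrightarrow>
    L2_inner M h (\<lambda>x. \<Sum>k\<in>F. f k x) = (\<Sum>k\<in>F. L2_inner M h (f k))"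
  using L2_inner_sum_left[of F f M h] L2_inner_commute[of M h] by simp

lemma L2_norm_nonneg [simp]: "0 \<le> L2_norm M f"
  by (simp add: L2_norm_def)

lemma L2_norm_zero [simp]: "L2_norm M (\<lambda>x. 0) = 0"
  by (simp add: L2_norm_def)

lemma L2_norm_square: "(L2_norm M f)\<^sup>2 = (LINT x|M. (cmod (f x))\<^sup>2)"
  by (simp add: L2_norm_def)

lemma L2_inner_self: "L2_inner M f f = of_real ((L2_norm M f)\<^sup>2)"
  by (simp add: L2_inner_def L2_norm_square flip: complex_norm_square integral_complex_of_real)

lemma L2_norm_scale: "L2_norm M (\<lambda>x. c * f x) = cmod c * L2_norm M f"
  by (simp add: L2_norm_def norm_mult power_mult_distrib real_sqrt_mult)

lemma L2_norm_minus: "L2_norm M (\<lambda>x. f x - g x) = L2_norm M (\<lambda>x. g x - f x)"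
  by (simp add: L2_norm_def norm_minus_commute)

lemma L2_norm_eq_0_iff:
  assumes "f \<in> L2 M" shows "L2_norm M f = 0 \<longleftrightarrow> (AE x in M. f x = 0)"
  using assms
  by (simp add: L2_norm_def integral_nonneg_eq_0_iff_AE[OF L2_integrable_square])

lemma L2_norm_cong_AE:
  assumes "f \<in> L2 M" "g \<in> L2 M" "AE x in M. f x = g x"
  shows "L2_norm M f = L2_norm M g"
proof -
  have [measurable]: "f \<in> borel_measurable M" "g \<in> borel_measurable M"
    using assms by (auto simp: L2_def)
  have "(LINT x|M. (cmod (f x))\<^sup>2) = (LINT x|M. (cmod (g x))\<^sup>2)"
    using assms(3) by (intro integral_cong_AE) auto
  then show ?thesis by (simp add: L2_norm_def)
qed

lemma L2_inner_cong_AE: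
  assumes "f \<in> L2 M" "g \<in> L2 M" "h \<in> L2 M" "k \<in> L2 M" "AE x in M. f x = g x" "AE x in M. h x = k x"
  shows "L2_inner M f h = L2_inner M g k"
proof -
  have [measurable]: "f \<in> borel_measurable M" "g \<in> borel_measurable M"
    "h \<in> borel_measurable M" "k \<in> borel_measurable M" using assms by (auto simp: L2_def)
  show ?thesis unfolding L2_inner_def using assms(5,6) by (intro integral_cong_AE) auto
qed

lemma L2_cauchy_schwarz:
  assumes f: "f \<in> L2 M" and g: "g \<in> L2 M"
  shows "cmod (L2_inner M f g) \<le> L2_norm M f * L2_norm M g"
proof (cases "L2_norm M f = 0 \<or> L2_norm M g = 0")
  case True
  then have "AE x in M. f x * cnj (g x) = 0"
    using f g by (auto simp: L2_norm_eq_0_iff elim: eventually_mono)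
  then have "L2_inner M f g = 0" unfolding L2_inner_def by (rule integral_eq_zero_AE)
  then show ?thesis by simp
next
  case False
  define a b where "a = L2_norm M f" and "b = L2_norm M g"
  have ab: "a > 0" "b > 0" using False by (auto simp: a_def b_def less_le)
  \<comment> \<open>Weighting the two squares by \<open>b / (2 * a)\<close> and \<open>a / (2 * b)\<close> turns the arithmetic-geometric
     mean inequality into the product of the norms.\<close>
  have "cmod (L2_inner M f g) \<le> (LINT x|M. b / (2 * a) * (cmod (f x))\<^sup>2 + a / (2 * b) * (cmod (g x))\<^sup>2)"
    unfolding L2_inner_def
  proof (rule order_trans[OF integral_norm_bound integral_mono])
    show "integrable M (\<lambda>x. norm (f x * cnj (g x)))"
      using f g by (intro integrable_norm L2_integrable_mult L2_cnj)
    show "integrable M (\<lambda>x. b / (2 * a) * (cmod (f x))\<^sup>2 + a / (2 * b) * (cmod (g x))\<^sup>2)"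
      using f g by (intro Bochner_Integration.integrable_add integrable_mult_right) (auto simp: L2_def)
    fix x
    have "0 \<le> (b * cmod (f x) - a * cmod (g x))\<^sup>2 / (2 * a * b)" using ab by simp
    also have "\<dots> = b / (2 * a) * (cmod (f x))\<^sup>2 + a / (2 * b) * (cmod (g x))\<^sup>2 - cmod (f x) * cmod (g x)"
      using ab by (simp add: power2_diff field_simps power2_eq_square)
    finally show "norm (f x * cnj (g x)) \<le> b / (2 * a) * (cmod (f x))\<^sup>2 + a / (2 * b) * (cmod (g x))\<^sup>2"
      by (simp add: norm_mult)
  qed
  also have "\<dots> = b / (2 * a) * a\<^sup>2 + a / (2 * b) * b\<^sup>2"
    using f g by (simp add: L2_integrable_square a_def b_def L2_norm_square)
  also have "\<dots> = a * b" using ab by (simp add: power2_eq_square)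
  finally show ?thesis by (simp add: a_def b_def)
qed

lemma L2_norm_add_square:
  assumes "f \<in> L2 M" "g \<in> L2 M"
  shows "(L2_norm M (\<lambda>x. f x + g x))\<^sup>2 = (L2_norm M f)\<^sup>2 + 2 * Re (L2_inner M f g) + (L2_norm M g)\<^sup>2"
proof -
  have "complex_of_real ((L2_norm M (\<lambda>x. f x + g x))\<^sup>2) =
      L2_inner M f f + L2_inner M f g + (L2_inner M g f + L2_inner M g g)"
    unfolding L2_inner_self[symmetric]
    using assms by (simp add: L2_inner_add_left L2_inner_add_right L2_add)
  then have "Re (complex_of_real ((L2_norm M (\<lambda>x. f x + g x))\<^sup>2)) =
      Re (L2_inner M f f + L2_inner M f g + (L2_inner M g f + L2_inner M g g))" by (rule arg_cong)
  then show ?thesis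
    by (simp only: L2_inner_self plus_complex.sel Re_complex_of_real L2_inner_commute[of M g f] complex_cnj)
       (simp add: algebra_simps)
qed

lemma L2_norm_triangle:
  assumes "f \<in> L2 M" "g \<in> L2 M"
  shows "L2_norm M (\<lambda>x. f x + g x) \<le> L2_norm M f + L2_norm M g"
proof (rule power2_le_imp_le)
  have "Re (L2_inner M f g) \<le> L2_norm M f * L2_norm M g"
    using complex_Re_le_cmod L2_cauchy_schwarz[OF assms] by (rule order_trans)
  then show "(L2_norm M (\<lambda>x. f x + g x))\<^sup>2 \<le> (L2_norm M f + L2_norm M g)\<^sup>2"
    by (simp add: L2_norm_add_square[OF assms] power2_sum)
qed simp

lemma L2_norm_triangle_diff:
  assumes "f \<in> L2 M" "g \<in> L2 M" "h \<in> L2 M"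
  shows "L2_norm M (\<lambda>x. g x - h x) \<le> L2_norm M (\<lambda>x. g x - f x) + L2_norm M (\<lambda>x. f x - h x)"
  using L2_norm_triangle[OF L2_diff[OF assms(2,1)] L2_diff[OF assms(1,3)]] by simp

lemma L2_norm_le_add_diff:
  assumes "f \<in> L2 M" "g \<in> L2 M"
  shows "L2_norm M f \<le> L2_norm M (\<lambda>x. f x - g x) + L2_norm M g"
  using L2_norm_triangle[OF L2_diff[OF assms] assms(2)] by simp

lemma L2_norm_pythagoras:
  assumes "f \<in> L2 M" "g \<in> L2 M" "L2_inner M f g = 0"
  shows "(L2_norm M (\<lambda>x. f x + g x))\<^sup>2 = (L2_norm M f)\<^sup>2 + (L2_norm M g)\<^sup>2"
  by (simp add: L2_norm_add_square[OF assms(1,2)] assms(3))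

lemma tendsto_L2_inner:
  assumes u: "\<And>n. u n \<in> L2 M" "f \<in> L2 M" "(\<lambda>n. L2_norm M (\<lambda>x. f x - u n x)) \<longlonglongrightarrow> 0"
    and v: "\<And>n. v n \<in> L2 M" "g \<in> L2 M" "(\<lambda>n. L2_norm M (\<lambda>x. g x - v n x)) \<longlonglongrightarrow> 0"
  shows "(\<lambda>n. L2_inner M (u n) (v n)) \<longlonglongrightarrow> L2_inner M f g"
proof (rule Lim_transform2[OF tendsto_const])
  let ?a = "\<lambda>n. L2_norm M (\<lambda>x. f x - u n x)" and ?b = "\<lambda>n. L2_norm M (\<lambda>x. g x - v n x)"
  show "(\<lambda>n. L2_inner M f g - L2_inner M (u n) (v n)) \<longlonglongrightarrow> 0"
  proof (rule Lim_null_comparison)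
    show "(\<lambda>n. ?a n * (?b n + L2_norm M g) + L2_norm M f * ?b n) \<longlonglongrightarrow> 0"
      by (auto intro!: tendsto_eq_intros u v)
    have "cmod (L2_inner M f g - L2_inner M (u n) (v n)) \<le> ?a n * (?b n + L2_norm M g) + L2_norm M f * ?b n" for n
    proof -
      have "L2_inner M f g - L2_inner M (u n) (v n) =
          L2_inner M (\<lambda>x. f x - u n x) (v n) + L2_inner M f (\<lambda>x. g x - v n x)"
        using u v by (simp add: L2_inner_diff_left L2_inner_diff_right)
      also have "cmod \<dots> \<le> ?a n * L2_norm M (v n) + L2_norm M f * ?b n"
        by (intro order_trans[OF norm_triangle_ineq] add_mono L2_cauchy_schwarz L2_diff u v)
      also have "L2_norm M (v n) \<le> ?b n + L2_norm M g"
        using L2_norm_le_add_diff[OF v(1)[of n] v(2)] L2_norm_minus[of M g "v n"] by simp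
      finally show ?thesis by (simp add: mult_left_mono)
    qed
    then show "\<forall>\<^sub>F n in sequentially. norm (L2_inner M f g - L2_inner M (u n) (v n)) \<le>
        ?a n * (?b n + L2_norm M g) + L2_norm M f * ?b n"
      by simp
  qed
qed

text \<open>Dominated convergence in quadratic mean.\<close>

lemma L2_dominated_tendsto:
  assumes "f \<in> borel_measurable M" "\<And>n. s n \<in> borel_measurable M" "integrable M w"
    "AE x in M. (\<lambda>n. s n x) \<longlonglongrightarrow> f x" "\<And>n x. (cmod (f x - s n x))\<^sup>2 \<le> w x"
  shows "(\<lambda>n. L2_norm M (\<lambda>x. f x - s n x)) \<longlonglongrightarrow> 0"
proof -
  have "(\<lambda>n. LINT x|M. (cmod (f x - s n x))\<^sup>2) \<longlonglongrightarrow> (LINT x|M. 0)"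
  proof (rule integral_dominated_convergence)
    show "AE x in M. (\<lambda>n. (cmod (f x - s n x))\<^sup>2) \<longlonglongrightarrow> 0"
      using assms(4) by eventually_elim (auto intro!: tendsto_eq_intros)
  qed (use assms in auto)
  from tendsto_real_sqrt[OF this] show ?thesis by (simp add: L2_norm_def)
qed

lemma nn_integral_L2: "f \<in> L2 M \<Longrightarrow> (\<integral>\<^sup>+x. ennreal ((cmod (f x))\<^sup>2) \<partial>M) = ennreal ((L2_norm M f)\<^sup>2)"
  by (simp add: L2_norm_square nn_integral_eq_integral[OF L2_integrable_square])

text \<open>The Riesz--Fischer theorem.\<close>

lemma L2_complete:
  assumes F: "\<And>n. F n \<in> L2 M"
    and cauchy: "\<And>e. 0 < e \<Longrightarrow> \<exists>N. \<forall>m\<ge>N. \<forall>n\<ge>N. L2_norm M (\<lambda>x. F m x - F n x) < e"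
  shows "\<exists>f\<in>L2 M. (\<lambda>n. L2_norm M (\<lambda>x. f x - F n x)) \<longlonglongrightarrow> 0"
proof -
  have "\<forall>k. \<exists>N. \<forall>m\<ge>N. \<forall>n\<ge>N. L2_norm M (\<lambda>x. F m x - F n x) < (1/2)^k"
    using cauchy by simp
  then obtain N where N: "\<And>k m n. m \<ge> N k \<Longrightarrow> n \<ge> N k \<Longrightarrow> L2_norm M (\<lambda>x. F m x - F n x) < (1/2)^k"
    by metis
  \<comment> \<open>The subsequence \<open>F (r k)\<close> has increments of norm at most \<open>(1/2)^k\<close>.\<close>
  define r where "r k = (\<Sum>j\<le>k. N j) + k" for k
  define G where "G k = F (r k)" for k
  have r_ge: "r j \<ge> N k" "r j \<ge> k" if "j \<ge> k" for j k
    using member_le_sum[of k "{..j}" N] that by (auto simp: r_def)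
  have G: "G k \<in> L2 M" for k by (simp add: G_def F)
  have [measurable]: "G k \<in> borel_measurable M" "F k \<in> borel_measurable M" for k
    using G F by (auto simp: L2_def)
  \<comment> \<open>The factor \<open>2^k\<close> still leaves a finite integral, and it makes the increments summable
     almost everywhere.\<close>
  have "(\<integral>\<^sup>+x. (\<Sum>k. ennreal (2^k * (cmod (G (Suc k) x - G k x))\<^sup>2)) \<partial>M) =
      (\<Sum>k. \<integral>\<^sup>+x. ennreal (2^k * (cmod (G (Suc k) x - G k x))\<^sup>2) \<partial>M)"
    by (rule nn_integral_suminf) simp
  also have "\<dots> \<le> (\<Sum>k. ennreal ((1/2)^k))"
  proof (rule suminf_le)
    fix k
    have D: "(\<lambda>x. G (Suc k) x - G k x) \<in> L2 M" using G by (intro L2_diff)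
    have "(\<integral>\<^sup>+x. ennreal (2^k * (cmod (G (Suc k) x - G k x))\<^sup>2) \<partial>M)
        = ennreal (2^k) * (\<integral>\<^sup>+x. ennreal ((cmod (G (Suc k) x - G k x))\<^sup>2) \<partial>M)"
      by (simp add: ennreal_mult nn_integral_cmult)
    also have "\<dots> = ennreal (2^k * (L2_norm M (\<lambda>x. G (Suc k) x - G k x))\<^sup>2)"
      by (simp add: nn_integral_L2[OF D] ennreal_mult)
    also have "\<dots> \<le> ennreal (2^k * ((1/2)^k)\<^sup>2)"
      using less_imp_le[OF N[of k "r (Suc k)" "r k"]] r_ge
      by (intro ennreal_leI mult_left_mono power_mono) (auto simp: G_def)
    also have "2^k * ((1/2)^k)\<^sup>2 = ((1/2)^k :: real)"
      by (simp add: power2_eq_square power_mult_distrib[symmetric] mult.assoc[symmetric])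
    finally show "(\<integral>\<^sup>+x. ennreal (2^k * (cmod (G (Suc k) x - G k x))\<^sup>2) \<partial>M) \<le> ennreal ((1/2)^k)" .
  qed auto
  also have "\<dots> < \<infinity>"
    by (subst suminf_ennreal2) (auto simp: summable_geometric)
  finally have "AE x in M. (\<Sum>k. ennreal (2^k * (cmod (G (Suc k) x - G k x))\<^sup>2)) \<noteq> \<infinity>"
    by (intro nn_integral_PInf_AE) auto
  then have conv: "AE x in M. convergent (\<lambda>k. G k x)"
  proof eventually_elim
    case (elim x)
    let ?d = "\<lambda>k. cmod (G (Suc k) x - G k x)"
    have sm: "summable (\<lambda>k. 2^k * (?d k)\<^sup>2)"
      using elim by (intro summable_suminf_not_top) auto
    then obtain S where S: "\<And>k. 2^k * (?d k)\<^sup>2 \<le> S"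
      using summable_LIMSEQ_zero[OF sm, THEN convergentI, THEN convergent_imp_Bseq]
      by (auto simp: Bseq_def norm_mult) 
    have "?d k \<le> sqrt S * (1 / sqrt 2) ^ k" for k
    proof -
      have "(?d k)\<^sup>2 \<le> S / 2^k" using S[of k] by (simp add: field_simps)
      then have "?d k \<le> sqrt (S / 2^k)" by (rule real_le_rsqrt)
      also have "sqrt (S / 2^k) = sqrt S * (1 / sqrt 2) ^ k"
        unfolding real_sqrt_divide real_sqrt_power power_one_over by simp
      finally show ?thesis .
    qed
    then have "norm (G (Suc k) x - G k x) \<le> sqrt S * (1 / sqrt 2) ^ k" if "k \<ge> 0" for k
      by blast
    moreover have "norm (1 / sqrt 2) < 1" by simp
    then have "summable (\<lambda>k. sqrt S * (1 / sqrt 2) ^ k)" by (intro summable_mult summable_geometric)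
    ultimately have "summable (\<lambda>k. G (Suc k) x - G k x)" by (rule summable_comparison_test'[rotated])
    then have "convergent (\<lambda>n. \<Sum>k<n. G (Suc k) x - G k x)"
      by (simp add: summable_iff_convergent)
    then have "convergent (\<lambda>n. (G n x - G 0 x) + G 0 x)"
      by (intro convergent_add convergent_const) (simp add: sum_lessThan_telescope[of "\<lambda>k. G k x"])
    then show ?case by simp
  qed
  define f where "f x = lim (\<lambda>k. G k x)" for x
  have [measurable]: "f \<in> borel_measurable M"
    unfolding f_def by (rule borel_measurable_lim_metric) simp
  \<comment> \<open>Fatou's lemma gives the rate of convergence of the original sequence.\<close>
  have bound: "(\<integral>\<^sup>+x. ennreal ((cmod (f x - F n x))\<^sup>2) \<partial>M) \<le> ennreal (((1/2)^k)\<^sup>2)" if "n \<ge> N k" for n k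
  proof -
    have "(\<integral>\<^sup>+x. ennreal ((cmod (f x - F n x))\<^sup>2) \<partial>M) =
        (\<integral>\<^sup>+x. liminf (\<lambda>j. ennreal ((cmod (G j x - F n x))\<^sup>2)) \<partial>M)"
    proof (rule nn_integral_cong_AE, use conv in eventually_elim)
      case (elim x)
      then have "(\<lambda>j. G j x) \<longlonglongrightarrow> f x" by (simp add: f_def convergent_LIMSEQ_iff)
      then have "(\<lambda>j. ennreal ((cmod (G j x - F n x))\<^sup>2)) \<longlonglongrightarrow> ennreal ((cmod (f x - F n x))\<^sup>2)"
        by (intro tendsto_intros)
      then show ?case by (rule lim_imp_Liminf[symmetric, OF sequentially_bot])
    qed
    also have "\<dots> \<le> liminf (\<lambda>j. \<integral>\<^sup>+x. ennreal ((cmod (G j x - F n x))\<^sup>2) \<partial>M)"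
      by (rule nn_integral_liminf) simp
    also have "\<dots> \<le> liminf (\<lambda>j::nat. ennreal (((1/2)^k)\<^sup>2))"
    proof (rule Liminf_mono, rule eventually_sequentiallyI)
      fix j assume "k \<le> j"
      have "(\<integral>\<^sup>+x. ennreal ((cmod (G j x - F n x))\<^sup>2) \<partial>M) = ennreal ((L2_norm M (\<lambda>x. G j x - F n x))\<^sup>2)"
        by (rule nn_integral_L2) (intro L2_diff G F)
      also have "\<dots> \<le> ennreal (((1/2)^k)\<^sup>2)"
        using less_imp_le[OF N[of k "r j" n]] r_ge[OF \<open>k \<le> j\<close>] that
        by (intro ennreal_leI power_mono) (auto simp: G_def)
      finally show "(\<integral>\<^sup>+x. ennreal ((cmod (G j x - F n x))\<^sup>2) \<partial>M) \<le> ennreal (((1/2)^k)\<^sup>2)" .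
    qed
    also have "\<dots> = ennreal (((1/2)^k)\<^sup>2)" by (simp add: Liminf_const)
    finally show ?thesis .
  qed
  have D: "(\<lambda>x. f x - F (N 0) x) \<in> L2 M"
    unfolding L2_def using bound[of 0 "N 0"]
    by (auto intro!: integrableI_nonneg simp: order_le_less_trans[OF _ ennreal_one_less_top])
  have f: "f \<in> L2 M" using L2_add[OF D F[of "N 0"]] by simp
  have "\<exists>n0. \<forall>n\<ge>n0. norm (L2_norm M (\<lambda>x. f x - F n x) - 0) < e" if "0 < e" for e
  proof -
    obtain k where k: "(1/2)^k < e" using real_arch_pow_inv[OF \<open>0 < e\<close>, of "1/2"] by auto
    have "L2_norm M (\<lambda>x. f x - F n x) < e" if "n \<ge> N k" for n
    proof -
      have "ennreal ((L2_norm M (\<lambda>x. f x - F n x))\<^sup>2) \<le> ennreal (((1/2)^k)\<^sup>2)"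
        using bound[OF that] nn_integral_L2[OF L2_diff[OF f F[of n]]] by simp
      then have "(L2_norm M (\<lambda>x. f x - F n x))\<^sup>2 \<le> ((1/2)^k)\<^sup>2" by (subst (asm) ennreal_le_iff) auto
      then have "L2_norm M (\<lambda>x. f x - F n x) \<le> (1/2)^k" by (rule power2_le_imp_le) simp
      then show ?thesis using k by simp
    qed
    then show ?thesis by (intro exI[of _ "N k"]) simp
  qed
  then have "(\<lambda>n. L2_norm M (\<lambda>x. f x - F n x)) \<longlonglongrightarrow> 0" by (intro LIMSEQ_I)
  then show ?thesis using f by blast
qed

text \<open>Composition with a measure-preserving map is isometric.\<close>

lemma L2_distr:
  assumes T: "T \<in> measurable P M" and d: "distr P M T = M"
  shows L2_compose: "f \<in> L2 M \<Longrightarrow> (\<lambda>\<omega>. f (T \<omega>)) \<in> L2 P"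
    and L2_inner_compose: "f \<in> L2 M \<Longrightarrow> g \<in> L2 M \<Longrightarrow> L2_inner P (\<lambda>\<omega>. f (T \<omega>)) (\<lambda>\<omega>. g (T \<omega>)) = L2_inner M f g"
    and L2_norm_compose: "f \<in> L2 M \<Longrightarrow> L2_norm P (\<lambda>\<omega>. f (T \<omega>)) = L2_norm M f"
proof -
  assume f: "f \<in> L2 M"
  then have fm: "f \<in> borel_measurable M" by (simp add: L2_def)
  have "integrable P (\<lambda>\<omega>. (cmod (f (T \<omega>)))\<^sup>2)"
    using integrable_distr[OF T, of "\<lambda>x. (cmod (f x))\<^sup>2"] f by (simp add: d L2_def)
  then show "(\<lambda>\<omega>. f (T \<omega>)) \<in> L2 P" using measurable_compose[OF T fm] by (simp add: L2_def)
  show "L2_norm P (\<lambda>\<omega>. f (T \<omega>)) = L2_norm M f"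
    using integral_distr[OF T, of "\<lambda>x. (cmod (f x))\<^sup>2"] fm by (simp add: d L2_norm_def)
  assume g: "g \<in> L2 M"
  then have [measurable]: "g \<in> borel_measurable M" "f \<in> borel_measurable M" using f by (auto simp: L2_def)
  show "L2_inner P (\<lambda>\<omega>. f (T \<omega>)) (\<lambda>\<omega>. g (T \<omega>)) = L2_inner M f g"
    using integral_distr[OF T, of "\<lambda>x. f x * cnj (g x)"] by (simp add: d L2_inner_def)
qed


section \<open>Closed spans\<close>

text \<open>The closure of a set of functions in \<open>L\<^sup>2\<close>.\<close>

definition L2_closure :: "'a measure \<Rightarrow> ('a \<Rightarrow> complex) set \<Rightarrow> ('a \<Rightarrow> complex) set" where
  "L2_closure M G = {f \<in> L2 M. \<forall>e>0. \<exists>g\<in>G. L2_norm M (\<lambda>x. f x - g x) < e}"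

lemma L2_closure_superset: "g \<in> G \<Longrightarrow> G \<subseteq> L2 M \<Longrightarrow> g \<in> L2_closure M G"
  by (auto simp: L2_closure_def intro!: bexI[of _ g])

lemma L2_closure_closed:
  assumes "G \<subseteq> L2 M" "f \<in> L2 M" "\<And>e. 0 < e \<Longrightarrow> \<exists>g\<in>L2_closure M G. L2_norm M (\<lambda>x. f x - g x) < e"
  shows "f \<in> L2_closure M G"
  unfolding L2_closure_def
proof safe
  fix e :: real assume "0 < e"
  then obtain g where g: "g \<in> L2_closure M G" "L2_norm M (\<lambda>x. f x - g x) < e / 2"
    using assms(3)[of "e / 2"] by auto
  then obtain h where h: "h \<in> G" "L2_norm M (\<lambda>x. g x - h x) < e / 2"
    using \<open>0 < e\<close> by (auto simp: L2_closure_def dest: spec[of _ "e / 2"])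
  have "L2_norm M (\<lambda>x. f x - h x) < e"
    using L2_norm_triangle_diff[of g M f h] g h assms by (auto simp: L2_closure_def)
  then show "\<exists>g\<in>G. L2_norm M (\<lambda>x. f x - g x) < e" using h by blast
qed (use assms in auto)

lemma L2_closure_tendsto:
  assumes "G \<subseteq> L2 M" "f \<in> L2 M" "\<And>n. g n \<in> L2_closure M G"
    "(\<lambda>n. L2_norm M (\<lambda>x. f x - g n x)) \<longlonglongrightarrow> 0"
  shows "f \<in> L2_closure M G"
proof (rule L2_closure_closed[OF assms(1,2)])
  fix e :: real assume "0 < e"
  then have "\<forall>\<^sub>F n in sequentially. L2_norm M (\<lambda>x. f x - g n x) < e"
    using order_tendstoD(2)[OF assms(4)] by blast
  then show "\<exists>g\<in>L2_closure M G. L2_norm M (\<lambda>x. f x - g x) < e"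
    using assms(3) eventually_happens'[OF sequentially_bot] by blast
qed

lemma L2_closure_lincomb:
  assumes G: "G \<subseteq> L2 M" "\<And>f g a b. f \<in> G \<Longrightarrow> g \<in> G \<Longrightarrow> (\<lambda>x. a * f x + b * g x) \<in> G"
    and f: "f \<in> L2_closure M G" and g: "g \<in> L2_closure M G"
  shows "(\<lambda>x. a * f x + b * g x) \<in> L2_closure M G"
  unfolding L2_closure_def
proof safe
  show "(\<lambda>x. a * f x + b * g x) \<in> L2 M"
    using f g by (intro L2_add L2_scale) (auto simp: L2_closure_def)
  fix e :: real assume "0 < e"
  define d where "d = e / (cmod a + cmod b + 1)"
  have pos: "cmod a + cmod b + 1 > 0" by (smt (verit) norm_ge_zero)
  have d: "d > 0" using pos \<open>0 < e\<close> by (simp add: d_def)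
  obtain u where u: "u \<in> G" "L2_norm M (\<lambda>x. f x - u x) < d"
    using f d by (auto simp: L2_closure_def)
  obtain v where v: "v \<in> G" "L2_norm M (\<lambda>x. g x - v x) < d"
    using g d by (auto simp: L2_closure_def)
  have L2: "f \<in> L2 M" "g \<in> L2 M" "u \<in> L2 M" "v \<in> L2 M"
    using f g u v G by (auto simp: L2_closure_def)
  have "L2_norm M (\<lambda>x. (a * f x + b * g x) - (a * u x + b * v x)) =
      L2_norm M (\<lambda>x. a * (f x - u x) + b * (g x - v x))"
    by (simp add: algebra_simps)
  also have "\<dots> \<le> cmod a * L2_norm M (\<lambda>x. f x - u x) + cmod b * L2_norm M (\<lambda>x. g x - v x)"
    unfolding L2_norm_scale[symmetric] using L2 by (intro L2_norm_triangle L2_scale L2_diff)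
  also have "\<dots> \<le> cmod a * d + cmod b * d"
    using u v by (intro add_mono mult_left_mono) auto
  also have "\<dots> < (cmod a + cmod b + 1) * d" using d by (simp add: algebra_simps)
  also have "\<dots> = e" using pos by (simp add: d_def)
  finally show "\<exists>h\<in>G. L2_norm M (\<lambda>x. a * f x + b * g x - h x) < e"
    by (intro bexI[of _ "\<lambda>x. a * u x + b * v x"] G(2)[OF u(1) v(1)])
qed

lemma L2_closure_sum:
  assumes G: "G \<subseteq> L2 M" "\<And>f g a b. f \<in> G \<Longrightarrow> g \<in> G \<Longrightarrow> (\<lambda>x. a * f x + b * g x) \<in> G" "G \<noteq> {}"
    and f: "\<And>k. k \<in> F \<Longrightarrow> f k \<in> L2_closure M G"
  shows "(\<lambda>x. \<Sum>k\<in>F. a k * f k x) \<in> L2_closure M G"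
proof -
  obtain g where "g \<in> G" using G by blast
  from G(2)[OF this this, of 0 0] have "(\<lambda>x. 0) \<in> G" by simp
  then have 0: "(\<lambda>x. 0) \<in> L2_closure M G" by (rule L2_closure_superset[OF _ G(1)])
  show ?thesis using f
  proof (induction F rule: infinite_finite_induct)
    case (insert k F)
    then have "(\<lambda>x. a k * f k x + 1 * (\<Sum>k\<in>F. a k * f k x)) \<in> L2_closure M G"
      by (intro L2_closure_lincomb G) auto
    then show ?case using insert by simp
  qed (simp_all add: 0)
qed

text \<open>Finite linear combinations of a family of functions.\<close>

definition fun_span :: "('i \<Rightarrow> 'a \<Rightarrow> complex) \<Rightarrow> ('a \<Rightarrow> complex) set" where
  "fun_span y = {\<lambda>x. \<Sum>k\<in>F. a k * y k x | F a. finite F}"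

lemma fun_span_L2: "(\<And>k. y k \<in> L2 M) \<Longrightarrow> fun_span y \<subseteq> L2 M"
  by (auto simp: fun_span_def intro!: L2_sum L2_scale)

lemma fun_span_lincomb:
  assumes "f \<in> fun_span y" "g \<in> fun_span y"
  shows "(\<lambda>x. a * f x + b * g x) \<in> fun_span y"
proof -
  obtain F c where f: "finite F" "f = (\<lambda>x. \<Sum>k\<in>F. c k * y k x)" using assms(1) by (auto simp: fun_span_def)
  obtain H d where g: "finite H" "g = (\<lambda>x. \<Sum>k\<in>H. d k * y k x)" using assms(2) by (auto simp: fun_span_def)
  define c' where "c' k = (if k \<in> F then c k else 0)" for k
  define d' where "d' k = (if k \<in> H then d k else 0)" for k
  have "f x = (\<Sum>k\<in>F \<union> H. c' k * y k x)" for x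
    unfolding f(2) using f(1) g(1) by (intro sum.mono_neutral_cong_left) (auto simp: c'_def)
  moreover have "g x = (\<Sum>k\<in>F \<union> H. d' k * y k x)" for x
    unfolding g(2) using f(1) g(1) by (intro sum.mono_neutral_cong_left) (auto simp: d'_def)
  ultimately have "(\<lambda>x. a * f x + b * g x) = (\<lambda>x. \<Sum>k\<in>F \<union> H. (a * c' k + b * d' k) * y k x)"
    by (simp add: sum_distrib_left sum.distrib algebra_simps)
  then show ?thesis using f(1) g(1) unfolding fun_span_def
    by (intro CollectI exI[of _ "F \<union> H"] exI[of _ "\<lambda>k. a * c' k + b * d' k"]) auto
qed

lemma fun_span_base: "y k \<in> fun_span y"
  unfolding fun_span_def by (intro CollectI exI[of _ "{k}"] exI[of _ "\<lambda>_. 1"]) auto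

text \<open>Transitivity of approximation: this transfers totality from one family to another.\<close>

lemma L2_closure_fun_span_mono:
  assumes y: "\<And>k. y k \<in> L2_closure M (fun_span e)" and e: "\<And>k. e k \<in> L2 M"
    and f: "f \<in> L2_closure M (fun_span y)"
  shows "f \<in> L2_closure M (fun_span e)"
proof (rule L2_closure_closed)
  show "fun_span e \<subseteq> L2 M" by (rule fun_span_L2[OF e])
  show "f \<in> L2 M" using f by (simp add: L2_closure_def)
  fix d :: real assume "0 < d"
  then obtain F a where "L2_norm M (\<lambda>x. f x - (\<Sum>k\<in>F. a k * y k x)) < d"
    using f by (force simp: L2_closure_def fun_span_def)
  moreover have "(\<lambda>x. \<Sum>k\<in>F. a k * y k x) \<in> L2_closure M (fun_span e)"
    using fun_span_L2[of e, OF e] fun_span_base[of e] by (intro L2_closure_sum fun_span_lincomb y) auto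
  ultimately show "\<exists>g\<in>L2_closure M (fun_span e). L2_norm M (\<lambda>x. f x - g x) < d"
    by (rule bexI)
qed


section \<open>Orthogonal expansions\<close>

text \<open>Pairwise orthogonal vectors that are each of norm one or negligible. Zero vectors are
  admitted because Gram--Schmidt without renumbering produces them.\<close>

definition orthosystem :: "'a measure \<Rightarrow> (nat \<Rightarrow> 'a \<Rightarrow> complex) \<Rightarrow> bool" where
  "orthosystem M e \<longleftrightarrow> (\<forall>k. e k \<in> L2 M \<and> L2_norm M (e k) \<in> {0, 1}) \<and>
     (\<forall>j k. j \<noteq> k \<longrightarrow> L2_inner M (e j) (e k) = 0)"

lemma orthosystem_L2: "orthosystem M e \<Longrightarrow> e k \<in> L2 M"
  by (simp add: orthosystem_def)

lemma orthosystem_sum_L2: "orthosystem M e \<Longrightarrow> (\<lambda>x. \<Sum>k\<in>F. a k * e k x) \<in> L2 M"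
  by (intro L2_sum L2_scale orthosystem_L2)

lemma L2_inner_norm_0:
  assumes "f \<in> L2 M" "g \<in> L2 M" "L2_norm M g = 0"
  shows "L2_inner M f g = 0"
  using L2_cauchy_schwarz[OF assms(1,2)] assms(3) by simp

lemma orthosystem_inner_sum:
  assumes e: "orthosystem M e" and "finite F" "j \<in> F"
  shows "L2_inner M (\<lambda>x. \<Sum>k\<in>F. a k * e k x) (e j) = a j * of_real (L2_norm M (e j))"
proof -
  have "L2_inner M (\<lambda>x. \<Sum>k\<in>F. a k * e k x) (e j) = (\<Sum>k\<in>F. a k * L2_inner M (e k) (e j))"
    using e by (subst L2_inner_sum_left) (auto intro: L2_scale simp: orthosystem_def L2_inner_scale_left)
  also have "\<dots> = (\<Sum>k\<in>F. if k = j then a j * L2_inner M (e j) (e j) else 0)"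
    using e by (intro sum.cong) (auto simp: orthosystem_def)
  also have "L2_inner M (e j) (e j) = of_real (L2_norm M (e j))"
    using e by (auto simp: orthosystem_def L2_inner_self power2_eq_square
        simp flip: of_real_mult dest: spec[of _ j])
  finally show ?thesis using assms by simp
qed

lemma orthosystem_inner_sums:
  assumes e: "orthosystem M e" and "finite F"
  shows "L2_inner M (\<lambda>x. \<Sum>k\<in>F. a k * e k x) (\<lambda>x. \<Sum>k\<in>F. b k * e k x) =
      (\<Sum>k\<in>F. a k * cnj (b k) * of_real (L2_norm M (e k)))"
proof -
  have "L2_inner M (\<lambda>x. \<Sum>k\<in>F. a k * e k x) (\<lambda>x. \<Sum>k\<in>F. b k * e k x) =
      (\<Sum>j\<in>F. cnj (b j) * L2_inner M (\<lambda>x. \<Sum>k\<in>F. a k * e k x) (e j))"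
    using e by (subst L2_inner_sum_right)
       (auto intro: L2_scale orthosystem_sum_L2 simp: orthosystem_L2 L2_inner_scale_right)
  then show ?thesis
    using assms by (simp add: orthosystem_inner_sum mult_ac)
qed

text \<open>Coefficients along negligible vectors vanish, so the normalising factor can be dropped.\<close>

lemma orthosystem_coeff_norm:
  assumes "orthosystem M e" "f \<in> L2 M"
  shows "L2_inner M f (e k) * of_real (L2_norm M (e k)) = L2_inner M f (e k)"
  using assms L2_inner_norm_0[OF assms(2), of "e k"]
  by (cases "L2_norm M (e k) = 0") (auto simp: orthosystem_def dest: spec[of _ k])

text \<open>Bessel's inequality, and the best approximation property of the partial sums.\<close>

lemma bessel:
  assumes e: "orthosystem M e" and f: "f \<in> L2 M" and F: "finite F"
  shows "(\<Sum>k\<in>F. (cmod (L2_inner M f (e k)))\<^sup>2) \<le> (L2_norm M f)\<^sup>2"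
    and "L2_norm M (\<lambda>x. f x - (\<Sum>k\<in>F. L2_inner M f (e k) * e k x))
      \<le> L2_norm M (\<lambda>x. f x - (\<Sum>k\<in>F. a k * e k x))"
proof -
  let ?S = "\<lambda>a x. \<Sum>k\<in>F. a k * e k x" and ?c = "\<lambda>k. L2_inner M f (e k)"
  let ?r = "\<lambda>x. f x - ?S ?c x"
  have S: "?S a \<in> L2 M" for a using e by (rule orthosystem_sum_L2)
  have r: "?r \<in> L2 M" by (intro L2_diff f S)
  have "L2_inner M ?r (e j) = 0" if "j \<in> F" for j
    using orthosystem_inner_sum[OF e F that, of ?c] orthosystem_coeff_norm[OF e f]
    by (simp add: L2_inner_diff_left f S orthosystem_L2[OF e])
  then have orth: "L2_inner M ?r (?S a) = 0" for a
    using e r by (subst L2_inner_sum_right)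
      (auto intro: L2_scale simp: orthosystem_L2 L2_inner_scale_right)
  have pyth: "(L2_norm M (\<lambda>x. f x - ?S a x))\<^sup>2 =
      (L2_norm M ?r)\<^sup>2 + (L2_norm M (?S (\<lambda>k. ?c k - a k)))\<^sup>2" for a
  proof -
    have "(\<lambda>x. ?r x + ?S (\<lambda>k. ?c k - a k) x) = (\<lambda>x. f x - ?S a x)"
      by (simp add: left_diff_distrib sum_subtractf)
    then show ?thesis using L2_norm_pythagoras[OF r S orth, of "\<lambda>k. ?c k - a k"] by simp
  qed
  have "(L2_norm M ?r)\<^sup>2 \<le> (L2_norm M (\<lambda>x. f x - ?S a x))\<^sup>2"
    unfolding pyth[of a] by simp
  then show "L2_norm M ?r \<le> L2_norm M (\<lambda>x. f x - ?S a x)"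
    by (rule power2_le_imp_le) simp
  have "complex_of_real ((L2_norm M (?S ?c))\<^sup>2) = (\<Sum>k\<in>F. ?c k * of_real (L2_norm M (e k)) * cnj (?c k))"
    unfolding L2_inner_self[symmetric] orthosystem_inner_sums[OF e F] by (simp add: mult_ac)
  also have "\<dots> = complex_of_real (\<Sum>k\<in>F. (cmod (?c k))\<^sup>2)"
    unfolding orthosystem_coeff_norm[OF e f] by (simp add: complex_norm_square del: of_real_power)
  finally have "(L2_norm M (?S ?c))\<^sup>2 = (\<Sum>k\<in>F. (cmod (?c k))\<^sup>2)" by (simp only: of_real_eq_iff)
  then show "(\<Sum>k\<in>F. (cmod (?c k))\<^sup>2) \<le> (L2_norm M f)\<^sup>2"
    using pyth[of "\<lambda>_. 0"] by simp
qed

lemma bessel_summable: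
  assumes "orthosystem M e" "f \<in> L2 M"
  shows "summable (\<lambda>k. (cmod (L2_inner M f (e k)))\<^sup>2)"
  by (rule summableI_nonneg_bounded[where x = "(L2_norm M f)\<^sup>2"])
     (auto intro: bessel(1)[OF assms])

text \<open>Convergence in quadratic mean of the series \<open>\<Sum>k. c k * e k\<close> to \<open>f\<close>.\<close>

definition L2_sums :: "'a measure \<Rightarrow> (nat \<Rightarrow> 'a \<Rightarrow> complex) \<Rightarrow> (nat \<Rightarrow> complex) \<Rightarrow> ('a \<Rightarrow> complex) \<Rightarrow> bool" where
  "L2_sums M e c f \<longleftrightarrow> f \<in> L2 M \<and>
     (\<lambda>n. L2_norm M (\<lambda>x. f x - (\<Sum>k<n. c k * e k x))) \<longlonglongrightarrow> 0"

lemma L2_sums_L2: "L2_sums M e c f \<Longrightarrow> f \<in> L2 M"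
  by (simp add: L2_sums_def)

lemma L2_sums_expansion:
  assumes e: "orthosystem M e" and f: "f \<in> L2_closure M (fun_span e)"
  shows "L2_sums M e (\<lambda>k. L2_inner M f (e k)) f"
  unfolding L2_sums_def
proof safe
  show fL: "f \<in> L2 M" using f by (simp add: L2_closure_def)
  show "(\<lambda>n. L2_norm M (\<lambda>x. f x - (\<Sum>k<n. L2_inner M f (e k) * e k x))) \<longlonglongrightarrow> 0"
  proof (rule LIMSEQ_I)
    fix d :: real assume "0 < d"
    then obtain F a where F: "finite F" "L2_norm M (\<lambda>x. f x - (\<Sum>k\<in>F. a k * e k x)) < d"
      using f by (force simp: L2_closure_def fun_span_def)
    obtain n0 where n0: "F \<subseteq> {..<n0}" using finite_nat_iff_bounded F(1) by blast
    have "L2_norm M (\<lambda>x. f x - (\<Sum>k<n. L2_inner M f (e k) * e k x)) < d" if "n \<ge> n0" for n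
    proof -
      define a' where "a' k = (if k \<in> F then a k else 0)" for k
      have "(\<Sum>k<n. a' k * e k x) = (\<Sum>k\<in>F. a k * e k x)" for x
        using n0 that by (intro sum.mono_neutral_cong_right) (auto simp: a'_def)
      then show ?thesis using bessel(2)[OF e fL, of "{..<n}" a'] F(2) by simp
    qed
    then show "\<exists>n0. \<forall>n\<ge>n0. norm (L2_norm M (\<lambda>x. f x - (\<Sum>k<n. L2_inner M f (e k) * e k x)) - 0) < d"
      by auto
  qed
qed

lemma L2_sums_exists:
  assumes e: "orthosystem M e" and c: "summable (\<lambda>k. (cmod (c k))\<^sup>2)"
  shows "\<exists>f. L2_sums M e c f"
proof -
  let ?S = "\<lambda>n x. \<Sum>k<n. c k * e k x"
  have S: "?S n \<in> L2 M" for n by (rule orthosystem_sum_L2[OF e])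
  have le: "(L2_norm M (\<lambda>x. ?S n x - ?S m x))\<^sup>2 \<le> (\<Sum>k\<in>{m..<n}. (cmod (c k))\<^sup>2)" if "m \<le> n" for m n
  proof -
    have "?S n x - ?S m x = (\<Sum>k\<in>{m..<n}. c k * e k x)" for x
      using sum_diff_nat_ivl[of 0 m n "\<lambda>k. c k * e k x"] that by (simp add: atLeast0LessThan)
    then have "complex_of_real ((L2_norm M (\<lambda>x. ?S n x - ?S m x))\<^sup>2) =
        (\<Sum>k\<in>{m..<n}. c k * cnj (c k) * of_real (L2_norm M (e k)))"
      by (simp only: L2_inner_self[symmetric] orthosystem_inner_sums[OF e] finite_atLeastLessThan)
    also have "\<dots> = complex_of_real (\<Sum>k\<in>{m..<n}. (cmod (c k))\<^sup>2 * L2_norm M (e k))"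
      by (simp add: complex_norm_square[symmetric])
    finally have "(L2_norm M (\<lambda>x. ?S n x - ?S m x))\<^sup>2 = (\<Sum>k\<in>{m..<n}. (cmod (c k))\<^sup>2 * L2_norm M (e k))"
      by (simp only: of_real_eq_iff)
    also have "\<dots> \<le> (\<Sum>k\<in>{m..<n}. (cmod (c k))\<^sup>2)"
    proof (rule sum_mono)
      fix k
      have "L2_norm M (e k) \<le> 1" using e by (auto simp: orthosystem_def dest: spec[of _ k])
      then show "(cmod (c k))\<^sup>2 * L2_norm M (e k) \<le> (cmod (c k))\<^sup>2" by (rule mult_left_le) simp
    qed
    finally show ?thesis .
  qed
  have "\<exists>N. \<forall>m\<ge>N. \<forall>n\<ge>N. L2_norm M (\<lambda>x. ?S m x - ?S n x) < d" if "0 < d" for d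
  proof -
    obtain N where N: "\<And>m n. m \<ge> N \<Longrightarrow> norm (\<Sum>k\<in>{m..<n}. (cmod (c k))\<^sup>2) < d\<^sup>2"
      using c[unfolded summable_Cauchy] \<open>0 < d\<close> by (meson zero_less_power)
    have "L2_norm M (\<lambda>x. ?S n x - ?S m x) < d" if "m \<ge> N" "m \<le> n" for m n
    proof -
      have "(L2_norm M (\<lambda>x. ?S n x - ?S m x))\<^sup>2 < d\<^sup>2"
        using le[OF that(2)] N[OF that(1), of n] by simp
      then show ?thesis using \<open>0 < d\<close> by (simp add: power_less_imp_less_base)
    qed
    note * = this
    have "L2_norm M (\<lambda>x. ?S m x - ?S n x) < d" if "m \<ge> N" "n \<ge> N" for m n
    proof (cases "m \<le> n")
      case True
      then show ?thesis
        using *[OF that(1) True] L2_norm_minus[of M "?S m" "?S n"] by linarith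
    qed (use *[of n m] that in simp)
    then show ?thesis by blast
  qed
  from L2_complete[of ?S, OF S this] show ?thesis by (auto simp: L2_sums_def)
qed

lemma L2_sums_lincomb:
  assumes e: "\<And>k. e k \<in> L2 M" and f: "L2_sums M e c f" and g: "L2_sums M e d g"
  shows "L2_sums M e (\<lambda>k. a * c k + b * d k) (\<lambda>x. a * f x + b * g x)"
  unfolding L2_sums_def
proof
  note L2 = f[THEN L2_sums_L2] g[THEN L2_sums_L2]
  show "(\<lambda>x. a * f x + b * g x) \<in> L2 M" using L2 by (intro L2_add L2_scale)
  let ?r = "\<lambda>f c n. L2_norm M (\<lambda>x. f x - (\<Sum>k<n. c k * e k x))"
  show "(\<lambda>n. ?r (\<lambda>x. a * f x + b * g x) (\<lambda>k. a * c k + b * d k) n) \<longlonglongrightarrow> 0"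
  proof (rule tendsto_sandwich[OF _ _ tendsto_const])
    show "(\<lambda>n. cmod a * ?r f c n + cmod b * ?r g d n) \<longlonglongrightarrow> 0"
      using f g by (auto intro!: tendsto_eq_intros simp: L2_sums_def)
    show "\<forall>\<^sub>F n in sequentially. ?r (\<lambda>x. a * f x + b * g x) (\<lambda>k. a * c k + b * d k) n
        \<le> cmod a * ?r f c n + cmod b * ?r g d n"
    proof (rule always_eventually, safe)
      fix n
      have "?r (\<lambda>x. a * f x + b * g x) (\<lambda>k. a * c k + b * d k) n =
         L2_norm M (\<lambda>x. a * (f x - (\<Sum>k<n. c k * e k x)) + b * (g x - (\<Sum>k<n. d k * e k x)))"
        by (simp add: algebra_simps sum.distrib sum_distrib_left)
      also have "\<dots> \<le> cmod a * ?r f c n + cmod b * ?r g d n"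
        unfolding L2_norm_scale[symmetric]
        using L2 e by (intro L2_norm_triangle L2_scale L2_diff L2_sum)
      finally show "?r (\<lambda>x. a * f x + b * g x) (\<lambda>k. a * c k + b * d k) n \<le> \<dots>" .
    qed
  qed simp
qed

lemma L2_sums_unique:
  assumes e: "\<And>k. e k \<in> L2 M" and f: "L2_sums M e c f" and g: "L2_sums M e c g"
  shows "AE x in M. f x = g x"
proof -
  note L2 = f[THEN L2_sums_L2] g[THEN L2_sums_L2]
  have "L2_norm M (\<lambda>x. f x - g x) \<le> 0"
  proof (rule tendsto_lowerbound)
    let ?r = "\<lambda>f n. L2_norm M (\<lambda>x. f x - (\<Sum>k<n. c k * e k x))"
    show "(\<lambda>n. ?r f n + ?r g n) \<longlonglongrightarrow> 0"
      using f g by (auto intro!: tendsto_eq_intros simp: L2_sums_def)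
    have "L2_norm M (\<lambda>x. f x - g x) \<le> ?r f n + ?r g n" for n
      using L2_norm_triangle_diff[of "\<lambda>x. \<Sum>k<n. c k * e k x" M f g] L2 e
      by (simp add: L2_sum L2_scale L2_norm_minus[of M g])
    then show "\<forall>\<^sub>F n in sequentially. L2_norm M (\<lambda>x. f x - g x) \<le> ?r f n + ?r g n" by simp
  qed simp
  then have "L2_norm M (\<lambda>x. f x - g x) = 0" using L2_norm_nonneg[of M] by (rule antisym)
  then show ?thesis using L2 by (simp add: L2_norm_eq_0_iff L2_diff)
qed

text \<open>Parseval's identity. The left-hand side involves the coefficients only, so matching
  coefficients against two orthonormal sequences on different spaces is an isometry.\<close>

lemma L2_sums_inner:
  assumes e: "orthosystem M e" and e1: "\<And>k. L2_norm M (e k) = 1"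
    and f: "L2_sums M e c f" and g: "L2_sums M e d g"
  shows "(\<lambda>k. c k * cnj (d k)) sums L2_inner M f g"
proof -
  have "(\<lambda>n. L2_inner M (\<lambda>x. \<Sum>k<n. c k * e k x) (\<lambda>x. \<Sum>k<n. d k * e k x)) \<longlonglongrightarrow> L2_inner M f g"
    using f g by (intro tendsto_L2_inner) (auto simp: L2_sums_def orthosystem_sum_L2[OF e])
  then show ?thesis by (simp add: sums_def orthosystem_inner_sums[OF e] e1)
qed

lemma L2_sums_norm:
  assumes "orthosystem M e" "\<And>k. L2_norm M (e k) = 1" "L2_sums M e c f"
  shows "(\<lambda>k. (cmod (c k))\<^sup>2) sums (L2_norm M f)\<^sup>2"
proof -
  have "(\<lambda>k. Re (c k * cnj (c k))) sums Re (L2_inner M f f)"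
    by (rule sums_Re[OF L2_sums_inner[OF assms(1,2,3,3)]])
  then show ?thesis unfolding L2_inner_self complex_norm_square[symmetric] by simp
qed

lemma L2_sums_coeff:
  assumes e: "orthosystem M e" and f: "L2_sums M e c f" and e1: "L2_norm M (e k) = 1"
  shows "L2_inner M f (e k) = c k"
proof (rule LIMSEQ_unique)
  show "(\<lambda>n. L2_inner M (\<lambda>x. \<Sum>k<n. c k * e k x) (e k)) \<longlonglongrightarrow> L2_inner M f (e k)"
    using f by (intro tendsto_L2_inner) (auto simp: L2_sums_def orthosystem_sum_L2[OF e] orthosystem_L2[OF e])
  have "\<forall>\<^sub>F n in sequentially. L2_inner M (\<lambda>x. \<Sum>k<n. c k * e k x) (e k) = c k"
    using eventually_gt_at_top[of k]
    by eventually_elim (simp add: orthosystem_inner_sum[OF e] e1)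
  then show "(\<lambda>n. L2_inner M (\<lambda>x. \<Sum>k<n. c k * e k x) (e k)) \<longlonglongrightarrow> c k"
    by (rule tendsto_eventually)
qed

lemma L2_sums_orthogonal:
  assumes e: "\<And>k. e k \<in> L2 M" and w: "w \<in> L2 M" "\<And>k. L2_inner M (e k) w = 0" and f: "L2_sums M e c f"
  shows "L2_inner M f w = 0"
proof (rule LIMSEQ_unique)
  show "(\<lambda>n. L2_inner M (\<lambda>x. \<Sum>k<n. c k * e k x) w) \<longlonglongrightarrow> L2_inner M f w"
    using f w e by (intro tendsto_L2_inner) (auto simp: L2_sums_def intro!: L2_sum L2_scale)
  have "L2_inner M (\<lambda>x. \<Sum>k<n. c k * e k x) w = 0" for n
    using w e by (subst L2_inner_sum_left) (auto intro: L2_scale simp: L2_inner_scale_left)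
  then show "(\<lambda>n. L2_inner M (\<lambda>x. \<Sum>k<n. c k * e k x) w) \<longlonglongrightarrow> 0" by simp
qed

text \<open>A limit of real partial sums is real almost everywhere, because the imaginary part of \<open>f\<close>
  is dominated pointwise by the distance to each of them.\<close>

lemma L2_sums_real:
  assumes e: "\<And>k. e k \<in> L2 M" "\<And>k x. e k x \<in> \<real>" and c: "\<And>k. c k \<in> \<real>" and f: "L2_sums M e c f"
  shows "AE x in M. f x \<in> \<real>"
proof -
  let ?g = "\<lambda>x. complex_of_real (Im (f x))"
  have fL: "f \<in> L2 M" using f by (rule L2_sums_L2)
  then have gL: "?g \<in> L2 M"
    by (intro L2_I[where g = "\<lambda>x. (cmod (f x))\<^sup>2"]) (auto simp: L2_def cmod_def)
  have "L2_norm M ?g \<le> L2_norm M (\<lambda>x. f x - (\<Sum>k<n. c k * e k x))" for n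
  proof -
    have "(\<Sum>k<n. c k * e k x) \<in> \<real>" for x by (intro sum_in_Reals Reals_mult c e)
    then have "cmod (?g x) \<le> cmod (f x - (\<Sum>k<n. c k * e k x))" for x
      using abs_Im_le_cmod[of "f x - (\<Sum>k<n. c k * e k x)"] by (simp add: complex_is_Real_iff)
    then have "(L2_norm M ?g)\<^sup>2 \<le> (L2_norm M (\<lambda>x. f x - (\<Sum>k<n. c k * e k x)))\<^sup>2"
      unfolding L2_norm_square
      by (intro integral_mono L2_integrable_square gL L2_diff fL L2_sum L2_scale e power_mono) auto
    then show ?thesis by (rule power2_le_imp_le) simp
  qed
  then have "L2_norm M ?g \<le> 0"
    using f by (intro tendsto_lowerbound[of _ 0 sequentially "L2_norm M ?g"]) (auto simp: L2_sums_def)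
  then have "L2_norm M ?g = 0" using L2_norm_nonneg[of M ?g] by simp
  then have "AE x in M. ?g x = 0" using gL by (simp add: L2_norm_eq_0_iff)
  then show ?thesis by eventually_elim (simp add: complex_is_Real_iff)
qed

text \<open>Gram--Schmidt orthonormalisation. A vector that depends on its predecessors yields zero,
  because division by zero is zero.\<close>

fun gram_schmidt :: "'a measure \<Rightarrow> (nat \<Rightarrow> 'a \<Rightarrow> complex) \<Rightarrow> nat \<Rightarrow> 'a \<Rightarrow> complex" where
  "gram_schmidt M y n = (\<lambda>x.
     (y n x - (\<Sum>k<n. L2_inner M (y n) (gram_schmidt M y k) * gram_schmidt M y k x)) /
     of_real (L2_norm M (\<lambda>x. y n x - (\<Sum>k<n. L2_inner M (y n) (gram_schmidt M y k) * gram_schmidt M y k x))))"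

declare gram_schmidt.simps [simp del]

text \<open>The last two parts say that real values and orthogonality to a fixed vector (such as the
  constant one, which expresses mean zero) are inherited from the given sequence.\<close>

lemma gram_schmidt_properties:
  assumes y: "\<And>k. y k \<in> L2 M"
  shows orthosystem_gram_schmidt: "orthosystem M (gram_schmidt M y)"
    and gram_schmidt_span: "y k \<in> L2_closure M (fun_span (gram_schmidt M y))"
    and gram_schmidt_zero: "L2_norm M (gram_schmidt M y k) = 0 \<Longrightarrow> gram_schmidt M y k x = 0"
    and gram_schmidt_real: "(\<And>k x. y k x \<in> \<real>) \<Longrightarrow> gram_schmidt M y k x \<in> \<real>"
    and gram_schmidt_orthogonal: "w \<in> L2 M \<Longrightarrow> (\<And>k. L2_inner M (y k) w = 0) \<Longrightarrow>
      L2_inner M (gram_schmidt M y k) w = 0"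
proof -
  let ?e = "gram_schmidt M y"
  define r where "r n x = y n x - (\<Sum>k<n. L2_inner M (y n) (?e k) * ?e k x)" for n x
  have e: "?e n = (\<lambda>x. r n x / of_real (L2_norm M (r n)))" for n
    by (subst gram_schmidt.simps) (simp add: r_def[abs_def])
  have L2: "?e n \<in> L2 M" "r n \<in> L2 M" for n
  proof (induction n rule: less_induct)
    case (less n)
    {
      case 2
      show ?case unfolding r_def[abs_def] using less y by (intro L2_diff L2_sum L2_scale) auto
      from L2_scale[OF this, of "1 / of_real (L2_norm M (r n))"] show "?e n \<in> L2 M" by (simp add: e)
    }
  qed
  have norm: "L2_norm M (?e n) = (if L2_norm M (r n) = 0 then 0 else 1)" for n
    using L2_norm_scale[of M "1 / of_real (L2_norm M (r n))" "r n"]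
    by (auto simp: e norm_divide)
  have orth: "L2_inner M (?e n) (?e j) = 0" if "j < n" for n j
    using that
  proof (induction n arbitrary: j rule: less_induct)
    case (less n)
    have "L2_inner M (r n) (?e j) = L2_inner M (y n) (?e j) - 
        (\<Sum>k<n. L2_inner M (y n) (?e k) * L2_inner M (?e k) (?e j))"
      unfolding r_def[abs_def] using L2 y
      by (simp add: L2_inner_diff_left L2_sum L2_scale L2_inner_sum_left L2_inner_scale_left)
    also have "(\<Sum>k<n. L2_inner M (y n) (?e k) * L2_inner M (?e k) (?e j)) =
        (\<Sum>k<n. if k = j then L2_inner M (y n) (?e j) * L2_inner M (?e j) (?e j) else 0)"
    proof (rule sum.cong)
      fix k assume k: "k \<in> {..<n}"
      have "L2_inner M (?e k) (?e j) = 0" if "k \<noteq> j"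
      proof (cases "j < k")
        case False
        then have "L2_inner M (?e j) (?e k) = 0" using less.IH[of j k] less.prems that by simp
        then show ?thesis by (subst L2_inner_commute) simp
      qed (use less.IH[of k j] k in simp)
      then show "L2_inner M (y n) (?e k) * L2_inner M (?e k) (?e j) =
        (if k = j then L2_inner M (y n) (?e j) * L2_inner M (?e j) (?e j) else 0)" by simp
    qed simp
    also have "\<dots> = L2_inner M (y n) (?e j) * L2_inner M (?e j) (?e j)" using less.prems by simp
    also have "\<dots> = L2_inner M (y n) (?e j)"
      using L2_inner_norm_0[OF y L2(1), of j n] norm[of j]
      by (cases "L2_norm M (r j) = 0") (simp_all add: L2_inner_self)
    finally have "L2_inner M (r n) (?e j) = 0" by simp
    then show ?case
      using L2_inner_scale_left[of M "1 / of_real (L2_norm M (r n))" "r n" "?e j"] by (simp add: e)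
  qed
  show os: "orthosystem M ?e"
    unfolding orthosystem_def
  proof safe
    fix j k :: nat assume "j \<noteq> k"
    then consider "j < k" | "k < j" by linarith
    then show "L2_inner M (?e j) (?e k) = 0"
    proof cases
      case 1
      then show ?thesis by (subst L2_inner_commute) (simp add: orth)
    qed (rule orth)
  qed (use L2 norm in \<open>auto split: if_splits\<close>)
  show "L2_norm M (?e k) = 0 \<Longrightarrow> ?e k x = 0"
    using norm[of k] by (subst e) (simp split: if_splits)
  show "?e k x \<in> \<real>" if real: "\<And>k x. y k x \<in> \<real>"
  proof (induction k arbitrary: x rule: less_induct)
    case (less k)
    have "L2_inner M (y k) (?e j) \<in> \<real>" if "j < k" for j
      unfolding L2_inner_def complex_is_Real_iff using real[of k] less[OF that]
      by (subst integral_Im[symmetric]) (auto simp: complex_is_Real_iff intro!: L2_integrable_mult L2_cnj L2 y)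
    then show ?case using less real unfolding e[of k] r_def[of k]
      by (intro Reals_divide Reals_diff sum_in_Reals Reals_mult Reals_of_real) auto
  qed
  show "L2_inner M (?e k) w = 0" if w: "w \<in> L2 M" "\<And>k. L2_inner M (y k) w = 0"
  proof (induction k rule: less_induct)
    case (less k)
    have "L2_inner M (r k) w = 0" 
      unfolding r_def[abs_def] using L2 y w less
      by (simp add: L2_inner_diff_left L2_sum L2_scale L2_inner_sum_left L2_inner_scale_left)
    then show ?case
      using L2_inner_scale_left[of M "1 / of_real (L2_norm M (r k))" "r k" w] by (simp add: e)
  qed
  show "y k \<in> L2_closure M (fun_span ?e)"
  proof (rule L2_closure_closed[OF fun_span_L2[OF L2(1)] y])
    fix d :: real assume "0 < d"
    let ?g = "\<lambda>x. \<Sum>j\<in>{..k}. (if j = k then of_real (L2_norm M (r k)) else L2_inner M (y k) (?e j)) * ?e j x"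
    have "?g \<in> fun_span ?e" unfolding fun_span_def
      by (intro CollectI exI[of _ "{..k}"] exI[of _
          "\<lambda>j. if j = k then of_real (L2_norm M (r k)) else L2_inner M (y k) (?e j)"]) simp
    then have "?g \<in> L2_closure M (fun_span ?e)" by (rule L2_closure_superset[OF _ fun_span_L2[OF L2(1)]])
    moreover have "L2_norm M (\<lambda>x. y k x - ?g x) = 0"
    proof (cases "L2_norm M (r k) = 0")
      case True
      then have "(\<lambda>x. y k x - ?g x) = r k" by (auto simp: r_def lessThan_Suc_atMost[symmetric] fun_eq_iff)
      then show ?thesis using True by simp
    next
      case False
      have "of_real (L2_norm M (r k)) * ?e k x = r k x" for x using False by (simp add: e)
      then have "y k x - ?g x = 0" for x
        by (simp add: lessThan_Suc_atMost[symmetric]) (simp add: r_def)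
      then show ?thesis by simp
    qed
    ultimately show "\<exists>g\<in>L2_closure M (fun_span ?e). L2_norm M (\<lambda>x. y k x - g x) < d"
      using \<open>0 < d\<close> by (intro bexI[of _ ?g]) simp_all
  qed
qed

text \<open>A total orthogonal system has infinitely many nonzero members as soon as some infinite
  orthonormal sequence exists.\<close>

lemma orthosystem_infinite_nonzero:
  assumes e: "orthosystem M e" and total: "\<And>f. f \<in> L2 M \<Longrightarrow> f \<in> L2_closure M (fun_span e)"
    and u: "orthosystem M u" "\<And>k. L2_norm M (u k) = 1"
  shows "infinite {k. L2_norm M (e k) = 1}"
proof
  let ?J = "{k. L2_norm M (e k) = 1}"
  assume fin: "finite ?J"
  obtain n0 where n0: "?J \<subseteq> {..<n0}" using finite_nat_iff_bounded fin by blast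
  \<comment> \<open>If only finitely many \<open>e j\<close> were nonzero, each \<open>u i\<close> would be a finite combination of
     them.\<close>
  have parseval: "(\<Sum>j\<in>?J. (cmod (L2_inner M (u i) (e j)))\<^sup>2) = 1" for i
  proof -
    let ?c = "\<lambda>k. L2_inner M (u i) (e k)" and ?S = "\<lambda>x. \<Sum>j\<in>?J. L2_inner M (u i) (e j) * e j x"
    have uL: "u i \<in> L2 M" by (rule orthosystem_L2[OF u(1)])
    have c0: "?c k = 0" if "k \<notin> ?J" for k
      using orthosystem_coeff_norm[OF e uL, of k] e that by (auto simp: orthosystem_def)
    have "L2_sums M e ?c (u i)" by (rule L2_sums_expansion[OF e total[OF uL]])
    moreover have partial: "(\<Sum>k<n. ?c k * e k x) = ?S x" if "n \<ge> n0" for n x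
      using n0 that c0 by (intro sum.mono_neutral_right) auto
    have "\<forall>\<^sub>F n in sequentially. L2_norm M (\<lambda>x. u i x - (\<Sum>k<n. ?c k * e k x)) = L2_norm M (\<lambda>x. u i x - ?S x)"
      using eventually_ge_at_top[of n0] by eventually_elim (simp only: partial)
    ultimately have "(\<lambda>n. L2_norm M (\<lambda>x. u i x - ?S x)) \<longlonglongrightarrow> 0"
      unfolding L2_sums_def by (blast intro: Lim_transform_eventually)
    then have norm0: "L2_norm M (\<lambda>x. u i x - ?S x) = 0" by (rule LIMSEQ_unique[OF tendsto_const])
    have SL: "?S \<in> L2 M" by (rule orthosystem_sum_L2[OF e])
    have "AE x in M. u i x - ?S x = 0" using norm0 uL SL by (simp add: L2_norm_eq_0_iff L2_diff)
    then have ae: "AE x in M. u i x = ?S x" by simp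
    have "complex_of_real ((L2_norm M (u i))\<^sup>2) = L2_inner M ?S ?S"
      unfolding L2_inner_self[symmetric] by (rule L2_inner_cong_AE[OF uL SL uL SL ae ae])
    also have "\<dots> = (\<Sum>j\<in>?J. ?c j * cnj (?c j) * of_real (L2_norm M (e j)))"
      by (rule orthosystem_inner_sums[OF e fin])
    also have "\<dots> = complex_of_real (\<Sum>j\<in>?J. (cmod (?c j))\<^sup>2)"
      by (simp add: complex_norm_square[symmetric])
    finally show ?thesis unfolding u(2) by (simp only: of_real_eq_iff) simp
  qed
  \<comment> \<open>Double counting: summing Parseval's identity over more vectors of \<open>u\<close> than there are
     nonzero \<open>e j\<close> contradicts Bessel's inequality for \<open>u\<close>.\<close>
  define K where "K = Suc (card ?J)"
  have "real K = (\<Sum>i<K. \<Sum>j\<in>?J. (cmod (L2_inner M (u i) (e j)))\<^sup>2)" by (simp add: parseval)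
  also have "\<dots> = (\<Sum>j\<in>?J. \<Sum>i<K. (cmod (L2_inner M (e j) (u i)))\<^sup>2)"
    by (subst sum.swap, subst L2_inner_commute) simp
  also have "\<dots> \<le> (\<Sum>j\<in>?J. (L2_norm M (e j))\<^sup>2)"
    by (intro sum_mono bessel(1)[OF u(1)] orthosystem_L2[OF e]) simp
  also have "\<dots> = real (card ?J)" by simp
  finally show False by (simp add: K_def)
qed

text \<open>Dropping the negligible members of a system loses nothing from the closed span.\<close>

lemma orthosystem_reindex:
  assumes e: "orthosystem M e" and inf: "infinite {k. L2_norm M (e k) = 1}"
  obtains s :: "nat \<Rightarrow> nat" where "orthosystem M (\<lambda>k. e (s k))" "\<And>k. L2_norm M (e (s k)) = 1"
    "\<And>f. f \<in> L2_closure M (fun_span e) \<Longrightarrow> f \<in> L2_closure M (fun_span (\<lambda>k. e (s k)))"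
proof
  let ?J = "{k. L2_norm M (e k) = 1}" and ?s = "enumerate {k. L2_norm M (e k) = 1}"
  have bij: "bij_betw ?s UNIV ?J" by (rule bij_enumerate[OF inf])
  have "?s j \<noteq> ?s k" if "j \<noteq> k" for j k
    using bij that by (simp add: bij_betw_def inj_eq)
  then show "orthosystem M (\<lambda>k. e (?s k))"
    using e by (simp add: orthosystem_def)
  show "L2_norm M (e (?s k)) = 1" for k using bij by (auto simp: bij_betw_def)
  have L2: "e k \<in> L2 M" for k by (rule orthosystem_L2[OF e])
  have sub: "fun_span (\<lambda>k. e (?s k)) \<subseteq> L2 M" by (rule fun_span_L2[OF L2])
  have "e k \<in> L2_closure M (fun_span (\<lambda>k. e (?s k)))" for k
  proof (cases "k \<in> ?J")
    case True
    then obtain j where "k = ?s j" using bij by (auto simp: bij_betw_def)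
    then show ?thesis using fun_span_base[of "\<lambda>k. e (?s k)" j] by (intro L2_closure_superset sub) simp
  next
    case False
    then have "L2_norm M (e k) = 0" using e by (auto simp: orthosystem_def)
    moreover have "(\<lambda>x. 0) \<in> fun_span (\<lambda>k. e (?s k))" unfolding fun_span_def
      by (intro CollectI exI[of _ "{}"]) simp
    ultimately show ?thesis using L2 unfolding L2_closure_def by (auto intro!: bexI[of _ "\<lambda>x. 0"])
  qed
  then show "f \<in> L2_closure M (fun_span (\<lambda>k. e (?s k)))" if "f \<in> L2_closure M (fun_span e)" for f
    by (rule L2_closure_fun_span_mono[OF _ L2 that])
qed


section \<open>Continuous linear maps into square-integrable functions\<close>

lemma continuous_map_L2_topology:
  "continuous_map X (L2_topology M) T \<longleftrightarrow> (\<forall>x\<in>topspace X. T x \<in> L2 M) \<and>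
     (\<forall>x\<in>topspace X. \<forall>e>0. \<exists>U. openin X U \<and> x \<in> U \<and> (\<forall>y\<in>U. L2_norm M (\<lambda>z. T y z - T x z) < e))"
  unfolding L2_topology_def
  by (subst continuous_map_seminorm_topology) (auto intro: L2_norm_triangle_diff)

text \<open>Continuity passes to any map whose increments are no larger in norm.\<close>

lemma continuous_map_L2_dominated:
  assumes T: "continuous_map X (L2_topology M) T"
    and S: "\<And>f. f \<in> topspace X \<Longrightarrow> S f \<in> L2 M'"
    and le: "\<And>f g. f \<in> topspace X \<Longrightarrow> g \<in> topspace X \<Longrightarrow>
      L2_norm M' (\<lambda>z. S g z - S f z) \<le> L2_norm M (\<lambda>z. T g z - T f z)"
  shows "continuous_map X (L2_topology M') S"
  unfolding continuous_map_L2_topology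
proof (intro conjI ballI allI impI S)
  fix f and e :: real assume f: "f \<in> topspace X" and "0 < e"
  then obtain U where U: "openin X U" "f \<in> U" "\<And>g. g \<in> U \<Longrightarrow> L2_norm M (\<lambda>z. T g z - T f z) < e"
    using T unfolding continuous_map_L2_topology by meson
  have "L2_norm M' (\<lambda>z. S g z - S f z) < e" if "g \<in> U" for g
    using le[OF f, of g] U(3)[OF that] openin_subset[OF U(1)] that by fastforce
  then show "\<exists>U. openin X U \<and> f \<in> U \<and> (\<forall>g\<in>U. L2_norm M' (\<lambda>z. S g z - S f z) < e)"
    using U by blast
qed

lemma linear_continuous_L2_AE:
  "linear_continuous_L2 X M T \<Longrightarrow> f \<in> topspace X \<Longrightarrow> g \<in> topspace X \<Longrightarrow>
    AE \<omega> in M. T (\<lambda>x. a * f x + b * g x) \<omega> = a * T f \<omega> + b * T g \<omega>"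
  by (simp add: linear_continuous_L2_def)

lemma L2_norm_linear_diff:
  assumes T: "linear_continuous_L2 X M T" and f: "f \<in> topspace X" and g: "g \<in> topspace X"
    and fg: "(\<lambda>x. f x - g x) \<in> topspace X"
  shows "L2_norm M (T (\<lambda>x. f x - g x)) = L2_norm M (\<lambda>z. T f z - T g z)"
proof (rule L2_norm_cong_AE)
  have L2: "h \<in> topspace X \<Longrightarrow> T h \<in> L2 M" for h
    using T by (simp add: linear_continuous_L2_def continuous_map_L2_topology)
  show "T (\<lambda>x. f x - g x) \<in> L2 M" "(\<lambda>z. T f z - T g z) \<in> L2 M" using L2 f g fg by (auto intro: L2_diff)
  have "AE z in M. T (\<lambda>x. 1 * f x + (-1) * g x) z = 1 * T f z + (-1) * T g z"
    using T f g unfolding linear_continuous_L2_def by blast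
  then show "AE z in M. T (\<lambda>x. f x - g x) z = T f z - T g z" by simp
qed

lemma L2_norm_linear_zero:
  assumes T: "linear_continuous_L2 X M T" and f: "f \<in> topspace X"
  shows "L2_norm M (T (\<lambda>x. 0)) = 0"
proof -
  have "AE z in M. T (\<lambda>x. 0 * f x + 0 * f x) z = 0 * T f z + 0 * T f z"
    using T f unfolding linear_continuous_L2_def by blast
  then have "AE z in M. (cmod (T (\<lambda>x. 0) z))\<^sup>2 = 0" by simp
  then have "(LINT z|M. (cmod (T (\<lambda>x. 0) z))\<^sup>2) = 0" by (rule integral_eq_zero_AE)
  then show ?thesis by (simp add: L2_norm_def)
qed

lemma linear_continuous_schwartz_L2:
  "linear_continuous_L2 schwartz_topology M T \<Longrightarrow> f \<in> schwartz \<Longrightarrow> T f \<in> L2 M"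
  by (simp add: linear_continuous_L2_def continuous_map_L2_topology topspace_schwartz_topology)


section \<open>Schwartz functions\<close>

lemma smooth_iter_partial_differentiable: "smooth f \<Longrightarrow> iter_partial is f differentiable (at x)"
  by (simp add: smooth_def)

lemma has_derivative_iter_partial:
  "smooth f \<Longrightarrow> (iter_partial is f has_derivative frechet_derivative (iter_partial is f) (at x)) (at x)"
  by (simp add: smooth_def frechet_derivative_works[symmetric])

lemma iter_partial_lincomb:
  assumes f: "smooth f" and g: "smooth g"
  shows "iter_partial is (\<lambda>x. a * f x + b * g x) =
    (\<lambda>x. a * iter_partial is f x + b * iter_partial is g x)"
proof (induction "is")
  case (Cons i "is")
  have "((\<lambda>x. a * iter_partial is f x + b * iter_partial is g x) has_derivative
      (\<lambda>h. a * frechet_derivative (iter_partial is f) (at x) h +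
           b * frechet_derivative (iter_partial is g) (at x) h)) (at x)" for x
    by (intro has_derivative_add has_derivative_mult_right has_derivative_iter_partial f g)
  from frechet_derivative_at[OF this] show ?case
    by (simp add: Cons fun_eq_iff)
qed simp

lemma smooth_lincomb:
  assumes "smooth f" "smooth g"
  shows "smooth (\<lambda>x. a * f x + b * g x)"
  using assms unfolding smooth_def iter_partial_lincomb[OF assms]
  by (auto intro!: differentiable_add differentiable_mult)

lemma iter_partial_bounded_linear:
  assumes f: "smooth f" and T: "bounded_linear T"
  shows "iter_partial is (\<lambda>x. T (f x)) = (\<lambda>x. T (iter_partial is f x))"
proof (induction "is")
  case (Cons i "is")
  have "((\<lambda>x. T (iter_partial is f x)) has_derivative
      (\<lambda>h. T (frechet_derivative (iter_partial is f) (at x) h))) (at x)" for x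
    by (intro bounded_linear.has_derivative[OF T] has_derivative_iter_partial f)
  from frechet_derivative_at[OF this] show ?case
    by (simp add: Cons fun_eq_iff)
qed simp

lemma smooth_bounded_linear:
  assumes f: "smooth f" and T: "bounded_linear T"
  shows "smooth (\<lambda>x. T (f x))"
proof -
  have "(\<lambda>x. T (iter_partial is f x)) differentiable (at x)" for "is" x
    using bounded_linear.has_derivative[OF T has_derivative_iter_partial[OF f]]
    by (blast intro: differentiableI)
  then show ?thesis by (simp add: smooth_def iter_partial_bounded_linear[OF assms])
qed

lemma schwartz_weight_nonneg: "0 \<le> schwartz_weight \<alpha> is f x"
  by (simp add: schwartz_weight_def)

lemma schwartz_smooth: "f \<in> schwartz \<Longrightarrow> smooth f"
  by (simp add: schwartz_def)

lemma schwartz_weight_le: "f \<in> schwartz \<Longrightarrow> schwartz_weight \<alpha> is f x \<le> schwartz_seminorm \<alpha> is f"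
  unfolding schwartz_seminorm_def by (rule cSUP_upper) (auto simp: schwartz_def)

lemma schwartz_seminorm_le:
  "(\<And>x. schwartz_weight \<alpha> is f x \<le> C) \<Longrightarrow> schwartz_seminorm \<alpha> is f \<le> C"
  unfolding schwartz_seminorm_def by (rule cSUP_least) auto

lemma schwartz_seminorm_nonneg: "f \<in> schwartz \<Longrightarrow> 0 \<le> schwartz_seminorm \<alpha> is f"
  using schwartz_weight_le schwartz_weight_nonneg order_trans by blast

lemma schwartzI:
  assumes "smooth f" "\<And>\<alpha> is. \<exists>C. \<forall>x. schwartz_weight \<alpha> is f x \<le> C"
  shows "f \<in> schwartz"
  using assms by (auto simp: schwartz_def bdd_above_def)

lemma schwartz_weight_lincomb:
  assumes "smooth f" "smooth g"
  shows "schwartz_weight \<alpha> is (\<lambda>x. a * f x + b * g x) x \<le>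
    cmod a * schwartz_weight \<alpha> is f x + cmod b * schwartz_weight \<alpha> is g x"
proof -
  let ?m = "\<bar>\<Prod>j\<in>UNIV. (x $ j) ^ \<alpha> j\<bar>"
  have "schwartz_weight \<alpha> is (\<lambda>x. a * f x + b * g x) x \<le>
      ?m * (cmod a * cmod (iter_partial is f x) + cmod b * cmod (iter_partial is g x))"
    unfolding schwartz_weight_def iter_partial_lincomb[OF assms] norm_mult[symmetric]
    by (intro mult_left_mono norm_triangle_ineq) simp
  then show ?thesis by (simp add: schwartz_weight_def algebra_simps)
qed

lemma schwartz_lincomb:
  assumes "f \<in> schwartz" "g \<in> schwartz"
  shows "(\<lambda>x. a * f x + b * g x) \<in> schwartz"
proof (rule schwartzI)
  note sm = assms[THEN schwartz_smooth]
  show "smooth (\<lambda>x. a * f x + b * g x)" using sm by (rule smooth_lincomb)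
  fix \<alpha> "is"
  have "schwartz_weight \<alpha> is (\<lambda>x. a * f x + b * g x) x \<le>
      cmod a * schwartz_seminorm \<alpha> is f + cmod b * schwartz_seminorm \<alpha> is g" for x
    by (rule order_trans[OF schwartz_weight_lincomb[OF sm]])
       (intro add_mono mult_left_mono schwartz_weight_le assms norm_ge_zero)
  then show "\<exists>C. \<forall>x. schwartz_weight \<alpha> is (\<lambda>x. a * f x + b * g x) x \<le> C" by blast
qed

lemma schwartz_zero [simp]: "(\<lambda>x. 0) \<in> schwartz"
proof -
  have [simp]: "iter_partial is (\<lambda>x::real^'a. 0) = (\<lambda>x. 0)" for "is" by (induction "is") auto
  show ?thesis by (auto simp: schwartz_def smooth_def schwartz_weight_def)
qed

lemma schwartz_nonempty: "schwartz \<noteq> {}"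
  using schwartz_zero by blast

lemma schwartz_diff: "f \<in> schwartz \<Longrightarrow> g \<in> schwartz \<Longrightarrow> (\<lambda>x. f x - g x) \<in> schwartz"
  using schwartz_lincomb[of f g 1 "-1"] by simp

lemma schwartz_seminorm_triangle_diff:
  assumes "f \<in> schwartz" "g \<in> schwartz" "h \<in> schwartz"
  shows "schwartz_seminorm \<alpha> is (\<lambda>x. g x - h x) \<le>
    schwartz_seminorm \<alpha> is (\<lambda>x. g x - f x) + schwartz_seminorm \<alpha> is (\<lambda>x. f x - h x)"
proof (rule schwartz_seminorm_le)
  fix x
  note d = schwartz_diff[OF assms(2,1)] schwartz_diff[OF assms(1,3)]
  show "schwartz_weight \<alpha> is (\<lambda>x. g x - h x) x \<le>
    schwartz_seminorm \<alpha> is (\<lambda>x. g x - f x) + schwartz_seminorm \<alpha> is (\<lambda>x. f x - h x)"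
    using schwartz_weight_lincomb[OF d[THEN schwartz_smooth], of \<alpha> "is" 1 1 x]
      schwartz_weight_le[OF d(1), of \<alpha> "is" x] schwartz_weight_le[OF d(2), of \<alpha> "is" x] by simp
qed

lemma schwartz_bounded_linear:
  assumes f: "f \<in> schwartz" and T: "bounded_linear T"
  shows "(\<lambda>x. T (f x)) \<in> schwartz"
proof (rule schwartzI)
  note sm = schwartz_smooth[OF f]
  show "smooth (\<lambda>x. T (f x))" by (rule smooth_bounded_linear[OF sm T])
  fix \<alpha> "is"
  obtain K where K: "K \<ge> 0" "\<And>z. cmod (T z) \<le> cmod z * K"
    using bounded_linear.nonneg_bounded[OF T] by blast
  have "schwartz_weight \<alpha> is (\<lambda>x. T (f x)) x \<le> schwartz_seminorm \<alpha> is f * K" for x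
  proof -
    let ?m = "\<bar>\<Prod>j\<in>UNIV. (x $ j) ^ \<alpha> j\<bar>"
    have "?m * cmod (T (iter_partial is f x)) \<le> ?m * (cmod (iter_partial is f x) * K)"
      by (intro mult_left_mono K) simp
    also have "\<dots> = schwartz_weight \<alpha> is f x * K" by (simp add: schwartz_weight_def)
    also have "\<dots> \<le> schwartz_seminorm \<alpha> is f * K"
      by (intro mult_right_mono schwartz_weight_le f K)
    finally show ?thesis by (simp add: schwartz_weight_def iter_partial_bounded_linear[OF sm T])
  qed
  then show "\<exists>C. \<forall>x. schwartz_weight \<alpha> is (\<lambda>x. T (f x)) x \<le> C" by blast
qed

lemma schwartz_Re: "f \<in> schwartz \<Longrightarrow> (\<lambda>x. of_real (Re (f x))) \<in> schwartz"
  by (rule schwartz_bounded_linear) (auto intro: bounded_linear_compose[OF bounded_linear_of_real bounded_linear_Re])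

lemma schwartz_Im: "f \<in> schwartz \<Longrightarrow> (\<lambda>x. of_real (Im (f x))) \<in> schwartz"
  by (rule schwartz_bounded_linear) (auto intro: bounded_linear_compose[OF bounded_linear_of_real bounded_linear_Im])

lemma schwartz_continuous_iter_partial: "f \<in> schwartz \<Longrightarrow> continuous_on UNIV (iter_partial is f)"
  by (auto simp: continuous_on_eq_continuous_within
      intro!: differentiable_imp_continuous_within smooth_iter_partial_differentiable schwartz_smooth)

lemma schwartz_measurable: "f \<in> schwartz \<Longrightarrow> f \<in> borel_measurable borel"
  using schwartz_continuous_iter_partial[of f "[]"] by (auto intro: borel_measurable_continuous_onI)

text \<open>A product of functions of one variable each is differentiated factor by factor; \<open>D i n\<close> is
  the \<open>n\<close>-th derivative of the factor in the variable \<open>i\<close>.\<close>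

lemma iter_partial_tensor:
  fixes D :: "'d::finite \<Rightarrow> nat \<Rightarrow> real \<Rightarrow> real"
  assumes D: "\<And>i n t. (D i n has_real_derivative D i (Suc n) t) (at t)"
  shows "iter_partial is (\<lambda>x. of_real (\<Prod>i\<in>UNIV. D i 0 (x $ i))) =
      (\<lambda>x. of_real (\<Prod>i\<in>UNIV. D i (count_list is i) (x $ i)))"
    and tensor_smooth: "smooth (\<lambda>x. of_real (\<Prod>i\<in>UNIV. D i 0 (x $ i)))"
proof -
  have comp: "((\<lambda>x. D i n (x $ i)) has_derivative (\<lambda>h. D i (Suc n) (x $ i) * h $ i)) (at x)" for i n x
    using has_derivative_compose[OF bounded_linear_imp_has_derivative[OF bounded_linear_vec_nth[of i]]
        D[of i n, unfolded has_field_derivative_def]] by simp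
  let ?P = "\<lambda>n x. complex_of_real (\<Prod>i\<in>UNIV. D i (n i) (x $ i))"
  let ?P' = "\<lambda>n x h. complex_of_real (\<Sum>i\<in>UNIV. D i (Suc (n i)) (x $ i) * h $ i * (\<Prod>j\<in>UNIV - {i}. D j (n j) (x $ j)))"
  have P: "(?P n has_derivative ?P' n x) (at x)" for n x
    by (intro has_derivative_of_real has_derivative_prod comp)
  show main: "iter_partial is (?P (\<lambda>_. 0)) = ?P (count_list is)" for "is"
  proof (induction "is")
    case (Cons j "is")
    have "?P' (count_list is) x (axis j 1) = ?P (count_list (j # is)) x" for x
    proof -
      let ?n = "count_list is"
      have "(\<Sum>i\<in>UNIV. D i (Suc (?n i)) (x $ i) * axis j 1 $ i * (\<Prod>k\<in>UNIV - {i}. D k (?n k) (x $ k))) =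
        (\<Sum>i\<in>UNIV. if i = j then D j (Suc (?n j)) (x $ j) * (\<Prod>k\<in>UNIV - {j}. D k (?n k) (x $ k)) else 0)"
        by (intro sum.cong) (auto simp: axis_def)
      also have "\<dots> = D j (Suc (?n j)) (x $ j) * (\<Prod>k\<in>UNIV - {j}. D k (?n k) (x $ k))" by simp
      also have "\<dots> = (\<Prod>i\<in>UNIV. D i (count_list (j # is) i) (x $ i))"
        by (subst (2) prod.remove[of _ j]) (auto intro!: prod.cong arg_cong2[where f = "(*)"])
      finally show ?thesis by (rule arg_cong)
    qed
    then show ?case
      by (simp only: iter_partial.simps Cons frechet_derivative_at[OF P, symmetric])
  qed simp
  show "smooth (?P (\<lambda>_. 0))"
    unfolding smooth_def main by (blast intro: differentiableI P)
qed

lemma tensor_schwartz: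
  fixes D :: "'d::finite \<Rightarrow> nat \<Rightarrow> real \<Rightarrow> real"
  assumes D: "\<And>i n t. (D i n has_real_derivative D i (Suc n) t) (at t)"
    and bounded: "\<And>i n k. \<exists>C. \<forall>t. \<bar>t ^ k * D i n t\<bar> \<le> C"
  shows "(\<lambda>x. of_real (\<Prod>i\<in>UNIV. D i 0 (x $ i))) \<in> schwartz"
proof (rule schwartzI)
  show "smooth (\<lambda>x. of_real (\<Prod>i\<in>UNIV. D i 0 (x $ i)))" by (rule tensor_smooth[of D, OF D])
  fix \<alpha> :: "'d \<Rightarrow> nat" and "is"
  define C where "C i n k = (SOME C. \<forall>t. \<bar>t ^ k * D i n t\<bar> \<le> C)" for i n k
  have C: "\<bar>t ^ k * D i n t\<bar> \<le> C i n k" for i n k t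
    using someI_ex[OF bounded[of k i n]] by (simp add: C_def)
  have "schwartz_weight \<alpha> is (\<lambda>x. of_real (\<Prod>i\<in>UNIV. D i 0 (x $ i))) x \<le>
      (\<Prod>i\<in>UNIV. C i (count_list is i) (\<alpha> i))" for x
    unfolding schwartz_weight_def iter_partial_tensor[of D, OF D]
    by (simp only: norm_of_real abs_mult[symmetric] prod.distrib[symmetric] abs_prod)
       (intro prod_mono conjI abs_ge_zero C)
  then show "\<exists>C. \<forall>x. schwartz_weight \<alpha> is (\<lambda>x. of_real (\<Prod>i\<in>UNIV. D i 0 (x $ i))) x \<le> C" by blast
qed


section \<open>Schwartz functions are square-integrable\<close>

lemma prod_Basis_eq:
  fixes x :: "real^'d::finite"
  shows "(\<Prod>b\<in>Basis. h (x \<bullet> b)) = (\<Prod>j\<in>UNIV. h (x $ j))"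
proof -
  have B: "(Basis :: (real^'d) set) = (\<lambda>j. axis j 1) ` UNIV" by (auto simp: Basis_vec_def)
  have "inj (\<lambda>j::'d. axis j (1::real))" by (auto simp: inj_on_def axis_eq_axis)
  then show ?thesis unfolding B by (subst prod.reindex) (auto simp: inner_axis)
qed

text \<open>The density of a product of Cauchy distributions, up to normalisation.\<close>

definition cauchy_weight :: "real^'d::finite \<Rightarrow> real" where
  "cauchy_weight x = (\<Prod>j\<in>UNIV. 1 / (1 + (x $ j)\<^sup>2))"

lemma cauchy_weight_pos: "0 < cauchy_weight x"
  unfolding cauchy_weight_def by (intro prod_pos) (auto simp: add_pos_nonneg)

lemma cauchy_weight_le_1: "cauchy_weight x \<le> 1"
  unfolding cauchy_weight_def by (intro prod_le_1) (auto simp: add_pos_nonneg)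

lemma cauchy_weight_measurable [measurable]: "cauchy_weight \<in> borel_measurable borel"
proof -
  have "continuous_on UNIV (\<lambda>x::real^'a. (\<Prod>j\<in>UNIV. 1 / (1 + (x $ j)\<^sup>2)))"
    by (intro continuous_intros) (auto simp: add_nonneg_eq_0_iff)
  then show ?thesis unfolding cauchy_weight_def[abs_def] by (rule borel_measurable_continuous_onI)
qed

lemma integrable_cauchy_weight: "integrable lborel (cauchy_weight :: real^'d::finite \<Rightarrow> real)"
proof (rule integrableI_nonneg)
  have "integrable lborel (\<lambda>x::real. inverse (1 + x\<^sup>2))"
    using integrable_inverse_1_plus_square by (simp add: set_integrable_def einterval_def)
  then have fin: "(\<integral>\<^sup>+x. ennreal (1 / (1 + x\<^sup>2)) \<partial>lborel) < \<infinity>" for b :: "real^'d"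
    using integrableD(2)
    by (subst nn_integral_eq_integral) (auto simp: divide_inverse add_nonneg_nonneg)
  have "(\<integral>\<^sup>+x. ennreal (cauchy_weight (x::real^'d)) \<partial>lborel) =
      (\<integral>\<^sup>+x. (\<Prod>b\<in>Basis. ennreal (1 / (1 + ((x::real^'d) \<bullet> b)\<^sup>2))) \<partial>lborel)"
    by (simp add: prod_ennreal add_nonneg_nonneg cauchy_weight_def
        flip: prod_Basis_eq[of "\<lambda>t. 1 / (1 + t\<^sup>2)"])
  also have "\<dots> = (\<Prod>b\<in>(Basis::(real^'d) set). \<integral>\<^sup>+x. ennreal (1 / (1 + x\<^sup>2)) \<partial>lborel)"
    by (rule nn_integral_lborel_prod) auto
  also have "\<dots> < \<infinity>" using fin by (simp add: power_less_top_ennreal)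
  finally show "(\<integral>\<^sup>+x. ennreal (cauchy_weight (x::real^'d)) \<partial>lborel) < \<infinity>" .
qed (auto intro: less_imp_le cauchy_weight_pos)

text \<open>A sum of Schwartz seminorms that controls the function by the Cauchy weight: expanding
  \<open>\<Prod>j. 1 + (x $ j)\<^sup>2\<close> gives one monomial for each set of coordinates.\<close>

definition decay_seminorm :: "(real^'d::finite \<Rightarrow> complex) \<Rightarrow> real" where
  "decay_seminorm f = (\<Sum>A\<in>UNIV. schwartz_seminorm (\<lambda>j. if j \<in> A then 2 else 0) [] f)"

lemma schwartz_le_cauchy_weight:
  assumes "f \<in> schwartz"
  shows "cmod (f x) \<le> decay_seminorm f * cauchy_weight x"
proof -
  have "(\<Prod>j\<in>UNIV. (x $ j)\<^sup>2 + 1) * cmod (f x) =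
     (\<Sum>A\<in>UNIV. (\<Prod>j\<in>A. (x $ j)\<^sup>2) * cmod (f x))"
    by (subst prod_add) (auto simp: sum_distrib_right)
  also have "\<dots> = (\<Sum>A\<in>UNIV. schwartz_weight (\<lambda>j. if j \<in> A then 2 else 0) [] f x)"
  proof (rule sum.cong)
    fix A :: "'a set"
    have "(\<Prod>j\<in>UNIV. (x $ j) ^ (if j \<in> A then 2 else 0)) = (\<Prod>j\<in>A. (x $ j)\<^sup>2)"
      by (intro prod.mono_neutral_cong_right) auto
    then show "(\<Prod>j\<in>A. (x $ j)\<^sup>2) * cmod (f x) = schwartz_weight (\<lambda>j. if j \<in> A then 2 else 0) [] f x"
      by (simp add: schwartz_weight_def prod_nonneg abs_of_nonneg)
  qed simp
  also have "\<dots> \<le> decay_seminorm f"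
    unfolding decay_seminorm_def by (intro sum_mono schwartz_weight_le assms)
  finally have "(\<Prod>j\<in>UNIV. (x $ j)\<^sup>2 + 1) * cmod (f x) \<le> decay_seminorm f" .
  moreover have "(\<Prod>j\<in>UNIV. (x $ j)\<^sup>2 + 1) = 1 / cauchy_weight x"
    by (simp add: cauchy_weight_def prod_dividef add.commute)
  ultimately have "cmod (f x) / cauchy_weight x \<le> decay_seminorm f" by simp
  then show ?thesis using cauchy_weight_pos[of x] by (simp add: pos_divide_le_eq)
qed

lemma decay_seminorm_nonneg: "f \<in> schwartz \<Longrightarrow> 0 \<le> decay_seminorm f"
  unfolding decay_seminorm_def by (intro sum_nonneg schwartz_seminorm_nonneg)

lemma schwartz_norm_square_le:
  assumes "f \<in> schwartz"
  shows "(cmod (f x))\<^sup>2 \<le> (decay_seminorm f)\<^sup>2 * cauchy_weight x"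
proof -
  have "(cmod (f x))\<^sup>2 \<le> (decay_seminorm f * cauchy_weight x)\<^sup>2"
    by (intro power_mono schwartz_le_cauchy_weight assms) simp
  also have "\<dots> = (decay_seminorm f)\<^sup>2 * (cauchy_weight x * cauchy_weight x)"
    by (simp add: power2_eq_square)
  also have "\<dots> \<le> (decay_seminorm f)\<^sup>2 * cauchy_weight x"
    using cauchy_weight_le_1[of x] cauchy_weight_pos[of x]
    by (intro mult_left_mono) (auto simp: mult_left_le)
  finally show ?thesis .
qed

lemma schwartz_L2: "f \<in> schwartz \<Longrightarrow> f \<in> L2 lborel"
  using schwartz_measurable[of f]
  by (intro L2_I[where g = "\<lambda>x. (decay_seminorm f)\<^sup>2 * cauchy_weight x"])
     (auto intro: integrable_cauchy_weight schwartz_norm_square_le)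

lemma schwartz_subset_L2: "schwartz \<subseteq> L2 lborel"
  using schwartz_L2 by blast

lemma schwartz_L2_norm_le:
  fixes f :: "real^'d::finite \<Rightarrow> complex"
  assumes "f \<in> schwartz"
  shows "L2_norm lborel f \<le> sqrt (LINT x|lborel. cauchy_weight (x::real^'d::finite)) * decay_seminorm f"
proof (rule power2_le_imp_le)
  have "(L2_norm lborel f)\<^sup>2 \<le> (LINT x|lborel. (decay_seminorm f)\<^sup>2 * cauchy_weight (x::real^'d))"
    unfolding L2_norm_square
    by (intro integral_mono L2_integrable_square schwartz_L2 assms integrable_mult_right
        integrable_cauchy_weight schwartz_norm_square_le)
  also have "\<dots> = (sqrt (LINT x|lborel. cauchy_weight (x::real^'d)) * decay_seminorm f)\<^sup>2"
    by (simp add: power_mult_distrib Bochner_Integration.integral_nonneg less_imp_le[OF cauchy_weight_pos])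
  finally show "(L2_norm lborel f)\<^sup>2 \<le> \<dots>" .
qed (auto intro!: mult_nonneg_nonneg decay_seminorm_nonneg assms Bochner_Integration.integral_nonneg less_imp_le[OF cauchy_weight_pos])

lemma linear_continuous_schwartz_inclusion:
  "linear_continuous_L2 schwartz_topology lborel (\<lambda>f :: real^'d::finite \<Rightarrow> complex. f)"
  unfolding linear_continuous_L2_def continuous_map_L2_topology topspace_schwartz_topology
proof safe
  fix f :: "real^'d \<Rightarrow> complex" and e :: real assume f: "f \<in> schwartz" and "0 < e"
  let ?C = "sqrt (LINT x|lborel. cauchy_weight (x::real^'d))"
  let ?n = "real (card (UNIV :: 'd set set))"
  let ?p = "\<lambda>A::'d set. schwartz_seminorm (\<lambda>j. if j \<in> A then 2 else 0) []"
  have C: "?C \<ge> 0" by (simp add: Bochner_Integration.integral_nonneg less_imp_le[OF cauchy_weight_pos])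
  define d where "d = e / (?C * ?n + 1)"
  have pos: "?C * ?n + 1 > 0" using C by (simp add: add_nonneg_pos)
  have d: "d > 0" using pos \<open>0 < e\<close> by (simp add: d_def)
  define U where "U = (\<Inter>A\<in>UNIV. {g \<in> schwartz. ?p A (\<lambda>x. g x - f x) < d})"
  have "openin schwartz_topology U"
    unfolding U_def schwartz_topology_def
    by (intro openin_INT2 openin_seminorm_ball f d) auto
  moreover have "?p A (\<lambda>x. 0) \<le> 0" for A
    using schwartz_seminorm_triangle_diff[OF f f f, of _ "[]"] schwartz_seminorm_le[of _ "[]" "\<lambda>x. 0" 0]
    by (auto simp: schwartz_weight_def)
  then have "f \<in> U" using f d by (auto simp: U_def intro: le_less_trans)
  moreover have "L2_norm lborel (\<lambda>x. g x - f x) < e" if g: "g \<in> U" for g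
  proof -
    have gf: "(\<lambda>x. g x - f x) \<in> schwartz" using g f by (auto simp: U_def intro: schwartz_diff)
    have "decay_seminorm (\<lambda>x. g x - f x) \<le> (\<Sum>A\<in>(UNIV::'d set set). d)"
      unfolding decay_seminorm_def using g by (intro sum_mono) (auto simp: U_def less_imp_le)
    then have "L2_norm lborel (\<lambda>x. g x - f x) \<le> ?C * (?n * d)"
      using schwartz_L2_norm_le[OF gf] mult_left_mono[OF _ C] by fastforce
    also have "\<dots> < (?C * ?n + 1) * d" using d by (simp add: algebra_simps)
    also have "\<dots> = e" using pos by (simp add: d_def)
    finally show ?thesis .
  qed
  ultimately show "\<exists>U. openin schwartz_topology U \<and> f \<in> U \<and> (\<forall>y\<in>U. L2_norm lborel (\<lambda>z. y z - f z) < e)"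
    by blast
qed (auto intro: schwartz_L2)


section \<open>Separability of continuous images of Schwartz space\<close>

text \<open>At a given tolerance, continuity involves finitely many seminorms; linearity makes the
  estimate uniform in the base point.\<close>

lemma linear_continuous_schwartz_small:
  assumes T: "linear_continuous_L2 schwartz_topology M T" and "0 < e"
  shows "\<exists>F d. finite F \<and> F \<subseteq> {schwartz_seminorm \<alpha> is | \<alpha> is. True} \<and> 0 < d \<and>
    (\<forall>f\<in>schwartz. \<forall>g\<in>schwartz. (\<forall>p\<in>F. p (\<lambda>x. f x - g x) < d) \<longrightarrow> L2_norm M (\<lambda>z. T f z - T g z) < e)"
proof -
  have L2: "h \<in> schwartz \<Longrightarrow> T h \<in> L2 M" for h
    using T by (rule linear_continuous_schwartz_L2)
  have "\<exists>U. openin schwartz_topology U \<and> (\<lambda>x. 0) \<in> U \<and>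
      (\<forall>y\<in>U. L2_norm M (\<lambda>z. T y z - T (\<lambda>x. 0) z) < e)"
    using T \<open>0 < e\<close> schwartz_zero
    unfolding linear_continuous_L2_def continuous_map_L2_topology topspace_schwartz_topology by blast
  then obtain U where U: "openin schwartz_topology U" "(\<lambda>x. 0) \<in> U"
      "\<And>y. y \<in> U \<Longrightarrow> L2_norm M (\<lambda>z. T y z - T (\<lambda>x. 0) z) < e"
    by blast
  have "\<exists>F d. finite F \<and> F \<subseteq> {schwartz_seminorm \<alpha> is | \<alpha> is. True} \<and> 0 < d \<and>
      (\<forall>g\<in>schwartz. (\<forall>p\<in>F. p (\<lambda>x. g x - (\<lambda>x. 0) x) < d) \<longrightarrow> g \<in> U)"
    by (rule openin_seminorm_topology_nbhd)
       (use U in \<open>auto simp: schwartz_topology_def intro: schwartz_seminorm_triangle_diff\<close>)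
  then obtain F d where F: "finite F" "F \<subseteq> {schwartz_seminorm \<alpha> is | \<alpha> is. True}" "0 < d"
      "\<And>g. g \<in> schwartz \<Longrightarrow> (\<forall>p\<in>F. p (\<lambda>x. g x - 0) < d) \<Longrightarrow> g \<in> U"
    by (elim exE conjE) (auto simp del: diff_zero)
  have "L2_norm M (\<lambda>z. T f z - T g z) < e"
    if fg: "f \<in> schwartz" "g \<in> schwartz" and "\<forall>p\<in>F. p (\<lambda>x. f x - g x) < d" for f g
  proof -
    let ?h = "\<lambda>x. f x - g x"
    have h: "?h \<in> schwartz" using fg by (rule schwartz_diff)
    then have "?h \<in> U" using F(4)[of ?h] that(3) by simp
    have "L2_norm M (\<lambda>z. T f z - T g z) = L2_norm M (T ?h)"
      using L2_norm_linear_diff[OF T] fg h by (simp add: topspace_schwartz_topology)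
    also have "\<dots> \<le> L2_norm M (\<lambda>z. T ?h z - T (\<lambda>x. 0) z) + L2_norm M (T (\<lambda>x. 0))"
      using L2 h by (intro L2_norm_le_add_diff) auto
    also have "\<dots> < e"
      using U(3)[OF \<open>?h \<in> U\<close>] L2_norm_linear_zero[OF T, of "\<lambda>x. 0"]
      by (simp add: topspace_schwartz_topology)
    finally show ?thesis .
  qed
  then show ?thesis using F by (intro exI[of _ F] exI[of _ d]) auto
qed

text \<open>Separability in the supremum norm, phrased by countable labels: a function that decays at
  infinity is determined up to \<open>e\<close> by a natural number, which encodes a radius, a mesh width and
  the rounded values on a finite net.\<close>

lemma uniform_label:
  fixes e :: real
  assumes "0 < e"
  shows "\<exists>lab :: ('a::euclidean_space \<Rightarrow> complex) \<Rightarrow> nat. \<forall>u v.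
    continuous_on UNIV u \<longrightarrow> (\<exists>B. \<forall>x. norm x * cmod (u x) \<le> B) \<longrightarrow>
    continuous_on UNIV v \<longrightarrow> (\<exists>B. \<forall>x. norm x * cmod (v x) \<le> B) \<longrightarrow>
    lab u = lab v \<longrightarrow> (\<forall>x. cmod (u x - v x) \<le> e)"
proof -
  have "\<exists>t. cball (0::'a) (real m) \<subseteq> (\<Union>x\<in>set t. ball x (1 / real (Suc k)))" for m k
  proof -
    have "\<exists>K. finite K \<and> cball (0::'a) (real m) \<subseteq> (\<Union>x\<in>K. ball x (1 / real (Suc k)))"
      using compact_cball[of "0::'a" "real m"] unfolding compact_eq_totally_bounded by simp
    then show ?thesis using finite_list by metis
  qed
  then obtain T where T: "\<And>m k. cball (0::'a) (real m) \<subseteq> (\<Union>x\<in>set (T m k). ball x (1 / real (Suc k)))"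
    by metis
  \<comment> \<open>\<open>good u m k\<close>: \<open>u\<close> is small outside the ball of radius \<open>m\<close>, and on a slightly larger ball it
     varies little at scale \<open>1 / Suc k\<close>. The larger ball is needed because the net may leave the
     ball that it covers.\<close>
  define good where "good u m k \<longleftrightarrow> (\<forall>x. norm x > real m \<longrightarrow> cmod (u x) \<le> e / 2) \<and>
     (\<forall>x\<in>cball 0 (real m + 1). \<forall>y\<in>cball 0 (real m + 1). dist x y < 1 / real (Suc k) \<longrightarrow> cmod (u x - u y) \<le> e / 4)"
    for u :: "'a \<Rightarrow> complex" and m k
  have ex_good: "\<exists>p. good u (fst p) (snd p)"
    if u: "continuous_on UNIV u" "\<forall>x. norm x * cmod (u x) \<le> B" for u B
  proof -
    obtain m where m: "real m > B * 2 / e" using reals_Archimedean2 by blast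
    have 1: "cmod (u x) \<le> e / 2" if "norm x > real m" for x
    proof -
      have "real m * cmod (u x) \<le> norm x * cmod (u x)" using that by (intro mult_right_mono) auto
      also have "\<dots> \<le> B" using u by blast
      also have "\<dots> \<le> real m * (e / 2)" using m \<open>0 < e\<close> by (simp add: field_simps)
      finally have *: "real m * cmod (u x) \<le> real m * (e / 2)" .
      show ?thesis
      proof (cases "m = 0")
        case True
        then have "B < 0" using m \<open>0 < e\<close> by (simp add: field_simps zero_less_mult_iff)
        moreover have "0 \<le> norm x * cmod (u x)" by simp
        ultimately show ?thesis using u(2)[rule_format, of x] by linarith
      qed (use * in simp)
    qed
    have "uniformly_continuous_on (cball 0 (real m + 1)) u"
      by (rule compact_uniformly_continuous) (auto intro: continuous_on_subset[OF u(1)])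
    then obtain d where d: "d > 0"
      "\<And>x y. x \<in> cball 0 (real m + 1) \<Longrightarrow> y \<in> cball 0 (real m + 1) \<Longrightarrow> dist y x < d \<Longrightarrow> dist (u y) (u x) < e / 4"
      using \<open>0 < e\<close> unfolding uniformly_continuous_on_def by (metis divide_pos_pos zero_less_numeral)
    obtain k where k: "1 / real (Suc k) < d" using d(1) by (rule nat_approx_posE)
    have "good u m k" unfolding good_def
    proof safe
      fix x y assume xy: "x \<in> cball (0::'a) (real m + 1)" "y \<in> cball (0::'a) (real m + 1)" "dist x y < 1 / real (Suc k)"
      then show "cmod (u x - u y) \<le> e / 4"
        using d(2)[OF xy(2,1)] k by (simp add: dist_norm)
    qed (rule 1)
    then show ?thesis by (intro exI[of _ "(m, k)"]) simp
  qed
  define pick where "pick u = (SOME p. good u (fst p) (snd p))" for u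
  define samples where "samples u = map (\<lambda>t. (\<lfloor>4 * Re (u t) / e\<rfloor>, \<lfloor>4 * Im (u t) / e\<rfloor>)) (T (fst (pick u)) (snd (pick u)))" for u
  define lab where "lab u = to_nat (pick u, samples u)" for u
  \<comment> \<open>Numbers that are rounded to the same integer differ by at most \<open>e / 4\<close>.\<close>
  have round: "\<bar>a - b\<bar> \<le> e / 4" if "\<lfloor>4 * a / e\<rfloor> = \<lfloor>4 * b / e\<rfloor>" for a b
  proof -
    have "\<bar>4 * a / e - 4 * b / e\<bar> < 1" using that by linarith
    also have "4 * a / e - 4 * b / e = 4 * (a - b) / e"
      by (simp add: diff_divide_distrib right_diff_distrib)
    finally have "4 * \<bar>a - b\<bar> < e" using \<open>0 < e\<close> by (simp only: abs_divide abs_mult) simp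
    then show ?thesis by simp
  qed
  have main: "cmod (u x - v x) \<le> e"
    if u: "continuous_on UNIV u" "\<forall>x. norm x * cmod (u x) \<le> B"
    and v: "continuous_on UNIV v" "\<forall>x. norm x * cmod (v x) \<le> C" and "lab u = lab v" for u v B C x
  proof -
    obtain m k where mk: "pick u = (m, k)" by fastforce
    have eq: "pick v = (m, k)" "samples u = samples v"
      using \<open>lab u = lab v\<close> mk by (auto simp: lab_def)
    have gu: "good u m k" using someI_ex[OF ex_good[OF u]] mk by (simp add: pick_def[symmetric])
    have gv: "good v m k" using someI_ex[OF ex_good[OF v]] eq by (simp add: pick_def[symmetric])
    show ?thesis
    proof (cases "norm x > real m")
      case True
      then have "cmod (u x) \<le> e / 2" "cmod (v x) \<le> e / 2" using gu gv by (auto simp: good_def)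
      then show ?thesis using norm_triangle_ineq4[of "u x" "v x"] by linarith
    next
      case False
      then have "x \<in> cball 0 (real m)" by simp
      then obtain t where t: "t \<in> set (T m k)" "dist t x < 1 / real (Suc k)" using T[of m k] by fastforce
      have "1 / real (Suc k) \<le> 1" by simp
      then have "norm t \<le> real m + 1"
        using t(2) False norm_triangle_sub[of t x] unfolding dist_norm by linarith
      then have in_ball: "t \<in> cball 0 (real m + 1)" "x \<in> cball 0 (real m + 1)" using False by auto
      have "cmod (u x - u t) \<le> e / 4" "cmod (v x - v t) \<le> e / 4"
        using gu gv in_ball t(2) by (auto simp: good_def dist_commute)
      moreover have "\<lfloor>4 * Re (u t) / e\<rfloor> = \<lfloor>4 * Re (v t) / e\<rfloor>" "\<lfloor>4 * Im (u t) / e\<rfloor> = \<lfloor>4 * Im (v t) / e\<rfloor>"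
        using eq mk t(1) by (auto simp: samples_def)
      then have "cmod (u t - v t) \<le> e / 4 + e / 4"
        using cmod_le[of "u t - v t"] round[of "Re (u t)" "Re (v t)"] round[of "Im (u t)" "Im (v t)"] by simp
      moreover have "u x - v x = (u x - u t) + (u t - v t) - (v x - v t)" by simp
      then have "cmod (u x - v x) \<le> cmod (u x - u t) + cmod (u t - v t) + cmod (v x - v t)"
        by (metis add_right_mono norm_triangle_ineq norm_triangle_ineq4 order_trans)
      ultimately show ?thesis by linarith
    qed
  qed
  show ?thesis using main by (intro exI[of _ lab]) blast
qed

text \<open>Each weighted derivative decays at infinity, because raising one exponent of the monomial
  by one gives another finite seminorm.\<close>

lemma schwartz_weight_decay:
  fixes f :: "real^'d::finite \<Rightarrow> complex"
  assumes f: "f \<in> schwartz"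
  shows "norm x * schwartz_weight \<alpha> is f x \<le> (\<Sum>j\<in>UNIV. schwartz_seminorm (\<alpha>(j := Suc (\<alpha> j))) is f)"
proof -
  have "norm x * schwartz_weight \<alpha> is f x \<le> (\<Sum>j\<in>UNIV. \<bar>x $ j\<bar>) * schwartz_weight \<alpha> is f x"
    by (intro mult_right_mono norm_le_l1_cart schwartz_weight_nonneg)
  also have "\<dots> = (\<Sum>j\<in>UNIV. \<bar>x $ j\<bar> * schwartz_weight \<alpha> is f x)" by (rule sum_distrib_right)
  also have "\<dots> \<le> (\<Sum>j\<in>UNIV. schwartz_seminorm (\<alpha>(j := Suc (\<alpha> j))) is f)"
  proof (rule sum_mono)
    fix j :: 'd
    have "(\<Prod>i\<in>UNIV. (x $ i) ^ (\<alpha>(j := Suc (\<alpha> j))) i) = x $ j * (\<Prod>i\<in>UNIV. (x $ i) ^ \<alpha> i)"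
      by (simp add: prod.remove[of _ j])
    then have "\<bar>x $ j\<bar> * schwartz_weight \<alpha> is f x = schwartz_weight (\<alpha>(j := Suc (\<alpha> j))) is f x"
      by (simp add: schwartz_weight_def abs_mult)
    then show "\<bar>x $ j\<bar> * schwartz_weight \<alpha> is f x \<le> schwartz_seminorm (\<alpha>(j := Suc (\<alpha> j))) is f"
      using schwartz_weight_le[OF f] by simp
  qed
  finally show ?thesis .
qed

lemma schwartz_seminorm_label:
  fixes p :: "(real^'d::finite \<Rightarrow> complex) \<Rightarrow> real"
  assumes p: "p = schwartz_seminorm \<alpha> is" and "0 < d"
  shows "\<exists>lab :: (real^'d \<Rightarrow> complex) \<Rightarrow> nat. \<forall>f\<in>schwartz. \<forall>g\<in>schwartz.
    lab f = lab g \<longrightarrow> p (\<lambda>x. f x - g x) < d"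
proof -
  obtain lab :: "(real^'d \<Rightarrow> complex) \<Rightarrow> nat" where lab: "\<And>u v B C x. continuous_on UNIV u \<Longrightarrow> (\<forall>x. norm x * cmod (u x) \<le> B) \<Longrightarrow>
    continuous_on UNIV v \<Longrightarrow> (\<forall>x. norm x * cmod (v x) \<le> C) \<Longrightarrow> lab u = lab v \<Longrightarrow> cmod (u x - v x) \<le> d / 2"
    using uniform_label[of "d / 2", where ?'a = "real^'d"] \<open>0 < d\<close> by (auto simp: field_simps) blast
  define U where "U f x = of_real (\<Prod>j\<in>UNIV. (x $ j) ^ \<alpha> j) * iter_partial is f x"
    for f :: "real^'d \<Rightarrow> complex" and x
  have normU: "cmod (U f x) = schwartz_weight \<alpha> is f x" for f x
    unfolding U_def schwartz_weight_def norm_mult norm_of_real ..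
  have contU: "continuous_on UNIV (U f)" if "f \<in> schwartz" for f
    unfolding U_def[abs_def] by (intro continuous_intros schwartz_continuous_iter_partial that)
  have "p (\<lambda>x. f x - g x) < d"
    if f: "f \<in> schwartz" and g: "g \<in> schwartz" and "lab (U f) = lab (U g)" for f g
  proof -
    have "schwartz_weight \<alpha> is (\<lambda>x. f x - g x) x \<le> d / 2" for x
    proof -
      have "U (\<lambda>x. f x - g x) x = U f x - U g x"
        using iter_partial_lincomb[OF f[THEN schwartz_smooth] g[THEN schwartz_smooth], of "is" 1 "-1"]
        by (simp add: U_def right_diff_distrib)
      moreover have "cmod (U f x - U g x) \<le> d / 2"
        using f g that(3) by (intro lab allI) (auto simp: normU intro: contU schwartz_weight_decay)
      ultimately show ?thesis by (simp flip: normU)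
    qed
    then show ?thesis using schwartz_seminorm_le[of \<alpha> "is" "\<lambda>x. f x - g x" "d / 2"] \<open>0 < d\<close> by (simp add: p)
  qed
  then show ?thesis by (intro exI[of _ "\<lambda>f. lab (U f)"]) blast
qed

lemma schwartz_seminorms_label:
  assumes "finite F" "F \<subseteq> {schwartz_seminorm \<alpha> is | \<alpha> is. True}" "0 < d"
  shows "\<exists>lab :: (real^'d::finite \<Rightarrow> complex) \<Rightarrow> nat. \<forall>f\<in>schwartz. \<forall>g\<in>schwartz.
    lab f = lab g \<longrightarrow> (\<forall>p\<in>F. p (\<lambda>x. f x - g x) < d)"
  using assms(1,2)
proof (induction F rule: finite_induct)
  case (insert p F)
  then obtain lab1 :: "(real^'d \<Rightarrow> complex) \<Rightarrow> nat" where lab1: "\<forall>f\<in>schwartz. \<forall>g\<in>schwartz.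
      lab1 f = lab1 g \<longrightarrow> (\<forall>p\<in>F. p (\<lambda>x. f x - g x) < d)"
    by auto
  obtain \<alpha> "is" where "p = schwartz_seminorm \<alpha> is" using insert.prems by auto
  from schwartz_seminorm_label[OF this \<open>0 < d\<close>] obtain lab2 :: "(real^'d \<Rightarrow> complex) \<Rightarrow> nat"
    where lab2: "\<forall>f\<in>schwartz. \<forall>g\<in>schwartz. lab2 f = lab2 g \<longrightarrow> p (\<lambda>x. f x - g x) < d" by blast
  show ?case
    by (rule exI[of _ "\<lambda>f. to_nat (lab1 f, lab2 f)"]) (use lab1 lab2 in simp)
qed auto

text \<open>Choosing a representative for every label and every tolerance gives a countable subset
  with dense image.\<close>

lemma schwartz_separable_image:
  fixes S :: "(real^'d::finite \<Rightarrow> complex) set"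
  assumes T: "linear_continuous_L2 schwartz_topology M T" and S: "S \<subseteq> schwartz" "S \<noteq> {}"
  shows "\<exists>\<phi> :: nat \<Rightarrow> real^'d \<Rightarrow> complex. range \<phi> \<subseteq> S \<and>
    (\<forall>f\<in>S. \<forall>e>0. \<exists>n. L2_norm M (\<lambda>z. T f z - T (\<phi> n) z) < e)"
proof -
  have "\<exists>lab :: (real^'d \<Rightarrow> complex) \<Rightarrow> nat. \<forall>f\<in>schwartz. \<forall>g\<in>schwartz.
    lab f = lab g \<longrightarrow> L2_norm M (\<lambda>z. T f z - T g z) < 1 / real (Suc k)" for k
  proof -
    have "0 < 1 / real (Suc k)" by simp
    from linear_continuous_schwartz_small[OF T this]
    obtain F d where "finite F" "F \<subseteq> {schwartz_seminorm \<alpha> is | \<alpha> is. True}" "0 < d"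
      and F: "\<forall>f\<in>schwartz. \<forall>g\<in>schwartz. (\<forall>p\<in>F. p (\<lambda>x. f x - g x) < d) \<longrightarrow>
        L2_norm M (\<lambda>z. T f z - T g z) < 1 / real (Suc k)"
      by (elim exE conjE)
    from schwartz_seminorms_label[OF this(1-3)] obtain lab :: "(real^'d \<Rightarrow> complex) \<Rightarrow> nat" where
      "\<forall>f\<in>schwartz. \<forall>g\<in>schwartz. lab f = lab g \<longrightarrow> (\<forall>p\<in>F. p (\<lambda>x. f x - g x) < d)" by blast
    then show ?thesis using F by (intro exI[of _ lab]) blast
  qed
  then obtain lab :: "nat \<Rightarrow> (real^'d \<Rightarrow> complex) \<Rightarrow> nat" where lab: "\<And>k f g. f \<in> schwartz \<Longrightarrow> g \<in> schwartz \<Longrightarrow>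
      lab k f = lab k g \<Longrightarrow> L2_norm M (\<lambda>z. T f z - T g z) < 1 / real (Suc k)"
    by metis
  obtain f0 where f0: "f0 \<in> S" using S by blast
  define rep where "rep k j = (if \<exists>f\<in>S. lab k f = j then SOME f. f \<in> S \<and> lab k f = j else f0)" for k j
  have rep: "rep k j \<in> S" for k j
    using f0 someI_ex[of "\<lambda>f. f \<in> S \<and> lab k f = j"] by (auto simp: rep_def)
  have rep_lab: "lab k (rep k (lab k f)) = lab k f" if "f \<in> S" for k f
    using that someI_ex[of "\<lambda>g. g \<in> S \<and> lab k g = lab k f"] by (auto simp: rep_def)
  define \<phi> where "\<phi> n = rep (fst (prod_decode n)) (snd (prod_decode n))" for n
  have "\<exists>n. L2_norm M (\<lambda>z. T f z - T (\<phi> n) z) < e" if f: "f \<in> S" and "0 < e" for f e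
  proof -
    obtain k where k: "1 / real (Suc k) < e" using \<open>0 < e\<close> by (rule nat_approx_posE)
    have "L2_norm M (\<lambda>z. T f z - T (rep k (lab k f)) z) < 1 / real (Suc k)"
      using f S rep by (intro lab) (auto simp: rep_lab)
    then show ?thesis using k
      by (intro exI[of _ "prod_encode (k, lab k f)"]) (simp add: \<phi>_def)
  qed
  then show ?thesis using rep by (intro exI[of _ \<phi>]) (auto simp: \<phi>_def)
qed

text \<open>For a real map, a sequence of real functions spans the image: split a Schwartz function
  into real and imaginary part.\<close>

lemma real_schwartz_separable_image:
  fixes T :: "(real^'d::finite \<Rightarrow> complex) \<Rightarrow> 'w \<Rightarrow> complex"
  assumes T: "linear_continuous_L2 schwartz_topology M T"
    and real: "\<And>f. f \<in> schwartz \<Longrightarrow> (\<And>x. f x \<in> \<real>) \<Longrightarrow> AE z in M. T f z \<in> \<real>"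
  obtains y :: "nat \<Rightarrow> 'w \<Rightarrow> complex" where
    "\<And>n. y n \<in> L2 M" "\<And>n z. y n z \<in> \<real>" "\<And>n. \<exists>f\<in>schwartz. AE z in M. y n z = T f z"
    "\<And>f. f \<in> schwartz \<Longrightarrow> T f \<in> L2_closure M (fun_span y)"
proof -
  let ?S = "{f \<in> schwartz. \<forall>x. f x \<in> \<real>} :: (real^'d \<Rightarrow> complex) set"
  have "(\<lambda>x. 0) \<in> ?S" by simp
  then have "?S \<noteq> {}" by blast
  moreover have "?S \<subseteq> schwartz" by blast
  ultimately obtain \<phi> :: "nat \<Rightarrow> real^'d \<Rightarrow> complex" where \<phi>: "range \<phi> \<subseteq> ?S"
    "\<forall>f\<in>?S. \<forall>e>0. \<exists>n. L2_norm M (\<lambda>z. T f z - T (\<phi> n) z) < e"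
    using schwartz_separable_image[OF T] by meson
  have L2: "f \<in> schwartz \<Longrightarrow> T f \<in> L2 M" for f
    using T by (rule linear_continuous_schwartz_L2)
  have \<phi>': "\<phi> n \<in> schwartz" "\<phi> n x \<in> \<real>" for n x using \<phi>(1) by auto
  define y where "y n z = complex_of_real (Re (T (\<phi> n) z))" for n z
  have ae: "AE z in M. y n z = T (\<phi> n) z" for n
  proof -
    have "AE z in M. T (\<phi> n) z \<in> \<real>" by (rule real) (use \<phi>' in auto)
    then show ?thesis by eventually_elim (simp add: y_def)
  qed
  have yL: "y n \<in> L2 M" for n
    unfolding y_def[abs_def] using L2[OF \<phi>'(1), of n]
    by (intro L2_I[where g = "\<lambda>x. (cmod (T (\<phi> n) x))\<^sup>2"]) (auto simp: L2_def cmod_def)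
  have real_in: "T f \<in> L2_closure M (fun_span y)" if fS: "f \<in> ?S" for f
  proof (rule L2_closure_closed[OF fun_span_L2[OF yL]])
    show fL: "T f \<in> L2 M" using L2 that by simp
    fix e :: real assume "0 < e"
    then obtain n where n: "L2_norm M (\<lambda>z. T f z - T (\<phi> n) z) < e" using bspec[OF \<phi>(2) fS] by blast
    have "L2_norm M (\<lambda>z. T f z - y n z) = L2_norm M (\<lambda>z. T f z - T (\<phi> n) z)"
      using ae[of n] fL yL L2[OF \<phi>'(1)] by (intro L2_norm_cong_AE L2_diff) auto
    then show "\<exists>g\<in>L2_closure M (fun_span y). L2_norm M (\<lambda>z. T f z - g z) < e"
      using n by (intro bexI[of _ "y n"] L2_closure_superset fun_span_base fun_span_L2 yL) simp
  qed
  have all_in: "T f \<in> L2_closure M (fun_span y)" if f: "f \<in> schwartz" for f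
  proof (rule L2_closure_closed[OF fun_span_L2[OF yL] L2[OF f]])
    fix e :: real assume "0 < e"
    let ?r = "\<lambda>x. complex_of_real (Re (f x))" and ?i = "\<lambda>x. complex_of_real (Im (f x))"
    have ri: "?r \<in> schwartz" "?i \<in> schwartz" using f by (auto intro: schwartz_Re schwartz_Im)
    have fe: "(\<lambda>x. 1 * ?r x + \<i> * ?i x) = f" by (simp add: complex_eq[symmetric])
    have "AE z in M. T (\<lambda>x. 1 * ?r x + \<i> * ?i x) z = 1 * T ?r z + \<i> * T ?i z"
      by (rule linear_continuous_L2_AE[OF T]) (simp_all add: topspace_schwartz_topology ri)
    then have "AE z in M. T f z = 1 * T ?r z + \<i> * T ?i z" unfolding fe .
    then have "L2_norm M (\<lambda>z. T f z - (1 * T ?r z + \<i> * T ?i z)) = 0"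
      using L2[OF f] L2[OF ri(1)] L2[OF ri(2)]
      by (subst L2_norm_eq_0_iff) (auto intro!: L2_diff L2_add L2_scale)
    moreover have "(\<lambda>z. 1 * T ?r z + \<i> * T ?i z) \<in> L2_closure M (fun_span y)"
      by (intro L2_closure_lincomb fun_span_L2 yL fun_span_lincomb real_in) (use ri in auto)
    ultimately show "\<exists>g\<in>L2_closure M (fun_span y). L2_norm M (\<lambda>z. T f z - g z) < e"
      using \<open>0 < e\<close> by (intro bexI[of _ "\<lambda>z. 1 * T ?r z + \<i> * T ?i z"]) auto
  qed
  show thesis
  proof (rule that)
    show "\<exists>f\<in>schwartz. AE z in M. y n z = T f z" for n using ae \<phi>' by blast
    show "y n z \<in> \<real>" for n z by (simp add: y_def)
  qed (fact yL all_in)+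
qed


section \<open>Density of Schwartz functions\<close>

lemma exp_neg_even_power_le:
  assumes "m \<ge> 1"
  shows "exp (- ((u::real) ^ (2 * m))) \<le> exp 1 * exp (- u\<^sup>2)"
proof (cases "\<bar>u\<bar> \<le> 1")
  case True
  then have "u\<^sup>2 \<le> 1" by (simp add: abs_square_le_1)
  moreover have "0 \<le> u ^ (2 * m)" by simp
  ultimately show ?thesis unfolding exp_add[symmetric] exp_le_cancel_iff by linarith
next
  case False
  then have "1 \<le> \<bar>u\<bar>\<^sup>2" by (intro one_le_power) simp
  then have "1 \<le> u\<^sup>2" by simp
  then have "(u\<^sup>2) ^ 1 \<le> (u\<^sup>2) ^ m" by (rule power_increasing[OF assms])
  then show ?thesis unfolding exp_add[symmetric] exp_le_cancel_iff by (simp add: power_mult)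
qed

lemma power_exp_neg_square_bounded: "\<exists>C. \<forall>u::real. \<bar>u ^ i\<bar> * exp (- u\<^sup>2) \<le> C"
proof (cases "i = 0")
  case False
  have "\<bar>u ^ i\<bar> * exp (- u\<^sup>2) \<le> 1 + real i ^ i" for u :: real
  proof -
    \<comment> \<open>From \<open>(1 + x / i) ^ i \<le> exp x\<close> with \<open>x = u\<^sup>2\<close>.\<close>
    have "(u\<^sup>2) ^ i \<le> real i ^ i * exp (u\<^sup>2)"
    proof -
      have "(u\<^sup>2 / real i) ^ i \<le> (1 + u\<^sup>2 / real i) ^ i" by (intro power_mono) auto
      also have "\<dots> \<le> exp (u\<^sup>2)"
        using False by (intro exp_ge_one_plus_x_over_n_power_n) (auto intro: order_trans[of _ 0])
      finally show ?thesis using False by (simp add: power_divide field_simps)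
    qed
    then have 1: "(u\<^sup>2) ^ i * exp (- u\<^sup>2) \<le> real i ^ i"
      by (simp add: exp_minus field_simps)
    have "\<bar>u ^ i\<bar> \<le> 1 + \<bar>u ^ i\<bar>\<^sup>2"
      using sum_squares_bound[of "\<bar>u ^ i\<bar>" 1] zero_le_power2[of "\<bar>u ^ i\<bar>"] abs_ge_zero[of "u ^ i"]
      by simp
    also have "\<bar>u ^ i\<bar>\<^sup>2 = (u\<^sup>2) ^ i" by (simp add: power_mult[symmetric] mult.commute)
    finally have "\<bar>u ^ i\<bar> * exp (- u\<^sup>2) \<le> (1 + (u\<^sup>2) ^ i) * exp (- u\<^sup>2)"
      by (rule mult_right_mono) simp
    also have "\<dots> = exp (- u\<^sup>2) + (u\<^sup>2) ^ i * exp (- u\<^sup>2)" by (simp add: distrib_right)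
    also have "\<dots> \<le> 1 + real i ^ i" by (intro add_mono 1) simp
    finally show ?thesis .
  qed
  then show ?thesis by blast
qed (auto intro: exI[of _ 1])

lemma poly_exp_neg_even_power_bounded:
  assumes m: "m \<ge> 1" and r: "r > 0"
  shows "\<exists>C. \<forall>t::real. \<bar>poly p t * exp (- (((t - c) / r) ^ (2 * m)))\<bar> \<le> C"
proof -
  define q where "q = pcompose p [:c, r:]"
  obtain C :: "nat \<Rightarrow> real" where C: "\<And>i u. \<bar>u ^ i\<bar> * exp (- u\<^sup>2) \<le> C i"
    using power_exp_neg_square_bounded by metis
  have "\<bar>poly p t * exp (- (((t - c) / r) ^ (2 * m)))\<bar> \<le> exp 1 * (\<Sum>i\<le>degree q. \<bar>coeff q i\<bar> * C i)" for t
  proof -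
    define u where "u = (t - c) / r"
    have "t = c + u * r" using r by (simp add: u_def)
    then have "poly p t = poly q u" by (simp add: q_def poly_pcompose)
    then have "\<bar>poly p t * exp (- (u ^ (2 * m)))\<bar> = \<bar>poly q u\<bar> * exp (- (u ^ (2 * m)))"
      by (simp add: abs_mult)
    also have "\<dots> \<le> (\<Sum>i\<le>degree q. \<bar>coeff q i\<bar> * \<bar>u ^ i\<bar>) * (exp 1 * exp (- u\<^sup>2))"
      unfolding poly_altdef abs_mult[symmetric]
      by (intro mult_mono sum_abs exp_neg_even_power_le m) (auto intro: sum_nonneg)
    also have "\<dots> = exp 1 * (\<Sum>i\<le>degree q. \<bar>coeff q i\<bar> * (\<bar>u ^ i\<bar> * exp (- u\<^sup>2)))"
      by (simp add: sum_distrib_left sum_distrib_right mult_ac)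
    also have "\<dots> \<le> exp 1 * (\<Sum>i\<le>degree q. \<bar>coeff q i\<bar> * C i)"
      by (intro mult_left_mono sum_mono C) auto
    finally show ?thesis by (simp add: u_def)
  qed
  then show ?thesis by blast
qed

text \<open>A smooth substitute for the indicator of the box with centre \<open>c\<close> and half side lengths
  \<open>r\<close>, to which it converges almost everywhere as \<open>m\<close> grows.\<close>

definition bump :: "nat \<Rightarrow> real^'d \<Rightarrow> real^'d \<Rightarrow> real^'d::finite \<Rightarrow> real" where
  "bump m c r x = (\<Prod>j\<in>UNIV. exp (- (((x $ j - c $ j) / r $ j) ^ (2 * m))))"

lemma bump_schwartz:
  fixes c r :: "real^'d::finite"
  assumes m: "m \<ge> 1" and r: "\<And>j. r $ j > 0"
  shows "(\<lambda>x. of_real (bump m c r x)) \<in> schwartz"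
proof -
  \<comment> \<open>All derivatives of \<open>exp (- Q)\<close> have the form \<open>P * exp (- Q)\<close> with polynomials \<open>P\<close> that are
     given recursively.\<close>
  define Q where "Q j = [:- c $ j / r $ j, 1 / r $ j:] ^ (2 * m)" for j
  define P where "P j = rec_nat 1 (\<lambda>n p. pderiv p - p * pderiv (Q j))" for j
  define D where "D j n t = poly (P j n) t * exp (- poly (Q j) t)" for j n t
  have Q: "poly (Q j) t = ((t - c $ j) / r $ j) ^ (2 * m)" for j t
    by (simp add: Q_def diff_divide_distrib)
  have "(\<lambda>x. complex_of_real (\<Prod>j\<in>UNIV. D j 0 (x $ j))) \<in> schwartz"
  proof (rule tensor_schwartz)
    fix j n t
    show "(D j n has_real_derivative D j (Suc n) t) (at t)"
      unfolding D_def[abs_def] P_def by (auto intro!: derivative_eq_intros simp: algebra_simps)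
    fix k
    have eq: "t ^ k * D j n t = poly (monom 1 k * P j n) t * exp (- (((t - c $ j) / r $ j) ^ (2 * m)))" for t
      by (simp add: D_def Q poly_monom)
    show "\<exists>C. \<forall>t. \<bar>t ^ k * D j n t\<bar> \<le> C"
      unfolding eq by (rule poly_exp_neg_even_power_bounded[OF m r])
  qed
  then show ?thesis by (simp add: bump_def D_def P_def Q)
qed

lemma exp_neg_square_le: "exp (- u\<^sup>2) \<le> 1 / (1 + (u::real)\<^sup>2)"
proof -
  have "1 + u\<^sup>2 \<le> exp (u\<^sup>2)" by (rule exp_ge_add_one_self)
  then show ?thesis by (simp add: exp_minus divide_inverse add_pos_nonneg le_imp_inverse_le)
qed

lemma one_plus_square_affine_le:
  assumes "r > 0"
  shows "1 / (1 + ((t - c) / r)\<^sup>2) \<le> (1 + 2 * c\<^sup>2 + 2 * r\<^sup>2) * (1 / (1 + (t::real)\<^sup>2))"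
proof -
  define u where "u = (t - c) / r"
  have t: "t = c + r * u" using assms by (simp add: u_def)
  have "t\<^sup>2 \<le> 2 * c\<^sup>2 + 2 * r\<^sup>2 * u\<^sup>2"
    using sum_squares_bound[of c "r * u"] by (simp add: t power2_sum power_mult_distrib)
  then have "1 + t\<^sup>2 \<le> (1 + 2 * c\<^sup>2 + 2 * r\<^sup>2) * (1 + u\<^sup>2)"
    by (simp add: algebra_simps) (smt (verit) zero_le_power2 mult_nonneg_nonneg)
  then show ?thesis
    unfolding u_def[symmetric]
    by (simp add: divide_simps add_pos_nonneg add_nonneg_eq_0_iff) 
qed

text \<open>Axis-parallel hyperplanes are null sets; this discards the boundary of a box, where the
  bump functions have the wrong limit.\<close>

lemma AE_lborel_component_neq: "AE x::real^'d::finite in lborel. x $ j \<noteq> s"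
proof -
  have "negligible {x::real^'d. x \<bullet> axis j 1 = s}"
    by (rule negligible_standard_hyperplane) (auto simp: Basis_vec_def)
  then have "{x::real^'d. x $ j = s} \<in> null_sets lebesgue"
    by (simp add: negligible_iff_null_sets inner_axis)
  moreover have "closed {x::real^'d. x $ j = s}"
    by (intro closed_Collect_eq continuous_intros)
  then have "{x::real^'d. x $ j = s} \<in> sets lborel" by simp
  ultimately have "{x::real^'d. x $ j = s} \<in> null_sets lborel" by (simp add: null_sets_completion_iff)
  from AE_not_in[OF this] show ?thesis by simp
qed

text \<open>Complex indicator functions.\<close>

abbreviation cind :: "'a set \<Rightarrow> 'a \<Rightarrow> complex" where
  "cind A x \<equiv> of_real (indicator A x)"

lemma cind_Int_box_L2:
  fixes a b :: "real^'d::finite"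
  assumes [measurable]: "A \<in> sets borel"
  shows "cind (A \<inter> box a b) \<in> L2 lborel"
proof (rule L2_I)
  show "integrable lborel (indicator (box a b) :: real^'d \<Rightarrow> real)"
    by (intro integrable_real_indicator emeasure_lborel_box_finite) simp
qed (auto simp: indicator_def)

lemma exp_neg_even_power_tendsto:
  assumes "\<bar>u\<bar> \<noteq> (1::real)"
  shows "(\<lambda>m. exp (- (u ^ (2 * Suc m)))) \<longlonglongrightarrow> (if \<bar>u\<bar> < 1 then 1 else 0)"
proof (cases "\<bar>u\<bar> < 1")
  case True
  then have "norm (u\<^sup>2) < 1" by (simp add: abs_square_less_1)
  then have "(\<lambda>m. (u\<^sup>2) ^ Suc m) \<longlonglongrightarrow> 0" by (intro LIMSEQ_Suc LIMSEQ_power_zero)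
  from tendsto_exp[OF tendsto_minus[OF this]] show ?thesis using True by (simp only: power_mult) simp
next
  case False
  then have "1 < \<bar>u\<bar>\<^sup>2" using assms by (intro one_less_power) auto
  then have u: "1 < u\<^sup>2" by simp
  have "(\<lambda>m. exp (- (u ^ (2 * Suc m)))) \<longlonglongrightarrow> 0"
  proof (rule tendsto_sandwich[OF _ _ tendsto_const])
    show "(\<lambda>m. inverse ((u\<^sup>2) ^ Suc m)) \<longlonglongrightarrow> 0"
      by (intro LIMSEQ_Suc LIMSEQ_inverse_realpow_zero u)
    have "exp (- (u ^ (2 * Suc m))) \<le> inverse ((u\<^sup>2) ^ Suc m)" for m
    proof -
      have "0 < (u\<^sup>2) ^ Suc m" 
        by (rule zero_less_power[OF order.strict_trans[OF zero_less_one u]])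
      moreover have "(u\<^sup>2) ^ Suc m \<le> exp ((u\<^sup>2) ^ Suc m)"
        using exp_ge_add_one_self[of "(u\<^sup>2) ^ Suc m"] by linarith
      ultimately show ?thesis unfolding power_mult exp_minus by (rule le_imp_inverse_le[rotated])
    qed
    then show "\<forall>\<^sub>F m in sequentially. exp (- (u ^ (2 * Suc m))) \<le> inverse ((u\<^sup>2) ^ Suc m)" by simp
  qed simp
  then show ?thesis using False by simp
qed

text \<open>Indicators of boxes are limits of bump functions by dominated convergence.\<close>

lemma box_schwartz_closure:
  fixes a b :: "real^'d::finite"
  shows "cind (box a b) \<in> L2_closure lborel schwartz"
proof (cases "box a b = {}")
  case True
  then show ?thesis using L2_closure_superset[OF schwartz_zero schwartz_subset_L2] by simp
next
  case False
  then obtain z where "z \<in> box a b" by blast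
  then have ab: "a $ j < b $ j" for j by (auto simp: mem_box_cart intro: less_trans)
  define c r where "c = (1/2) *\<^sub>R (a + b)" and "r = (1/2) *\<^sub>R (b - a)"
  have r: "r $ j > 0" for j using ab[of j] by (simp add: r_def)
  let ?u = "\<lambda>j x. (x $ j - c $ j) / r $ j"
  have mem: "x \<in> box a b \<longleftrightarrow> (\<forall>j. \<bar>?u j x\<bar> < 1)" for x
  proof -
    have "a $ j < x $ j \<and> x $ j < b $ j \<longleftrightarrow> \<bar>x $ j - c $ j\<bar> < r $ j" for j
      by (auto simp: c_def r_def abs_less_iff field_simps)
    then show ?thesis using r by (simp add: mem_box_cart abs_divide abs_of_pos)
  qed
  define K where "K = (\<Prod>j\<in>UNIV. exp 1 * (1 + 2 * (c $ j)\<^sup>2 + 2 * (r $ j)\<^sup>2))"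
  have K: "K \<ge> 0" unfolding K_def by (intro prod_nonneg) (auto intro!: mult_nonneg_nonneg add_nonneg_nonneg)
  \<comment> \<open>Both the indicator and the bump functions lie below a multiple of the Cauchy weight.\<close>
  have dom: "(\<Prod>j\<in>UNIV. exp 1 * (1 / (1 + (?u j x)\<^sup>2))) \<le> K * cauchy_weight x" for x
    unfolding K_def cauchy_weight_def prod.distrib[symmetric] mult.assoc
    by (intro prod_mono conjI mult_left_mono one_plus_square_affine_le r) (auto intro: add_nonneg_nonneg)
  have bump_le: "0 \<le> bump (Suc m) c r x" "bump (Suc m) c r x \<le> K * cauchy_weight x" for m x
  proof -
    have "bump (Suc m) c r x \<le> (\<Prod>j\<in>UNIV. exp 1 * (1 / (1 + (?u j x)\<^sup>2)))"
      unfolding bump_def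
      by (intro prod_mono conjI order_trans[OF exp_neg_even_power_le mult_left_mono[OF exp_neg_square_le]]) auto
    then show "bump (Suc m) c r x \<le> K * cauchy_weight x" using dom[of x] by linarith
  qed (simp add: bump_def prod_nonneg)
  have ind_le: "indicator (box a b) x \<le> K * cauchy_weight x" for x
  proof (cases "x \<in> box a b")
    case True
    have "1 \<le> exp 1 * (1 / (1 + w))" if "0 \<le> w" "w \<le> 1" for w :: real
      using that exp_ge_add_one_self[of 1] by (simp add: le_divide_eq)
    then have "1 \<le> exp 1 * (1 / (1 + (?u j x)\<^sup>2))" for j
      using True mem by (simp only: zero_le_power2 abs_square_le_1 less_imp_le)
    then have "1 \<le> (\<Prod>j\<in>UNIV. exp 1 * (1 / (1 + (?u j x)\<^sup>2)))" by (intro prod_ge_1) auto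
    then show ?thesis using True dom[of x] by simp
  qed (use K less_imp_le[OF cauchy_weight_pos] in \<open>auto intro: mult_nonneg_nonneg\<close>)
  have lim: "AE x in lborel. (\<lambda>m. complex_of_real (bump (Suc m) c r x)) \<longlonglongrightarrow> cind (box a b) x"
  proof -
    have "AE x in lborel. \<forall>j. x $ j \<noteq> a $ j \<and> x $ j \<noteq> b $ j"
      by (intro AE_all_countable[THEN iffD2] allI AE_conjI AE_lborel_component_neq)
    then show ?thesis
    proof eventually_elim
      case (elim x)
      have neq: "\<bar>?u j x\<bar> \<noteq> 1" for j
        using elim[rule_format, of j] r[of j] by (auto simp: c_def r_def abs_if field_simps split: if_splits)
      have "(\<lambda>m. exp (- ((?u j x) ^ (2 * Suc m)))) \<longlonglongrightarrow> (if \<bar>?u j x\<bar> < 1 then 1 else 0)" for j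
        by (rule exp_neg_even_power_tendsto[OF neq])
      then have "(\<lambda>m. bump (Suc m) c r x) \<longlonglongrightarrow> (\<Prod>j\<in>UNIV. if \<bar>?u j x\<bar> < 1 then 1 else 0)"
        unfolding bump_def by (intro tendsto_prod)
      also have "(\<Prod>j\<in>UNIV. if \<bar>?u j x\<bar> < 1 then 1 else (0::real)) = indicator (box a b) x"
        by (auto simp: indicator_def mem prod_zero_iff)
      finally show ?case by (rule tendsto_of_real)
    qed
  qed
  have L2: "cind (box a b) \<in> L2 lborel" using cind_Int_box_L2[of UNIV a b] by simp
  show ?thesis
  proof (rule L2_closure_tendsto[OF schwartz_subset_L2 L2])
    fix m show "(\<lambda>x. of_real (bump (Suc m) c r x)) \<in> L2_closure lborel schwartz"
      by (intro L2_closure_superset bump_schwartz schwartz_subset_L2 r) simp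
  next
    show "(\<lambda>m. L2_norm lborel (\<lambda>x. cind (box a b) x - of_real (bump (Suc m) c r x))) \<longlonglongrightarrow> 0"
    proof (rule L2_dominated_tendsto[OF _ _ _ lim])
      show "integrable lborel (\<lambda>x. K\<^sup>2 * cauchy_weight (x::real^'d))"
        by (intro integrable_mult_right integrable_cauchy_weight)
      show "(\<lambda>x. complex_of_real (bump (Suc m) c r x)) \<in> borel_measurable lborel" for m
        using schwartz_measurable[OF bump_schwartz[OF _ r, of "Suc m" c]] by simp
      fix m x
      have "\<bar>indicator (box a b) x - bump (Suc m) c r x\<bar> \<le> K * cauchy_weight x"
        using bump_le[of m x] ind_le[of x] by (auto simp: indicator_def split: if_splits)
      then have "(\<bar>indicator (box a b) x - bump (Suc m) c r x\<bar>)\<^sup>2 \<le> (K * cauchy_weight x)\<^sup>2"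
        by (rule power_mono) simp
      also have "\<dots> = K\<^sup>2 * (cauchy_weight x * cauchy_weight x)" by (simp add: power2_eq_square)
      also have "\<dots> \<le> K\<^sup>2 * cauchy_weight x"
        using cauchy_weight_le_1[of x] cauchy_weight_pos[of x]
        by (intro mult_left_mono) (auto simp: mult_left_le)
      finally show "(cmod (cind (box a b) x - of_real (bump (Suc m) c r x)))\<^sup>2 \<le> K\<^sup>2 * cauchy_weight x"
        unfolding of_real_diff[symmetric] norm_of_real .
    qed auto
  qed
qed

lemma box_Int_box_cart: "box a b \<inter> box c d = box (\<chi> j. max (a $ j) (c $ j)) (\<chi> j. min (b $ j) (d $ j))"
  for a b c d :: "real^'d::finite"
  by (auto simp: mem_box_cart)

text \<open>Borel sets are reached from boxes by Dynkin's theorem. The intersection with a fixed box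
  keeps all measures finite.\<close>

lemma borel_schwartz_closure:
  fixes A :: "(real^'d::finite) set"
  assumes "A \<in> sets borel"
  shows "cind (A \<inter> box a b) \<in> L2_closure lborel schwartz"
proof -
  let ?G = "range (\<lambda>(a, b). box a b) :: (real^'d) set set"
  have "A \<in> sigma_sets UNIV ?G" using assms by (simp add: borel_eq_box)
  have st: "Int_stable ?G"
    by (auto simp: Int_stable_def box_Int_box_cart)
  have "?G \<subseteq> Pow UNIV" by simp
  with st show ?thesis using \<open>A \<in> sigma_sets UNIV ?G\<close>
  proof (induction A rule: sigma_sets_induct_disjoint)
    case (basic A)
    then show ?case by (auto simp: box_Int_box_cart box_schwartz_closure)
  next
    case empty
    then show ?case using box_schwartz_closure[of 0 0] by simp
  next
    case (compl A)
    have "(\<lambda>x. 1 * cind (box a b) x + (-1) * cind (A \<inter> box a b) x) \<in> L2_closure lborel schwartz"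
      by (intro L2_closure_lincomb schwartz_subset_L2 schwartz_lincomb box_schwartz_closure compl)
    also have "(\<lambda>x. 1 * cind (box a b) x + (-1) * cind (A \<inter> box a b) x) = cind ((UNIV - A) \<inter> box a b)"
      by (auto simp: fun_eq_iff indicator_def)
    finally show ?case .
  next
    case (union A)
    have A: "A i \<in> sets borel" for i
      using union by (auto simp: borel_eq_box)
    let ?s = "\<lambda>n x. \<Sum>i\<in>{..<n}. 1 * cind (A i \<inter> box a b) x"
    have s: "?s n x = cind ((\<Union>i<n. A i) \<inter> box a b) x" for n x
    proof -
      have "indicator ((\<Union>i<n. A i)) x = (\<Sum>i<n. indicator (A i) x :: real)"
        using union(1) by (intro indicator_UN_disjoint) (auto simp: disjoint_family_on_def)
      then have "?s n x = of_real (indicator (\<Union>i<n. A i) x * indicator (box a b) x)"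
        by (simp only: indicator_inter_arith of_real_mult of_real_sum sum_distrib_right mult_1)
      then show ?thesis by (simp only: indicator_inter_arith)
    qed
    show ?case
    proof (rule L2_closure_tendsto[OF schwartz_subset_L2])
      show "cind ((\<Union>i. A i) \<inter> box a b) \<in> L2 lborel" using A by (intro cind_Int_box_L2) auto
      show "?s n \<in> L2_closure lborel schwartz" for n
        by (intro L2_closure_sum schwartz_subset_L2 schwartz_lincomb schwartz_nonempty union)
      show "(\<lambda>n. L2_norm lborel (\<lambda>x. cind ((\<Union>i. A i) \<inter> box a b) x - ?s n x)) \<longlonglongrightarrow> 0"
      proof (rule L2_dominated_tendsto)
        show "integrable lborel (indicator (box a b) :: real^'d \<Rightarrow> real)"
          by (intro integrable_real_indicator emeasure_lborel_box_finite) simp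
        show "AE x in lborel. (\<lambda>n. ?s n x) \<longlonglongrightarrow> cind ((\<Union>i. A i) \<inter> box a b) x"
        proof (rule AE_I2)
          fix x
          have "(\<lambda>n. indicator (\<Union>i<n. A i) x :: real) \<longlonglongrightarrow> indicator (\<Union>i. A i) x"
            by (rule LIMSEQ_indicator_UN)
          then show "(\<lambda>n. ?s n x) \<longlonglongrightarrow> cind ((\<Union>i. A i) \<inter> box a b) x"
            unfolding s unfolding indicator_inter_arith by (intro tendsto_of_real tendsto_mult tendsto_const)
        qed
        show "(cmod (cind ((\<Union>i. A i) \<inter> box a b) x - ?s n x))\<^sup>2 \<le> indicator (box a b) x" for n x
          unfolding s by (auto simp: indicator_def)
        show "?s n \<in> borel_measurable lborel" for n
          using A by (auto intro!: borel_measurable_sum)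
      qed (use A in auto)
    qed
  qed
qed

theorem schwartz_dense:
  fixes f :: "real^'d::finite \<Rightarrow> complex"
  assumes f: "f \<in> L2 lborel"
  shows "f \<in> L2_closure lborel schwartz"
proof -
  have fm: "f \<in> borel_measurable lborel" using f by (simp add: L2_def)
  obtain F where F: "\<And>i. simple_function lborel (F i)" "\<And>x. (\<lambda>i. F i x) \<longlonglongrightarrow> f x"
      "\<And>i x. cmod (F i x) \<le> 2 * cmod (f x)"
    using borel_measurable_implies_sequence_metric[OF fm, of 0] by (auto simp: dist_norm)
  have [measurable]: "F i \<in> borel_measurable borel" for i
    using borel_measurable_simple_function[OF F(1)] by simp
  define B :: "nat \<Rightarrow> (real^'d) set" where "B i = box (\<chi> j. - real i) (\<chi> j. real i)" for i
  let ?s = "\<lambda>i x. F i x * cind (B i) x"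
  show ?thesis
  proof (rule L2_closure_tendsto[OF schwartz_subset_L2 f])
    fix i
    have fin: "finite (range (F i))" using F(1)[of i] by (simp add: simple_function_def)
    have "(\<lambda>x. \<Sum>v\<in>range (F i). v * cind (F i -` {v} \<inter> B i) x) \<in> L2_closure lborel schwartz"
      unfolding B_def
      by (intro L2_closure_sum schwartz_subset_L2 schwartz_lincomb borel_schwartz_closure)
         (use schwartz_nonempty measurable_sets_borel[of "F i" borel] in auto)
    also have "(\<lambda>x. \<Sum>v\<in>range (F i). v * cind (F i -` {v} \<inter> B i) x) = ?s i"
    proof
      fix x
      have "(\<Sum>v\<in>range (F i). v * cind (F i -` {v} \<inter> B i) x) =
          (\<Sum>v\<in>range (F i). if v = F i x then ?s i x else 0)"
        by (intro sum.cong) (auto simp: indicator_def)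
      then show "(\<Sum>v\<in>range (F i). v * cind (F i -` {v} \<inter> B i) x) = ?s i x" using fin by simp
    qed
    finally show "?s i \<in> L2_closure lborel schwartz" .
  next
    show "(\<lambda>i. L2_norm lborel (\<lambda>x. f x - ?s i x)) \<longlonglongrightarrow> 0"
    proof (rule L2_dominated_tendsto)
      show "integrable lborel (\<lambda>x. 9 * (cmod (f x))\<^sup>2)" using f by (simp add: L2_def)
      show "AE x in lborel. (\<lambda>i. ?s i x) \<longlonglongrightarrow> f x"
      proof (rule AE_I2)
        fix x :: "real^'d"
        obtain n where n: "norm x < real n" using reals_Archimedean2 by blast
        have inB: "x \<in> B i" if "i \<ge> n" for i
          using n that component_le_norm_cart[of x] by (auto simp: B_def mem_box_cart abs_less_iff) (smt (verit) of_nat_mono)+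
        have "\<forall>\<^sub>F i in sequentially. F i x = ?s i x"
          using eventually_ge_at_top[of n] by eventually_elim (simp add: inB)
        with F(2) show "(\<lambda>i. ?s i x) \<longlonglongrightarrow> f x" by (rule Lim_transform_eventually)
      qed
      fix i x
      have "cmod (?s i x) \<le> 2 * cmod (f x)" using F(3)[of i x] by (auto simp: indicator_def norm_mult)
      then have "cmod (f x - ?s i x) \<le> 3 * cmod (f x)" using norm_triangle_ineq4[of "f x" "?s i x"] by linarith
      then have "(cmod (f x - ?s i x))\<^sup>2 \<le> (3 * cmod (f x))\<^sup>2" by (rule power_mono) simp
      then show "(cmod (f x - ?s i x))\<^sup>2 \<le> 9 * (cmod (f x))\<^sup>2" by (simp add: power_mult_distrib)
    qed (use fm in \<open>auto simp: B_def\<close>)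
  qed
qed


section \<open>A real orthonormal basis for Lebesgue measure\<close>

text \<open>Indicators of the unit cubes along the diagonal.\<close>

lemma lborel_orthonormal_sequence:
  "\<exists>u :: nat \<Rightarrow> real^'d::finite \<Rightarrow> complex. orthosystem lborel u \<and> (\<forall>k. L2_norm lborel (u k) = 1)"
proof -
  define Q :: "nat \<Rightarrow> (real^'d) set" where "Q k = box (\<chi> j. real k) (\<chi> j. real k + 1)" for k
  have L2: "cind (Q k) \<in> L2 lborel" for k
    using cind_Int_box_L2[of UNIV] unfolding Q_def by simp
  have "measure lborel (Q k) = 1" for k
  proof -
    have "emeasure lborel (Q k) = ennreal (\<Prod>b\<in>Basis. ((\<chi> j. real k + 1) - (\<chi> j. real k) :: real^'d) \<bullet> b)"
      unfolding Q_def by (rule emeasure_lborel_box) (auto simp: Basis_vec_def inner_axis)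
    also have "(\<Prod>b\<in>Basis. ((\<chi> j. real k + 1) - (\<chi> j. real k) :: real^'d) \<bullet> b) = 1"
      by (intro prod.neutral) (auto simp: Basis_vec_def inner_axis)
    finally show ?thesis by (simp add: measure_def)
  qed
  moreover have "(cmod (cind (Q k) x))\<^sup>2 = indicator (Q k) x" for k x by (simp add: indicator_def)
  ultimately have norm: "L2_norm lborel (cind (Q k)) = 1" for k
    by (simp add: L2_norm_def)
  have "cind (Q j) x * cnj (cind (Q k) x) = 0" if "j \<noteq> k" for j k x
  proof -
    have "\<not> (x \<in> Q j \<and> x \<in> Q k)"
    proof
      assume "x \<in> Q j \<and> x \<in> Q k"
      then have "\<forall>i. real j < x $ i \<and> x $ i < real j + 1 \<and> real k < x $ i \<and> x $ i < real k + 1"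
        by (auto simp: Q_def mem_box_cart)
      then have "real j < real k + 1 \<and> real k < real j + 1" by (meson order.strict_trans)
      then show False using that by linarith
    qed
    then show ?thesis by (auto simp: indicator_def)
  qed
  then have "L2_inner lborel (cind (Q j)) (cind (Q k)) = 0" if "j \<noteq> k" for j k
    unfolding L2_inner_def by (simp only: that not_False_eq_True integral_zero)
  then have "orthosystem lborel (\<lambda>k. cind (Q k))" using L2 norm by (auto simp: orthosystem_def)
  then show ?thesis using norm by blast
qed

text \<open>Gram--Schmidt applied to a dense sequence of real Schwartz functions, after which zero
  vectors are removed.\<close>

lemma lborel_orthonormal_basis:
  obtains e :: "nat \<Rightarrow> real^'d::finite \<Rightarrow> complex" where
    "orthosystem lborel e" "\<And>k. L2_norm lborel (e k) = 1" "\<And>k x. e k x \<in> \<real>"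
    "\<And>f. f \<in> L2 lborel \<Longrightarrow> f \<in> L2_closure lborel (fun_span e)"
proof -
  have "\<exists>y :: nat \<Rightarrow> real^'d \<Rightarrow> complex. (\<forall>n. y n \<in> L2 lborel) \<and> (\<forall>n z. y n z \<in> \<real>) \<and>
      (\<forall>f\<in>schwartz. f \<in> L2_closure lborel (fun_span y))"
    by (rule real_schwartz_separable_image[OF linear_continuous_schwartz_inclusion]) (rule AE_I2, blast, blast)
  then obtain y :: "nat \<Rightarrow> real^'d \<Rightarrow> complex" where y: "\<And>n. y n \<in> L2 lborel" "\<And>n z. y n z \<in> \<real>"
      "\<And>f. f \<in> schwartz \<Longrightarrow> f \<in> L2_closure lborel (fun_span y)"
    by blast
  let ?e = "gram_schmidt lborel y"
  have e: "orthosystem lborel ?e" by (rule orthosystem_gram_schmidt[OF y(1)])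
  have total: "f \<in> L2_closure lborel (fun_span ?e)" if f: "f \<in> L2 lborel" for f
  proof -
    have "f \<in> L2_closure lborel (fun_span y)"
    proof (rule L2_closure_closed[OF fun_span_L2[OF y(1)] f])
      fix d :: real assume "0 < d"
      then obtain g where "g \<in> schwartz" "L2_norm lborel (\<lambda>x. f x - g x) < d"
        using schwartz_dense[OF f] by (auto simp: L2_closure_def)
      then show "\<exists>g\<in>L2_closure lborel (fun_span y). L2_norm lborel (\<lambda>x. f x - g x) < d"
        using y(3) by blast
    qed
    then show ?thesis
      by (rule L2_closure_fun_span_mono[OF gram_schmidt_span[OF y(1)] orthosystem_L2[OF e]])
  qed
  obtain u :: "nat \<Rightarrow> real^'d \<Rightarrow> complex" where u: "orthosystem lborel u" "\<And>k. L2_norm lborel (u k) = 1"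
    using lborel_orthonormal_sequence by blast
  obtain s where "orthosystem lborel (\<lambda>k. ?e (s k))" "\<And>k. L2_norm lborel (?e (s k)) = 1"
    "\<And>f. f \<in> L2_closure lborel (fun_span ?e) \<Longrightarrow> f \<in> L2_closure lborel (fun_span (\<lambda>k. ?e (s k)))"
    using orthosystem_reindex[OF e orthosystem_infinite_nonzero[OF e total u]] by blast
  then show thesis
    using that[of "\<lambda>k. ?e (s k)"] gram_schmidt_real[of y lborel, OF y(1,2)] total by blast
qed


section \<open>Orthonormal variables on an enlarged probability space\<close>

text \<open>Independent fair signs.\<close>

lemma coordinate_noise:
  "\<exists>(N :: (nat \<Rightarrow> real) measure) (\<eta> :: nat \<Rightarrow> (nat \<Rightarrow> real) \<Rightarrow> complex).
    prob_space N \<and> orthosystem N \<eta> \<and> (\<forall>k. L2_norm N (\<eta> k) = 1) \<and> (\<forall>k \<omega>. \<eta> k \<omega> \<in> \<real>) \<and>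
    (\<forall>k. (LINT \<omega>|N. \<eta> k \<omega>) = 0)"
proof -
  define R :: "real measure" where "R = measure_pmf (pmf_of_set {-1, 1})"
  define N where "N = PiM UNIV (\<lambda>_::nat. R)"
  interpret R: product_prob_space "\<lambda>_::nat. R" UNIV
    by (rule product_prob_spaceI) (simp add: R_def measure_pmf.prob_space_axioms)
  have intR: "integrable R f" for f :: "real \<Rightarrow> real"
    unfolding R_def by (rule integrable_measure_pmf_finite) simp
  have R: "(LINT x|R. x) = 0" "(LINT x|R. x\<^sup>2) = 1"
    by (simp_all add: R_def integral_pmf_of_set)
  have comp: "(\<lambda>\<omega>. \<omega> k) \<in> measurable N R" for k
    unfolding N_def by (rule measurable_component_singleton) simp
  have distr: "distr N R (\<lambda>\<omega>. \<omega> k) = R" for k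
    unfolding N_def by (rule R.PiM_component) simp
  have Rm: "f \<in> borel_measurable R" for f :: "real \<Rightarrow> real" by (simp add: R_def)
  have int1: "(LINT \<omega>|N. f (\<omega> k)) = (LINT x|R. f x)" and intble1: "integrable N (\<lambda>\<omega>. f (\<omega> k))"
    for f :: "real \<Rightarrow> real" and k
    using integral_distr[OF comp Rm, of k f] integrable_distr[OF comp, of k f] intR[of f]
    by (simp_all add: distr)
  \<comment> \<open>Distinct coordinates are uncorrelated, by integration over the two relevant factors.\<close>
  have int2: "(LINT \<omega>|N. \<omega> j * \<omega> k) = 0" if "j \<noteq> k" for j k
  proof -
    let ?J = "{j, k}"
    have m: "(\<lambda>\<omega>. restrict \<omega> ?J) \<in> measurable N (PiM ?J (\<lambda>_. R))"
      unfolding N_def by (rule measurable_restrict_subset) simp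
    have m2: "(\<lambda>\<omega>. \<Prod>i\<in>?J. \<omega> i) \<in> borel_measurable (PiM ?J (\<lambda>_. R))"
    proof (rule borel_measurable_prod)
      fix i assume "i \<in> ?J"
      then have "(\<lambda>\<omega>. \<omega> i) \<in> measurable (PiM ?J (\<lambda>_. R)) R" by (rule measurable_component_singleton)
      from measurable_compose[OF this Rm[of "\<lambda>x. x"]]
      show "(\<lambda>\<omega>. \<omega> i) \<in> borel_measurable (PiM ?J (\<lambda>_. R))" .
    qed
    have "(LINT \<omega>|N. \<omega> j * \<omega> k) = (LINT \<omega>|N. (\<Prod>i\<in>?J. restrict \<omega> ?J i))"
      using that by simp
    also have "\<dots> = (LINT \<omega>|(distr N (PiM ?J (\<lambda>_. R)) (\<lambda>\<omega>. restrict \<omega> ?J)). (\<Prod>i\<in>?J. \<omega> i))"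
      by (rule integral_distr[OF m m2, symmetric])
    also have "distr N (PiM ?J (\<lambda>_. R)) (\<lambda>\<omega>. restrict \<omega> ?J) = PiM ?J (\<lambda>_. R)"
      unfolding N_def by (rule R.distr_PiM_restrict_finite) auto
    also have "(LINT \<omega>|(PiM ?J (\<lambda>_. R)). (\<Prod>i\<in>?J. \<omega> i)) = (\<Prod>i\<in>?J. LINT x|R. x)"
      by (rule R.product_integral_prod) (auto intro: intR)
    also have "\<dots> = 0" by (simp add: R card_gt_0_iff)
    finally show ?thesis .
  qed
  define \<eta> :: "nat \<Rightarrow> (nat \<Rightarrow> real) \<Rightarrow> complex" where "\<eta> k \<omega> = of_real (\<omega> k)" for k \<omega>
  have L2: "\<eta> k \<in> L2 N" for k
    using intble1[of "\<lambda>x. x\<^sup>2" k] measurable_compose[OF comp[of k] Rm[of "\<lambda>x. x"]]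
    by (simp add: L2_def \<eta>_def[abs_def])
  have norm: "L2_norm N (\<eta> k) = 1" for k
    using int1[of "\<lambda>x. x\<^sup>2" k] by (simp add: L2_norm_def \<eta>_def R)
  have "L2_inner N (\<eta> j) (\<eta> k) = 0" if "j \<noteq> k" for j k
    using int2[OF that] by (simp add: L2_inner_def \<eta>_def flip: of_real_mult)
  then have "orthosystem N \<eta>" using L2 norm by (simp add: orthosystem_def)
  moreover have "(LINT \<omega>|N. \<eta> k \<omega>) = 0" for k
    using int1[of "\<lambda>x. x" k] by (simp add: \<eta>_def R)
  moreover have "prob_space N" unfolding N_def by (rule R.prob_space_axioms)
  moreover have "\<eta> k \<omega> \<in> \<real>" for k \<omega> by (simp add: \<eta>_def)
  ultimately show ?thesis using norm by blast
qed

lemma (in prob_space) distr_pair_snd: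
  assumes "prob_space N"
  shows "distr (M \<Otimes>\<^sub>M N) N snd = N"
proof (intro measure_eqI)
  interpret N: prob_space N by fact
  fix A assume A: "A \<in> sets (distr (M \<Otimes>\<^sub>M N) N snd)"
  then have "emeasure (distr (M \<Otimes>\<^sub>M N) N snd) A = emeasure (M \<Otimes>\<^sub>M N) (space M \<times> A)"
    by (auto simp add: emeasure_distr space_pair_measure dest: sets.sets_into_space
        intro!: arg_cong2[where f=emeasure])
  with A show "emeasure (distr (M \<Otimes>\<^sub>M N) N snd) A = emeasure N A"
    by (simp add: N.emeasure_pair_measure_Times emeasure_space_1)
qed simp

text \<open>Zero vectors of the system are replaced by independent signs on the additional factor.\<close>

lemma complete_to_orthonormal:
  fixes X :: "nat \<Rightarrow> 'w \<Rightarrow> complex"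
  assumes "prob_space M" and X: "orthosystem M X" "\<And>k z. X k z \<in> \<real>" "\<And>k. (LINT z|M. X k z) = 0"
  shows "\<exists>(N :: (nat \<Rightarrow> real) measure) (\<xi> :: nat \<Rightarrow> 'w \<times> (nat \<Rightarrow> real) \<Rightarrow> complex).
    prob_space N \<and> orthosystem (M \<Otimes>\<^sub>M N) \<xi> \<and> (\<forall>k. L2_norm (M \<Otimes>\<^sub>M N) (\<xi> k) = 1) \<and>
    (\<forall>k \<omega>. \<xi> k \<omega> \<in> \<real>) \<and> (\<forall>k. (LINT \<omega>|(M \<Otimes>\<^sub>M N). \<xi> k \<omega>) = 0) \<and>
    (\<forall>k. L2_norm M (X k) = 1 \<longrightarrow> \<xi> k = (\<lambda>\<omega>. X k (fst \<omega>)))"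
proof -
  interpret M: prob_space M by fact
  obtain N :: "(nat \<Rightarrow> real) measure" and \<eta> :: "nat \<Rightarrow> (nat \<Rightarrow> real) \<Rightarrow> complex" where N: "prob_space N" and \<eta>: "orthosystem N \<eta>" "\<And>k. L2_norm N (\<eta> k) = 1"
    "\<And>k \<omega>. \<eta> k \<omega> \<in> \<real>" "\<And>k. (LINT \<omega>|N. \<eta> k \<omega>) = 0" using coordinate_noise by blast
  interpret N: prob_space N by fact
  interpret P: pair_prob_space M N ..
  let ?P = "M \<Otimes>\<^sub>M N"
  note fst = measurable_fst[of M N] N.distr_pair_fst[of M]
  note snd = measurable_snd[of M N] M.distr_pair_snd[OF N]
  define \<xi> where "\<xi> k = (if L2_norm M (X k) = 1 then (\<lambda>\<omega>. X k (fst \<omega>)) else (\<lambda>\<omega>. \<eta> k (snd \<omega>)))" for k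
  have XL: "X k \<in> L2 M" and \<eta>L: "\<eta> k \<in> L2 N" for k using X(1) \<eta>(1) by (auto intro: orthosystem_L2)
  have L2: "\<xi> k \<in> L2 ?P" for k
    using L2_compose[OF fst XL] L2_compose[OF snd \<eta>L] by (simp add: \<xi>_def)
  have norm: "L2_norm ?P (\<xi> k) = 1" for k
    using L2_norm_compose[OF fst XL] L2_norm_compose[OF snd \<eta>L] \<eta>(2) by (simp add: \<xi>_def)
  have real: "\<xi> k \<omega> \<in> \<real>" for k \<omega> using X(2) \<eta>(3) by (simp add: \<xi>_def)
  have mean: "(LINT \<omega>|?P. \<xi> k \<omega>) = 0" for k
  proof -
    have "(LINT \<omega>|?P. X k (fst \<omega>)) = (LINT z|M. X k z)"
      using integral_distr[OF fst(1), of "X k"] XL[of k] by (simp add: fst(2) L2_def)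
    moreover have "(LINT \<omega>|?P. \<eta> k (snd \<omega>)) = (LINT z|N. \<eta> k z)"
      using integral_distr[OF snd(1), of "\<eta> k"] \<eta>L[of k] by (simp add: snd(2) L2_def)
    ultimately show ?thesis using X(3) \<eta>(4) by (simp add: \<xi>_def)
  qed
  have cross: "L2_inner ?P (\<lambda>\<omega>. X j (fst \<omega>)) (\<lambda>\<omega>. \<eta> k (snd \<omega>)) = 0" for j k
  proof -
    have "integrable ?P (\<lambda>\<omega>. X j (fst \<omega>) * cnj (\<eta> k (snd \<omega>)))"
      by (intro L2_integrable_mult L2_cnj L2_compose[OF fst XL] L2_compose[OF snd \<eta>L])
    from P.integral_fst'[OF this] show ?thesis
      by (simp add: L2_inner_def \<eta>(4))
  qed
  have "L2_inner ?P (\<xi> j) (\<xi> k) = 0" if "j \<noteq> k" for j k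
    using that cross[of j k] cross[of k j] X(1) \<eta>(1)
      L2_inner_commute[of ?P "\<lambda>\<omega>. X k (fst \<omega>)" "\<lambda>\<omega>. \<eta> j (snd \<omega>)"]
      L2_inner_compose[OF fst XL XL, of j k] L2_inner_compose[OF snd \<eta>L \<eta>L, of j k]
    by (simp add: \<xi>_def orthosystem_def)
  then have "orthosystem ?P \<xi>" using L2 norm by (simp add: orthosystem_def)
  moreover have "\<forall>k. L2_norm M (X k) = 1 \<longrightarrow> \<xi> k = (\<lambda>\<omega>. X k (fst \<omega>))" by (simp add: \<xi>_def)
  ultimately show ?thesis using N norm real mean by blast
qed


section \<open>Adjoints and extensions\<close>

text \<open>The Cauchy--Schwarz inequality for the bilinear pairing.\<close>

lemma pairing_bound:
  assumes "f \<in> L2 lborel" "h \<in> L2 lborel"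
  shows "cmod (pairing f h) \<le> L2_norm lborel f * L2_norm lborel h"
proof -
  have "pairing f h = L2_inner lborel f (\<lambda>x. cnj (h x))" by (simp add: pairing_def L2_inner_def)
  moreover have "L2_norm lborel (\<lambda>x. cnj (h x)) = L2_norm lborel h" by (simp add: L2_norm_def)
  ultimately show ?thesis using L2_cauchy_schwarz[OF assms(1) L2_cnj[OF assms(2)]] by simp
qed

lemma pairing_lincomb_left:
  assumes "f \<in> L2 lborel" "g \<in> L2 lborel" "h \<in> L2 lborel"
  shows "pairing (\<lambda>x. a * f x + b * g x) h = a * pairing f h + b * pairing g h"
proof -
  have "(LINT x|lborel. (a * f x + b * g x) * h x) = (LINT x|lborel. a * (f x * h x) + b * (g x * h x))"
    by (simp add: algebra_simps)
  then show ?thesis using assms by (simp add: pairing_def L2_integrable_mult)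
qed

lemma pairing_lincomb_right:
  assumes "f \<in> L2 lborel" "g \<in> L2 lborel" "h \<in> L2 lborel"
  shows "pairing h (\<lambda>x. a * f x + b * g x) = a * pairing h f + b * pairing h g"
  using pairing_lincomb_left[OF assms] by (simp add: pairing_def mult.commute)

lemma pairing_cong_AE:
  assumes "f \<in> L2 lborel" "g \<in> L2 lborel" "h \<in> L2 lborel" "AE x in lborel. f x = g x"
  shows "pairing h f = pairing h g"
proof -
  have [measurable]: "f \<in> borel_measurable lborel" "g \<in> borel_measurable lborel" "h \<in> borel_measurable lborel"
    using assms by (auto simp: L2_def)
  show ?thesis unfolding pairing_def using assms(4) by (intro integral_cong_AE) auto
qed

text \<open>The adjoint of a continuous operator from Schwartz space to \<open>L\<^sup>2\<close> is weak-continuous.\<close>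

lemma linear_weak_continuous_adjoint:
  fixes R :: "(real^'d::finite \<Rightarrow> complex) \<Rightarrow> real^'d \<Rightarrow> complex"
  assumes R: "linear_continuous_L2 schwartz_topology lborel R"
  shows "linear_weak_continuous (\<lambda>f \<phi>. pairing f (R \<phi>))"
  unfolding linear_weak_continuous_def
proof safe
  have RL: "\<phi> \<in> schwartz \<Longrightarrow> R \<phi> \<in> L2 lborel" for \<phi>
    using R by (rule linear_continuous_schwartz_L2)
  show "pairing (\<lambda>x. a * f x + b * g x) (R \<phi>) = a * pairing f (R \<phi>) + b * pairing g (R \<phi>)"
    if "f \<in> L2 lborel" "g \<in> L2 lborel" "\<phi> \<in> schwartz" for f g a b \<phi>
    using that RL by (intro pairing_lincomb_left)
  have temp: "(\<lambda>\<phi>. pairing f (R \<phi>)) \<in> tempered_distributions" if f: "f \<in> L2 lborel" for f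
    unfolding tempered_distributions_def
  proof (intro CollectI conjI ballI allI)
    fix \<phi> \<psi> :: "real^'d \<Rightarrow> complex" and a b assume ph: "\<phi> \<in> schwartz" "\<psi> \<in> schwartz"
    have "pairing f (R (\<lambda>x. a * \<phi> x + b * \<psi> x)) = pairing f (\<lambda>x. a * R \<phi> x + b * R \<psi> x)"
      using ph by (intro pairing_cong_AE RL schwartz_lincomb L2_add L2_scale f linear_continuous_L2_AE[OF R])
        (auto simp: topspace_schwartz_topology)
    then show "pairing f (R (\<lambda>x. a * \<phi> x + b * \<psi> x)) = a * pairing f (R \<phi>) + b * pairing f (R \<psi>)"
      using pairing_lincomb_right[OF RL[OF ph(1)] RL[OF ph(2)] f] by simp
  next
    show "continuous_map schwartz_topology euclidean (\<lambda>\<phi>. pairing f (R \<phi>))"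
    proof (rule continuous_map_complex)
      fix \<phi> :: "real^'d \<Rightarrow> complex" and e :: real assume "\<phi> \<in> topspace schwartz_topology" "0 < e"
      then have ph: "\<phi> \<in> schwartz" by (simp add: topspace_schwartz_topology)
      let ?d = "e / (L2_norm lborel f + 1)"
      have pos: "L2_norm lborel f + 1 > 0" by (simp add: add_nonneg_pos)
      then have d: "?d > 0" using \<open>0 < e\<close> by simp
      obtain U where U: "openin schwartz_topology U" "\<phi> \<in> U"
          "\<forall>\<psi>\<in>U. L2_norm lborel (\<lambda>z. R \<psi> z - R \<phi> z) < ?d"
        using R ph d unfolding linear_continuous_L2_def continuous_map_L2_topology topspace_schwartz_topology
        by meson
      have "cmod (pairing f (R \<psi>) - pairing f (R \<phi>)) < e" if "\<psi> \<in> U" for \<psi>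
      proof -
        have ps: "\<psi> \<in> schwartz" using that openin_subset[OF U(1)] by (auto simp: topspace_schwartz_topology)
        have "pairing f (R \<psi>) - pairing f (R \<phi>) = pairing f (\<lambda>x. R \<psi> x - R \<phi> x)"
          using pairing_lincomb_right[OF RL[OF ps] RL[OF ph] f, of 1 "-1"] by simp
        also have "cmod \<dots> \<le> L2_norm lborel f * L2_norm lborel (\<lambda>x. R \<psi> x - R \<phi> x)"
          by (intro pairing_bound f L2_diff RL ps ph)
        also have "\<dots> \<le> L2_norm lborel f * ?d"
          using U(3) that by (intro mult_left_mono) auto
        also have "\<dots> < (L2_norm lborel f + 1) * ?d" by (rule mult_strict_right_mono[OF _ d]) simp
        also have "\<dots> = e" using pos by simp
        finally show ?thesis .
      qed
      then show "\<exists>U. openin schwartz_topology U \<and> \<phi> \<in> U \<and>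
          (\<forall>\<psi>\<in>U. cmod (pairing f (R \<psi>) - pairing f (R \<phi>)) < e)" using U by blast
    qed
  qed
  show "continuous_map L2_weak_topology tempered_weak_topology (\<lambda>f \<phi>. pairing f (R \<phi>))"
    unfolding tempered_weak_topology_def
  proof (subst continuous_map_seminorm_topology, safe)
    show "(\<lambda>\<phi>. pairing f (R \<phi>)) \<in> tempered_distributions" if "f \<in> topspace L2_weak_topology" for f
      using temp that by (simp add: topspace_L2_weak_topology)
  next
    fix f \<phi> :: "real^'d \<Rightarrow> complex" and e :: real
    assume f: "f \<in> topspace L2_weak_topology" and ph: "\<phi> \<in> schwartz" and "0 < e"
    let ?p = "\<lambda>f. cmod (pairing f (R \<phi>))"
    let ?U = "{g \<in> L2 lborel. ?p (\<lambda>x. g x - f x) < e}"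
    have fL: "f \<in> L2 lborel" using f by (simp add: topspace_L2_weak_topology)
    have "openin L2_weak_topology ?U"
      unfolding L2_weak_topology_def using RL[OF ph] fL \<open>0 < e\<close> by (intro openin_seminorm_ball) auto
    moreover have "f \<in> ?U" using fL \<open>0 < e\<close> by (simp add: pairing_def)
    moreover have "pairing g (R \<phi>) - pairing f (R \<phi>) = pairing (\<lambda>x. g x - f x) (R \<phi>)" if "g \<in> ?U" for g
      using pairing_lincomb_left[OF _ fL RL[OF ph], of g 1 "-1"] that by simp
    ultimately show "\<exists>U. openin L2_weak_topology U \<and> f \<in> U \<and>
        (\<forall>g\<in>U. cmod (pairing g (R \<phi>) - pairing f (R \<phi>)) < e)"
      by (intro exI[of _ ?U]) simp
  next
    fix f g h :: "(real^'d \<Rightarrow> complex) \<Rightarrow> complex" and \<phi> :: "real^'d \<Rightarrow> complex"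
    show "cmod (g \<phi> - h \<phi>) \<le> cmod (g \<phi> - f \<phi>) + cmod (f \<phi> - h \<phi>)"
      using norm_triangle_ineq[of "g \<phi> - f \<phi>" "f \<phi> - h \<phi>"] by simp
  qed (use schwartz_nonempty in auto)
qed

text \<open>The operator recovered from its adjoint is determined almost everywhere.\<close>

lemma predual_operator_adjoint:
  fixes R :: "(real^'d::finite \<Rightarrow> complex) \<Rightarrow> real^'d \<Rightarrow> complex"
  assumes R: "linear_continuous_L2 schwartz_topology lborel R" and ph: "\<phi> \<in> schwartz"
  defines "R' \<equiv> predual_operator (\<lambda>f \<phi>. pairing f (R \<phi>))"
  shows "R' \<phi> \<in> L2 lborel" "AE x in lborel. R' \<phi> x = R \<phi> x"
proof -
  have L2: "S \<phi> \<in> L2 lborel" if "linear_continuous_L2 schwartz_topology lborel S"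
    for S :: "(real^'d \<Rightarrow> complex) \<Rightarrow> real^'d \<Rightarrow> complex"
    using that ph by (rule linear_continuous_schwartz_L2)
  have "linear_continuous_L2 schwartz_topology lborel R' \<and>
      (\<forall>f\<in>L2 lborel. \<forall>\<phi>\<in>schwartz. pairing f (R \<phi>) = pairing f (R' \<phi>))"
    unfolding R'_def predual_operator_def by (rule someI[of _ R]) (simp add: R)
  then have R': "linear_continuous_L2 schwartz_topology lborel R'"
    and eq: "\<And>f. f \<in> L2 lborel \<Longrightarrow> pairing f (R \<phi>) = pairing f (R' \<phi>)" using ph by auto
  show R'L: "R' \<phi> \<in> L2 lborel" by (rule L2[OF R'])
  let ?d = "\<lambda>x. R' \<phi> x - R \<phi> x"
  have dL: "?d \<in> L2 lborel" by (intro L2_diff R'L L2[OF R])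
  have "complex_of_real ((L2_norm lborel ?d)\<^sup>2) = L2_inner lborel ?d ?d" by (rule L2_inner_self[symmetric])
  also have "\<dots> = pairing (\<lambda>x. cnj (?d x)) ?d" by (simp add: L2_inner_def pairing_def mult.commute)
  also have "\<dots> = 0"
    using pairing_lincomb_right[OF R'L L2[OF R] L2_cnj[OF dL], of 1 "-1"] eq[OF L2_cnj[OF dL]] by simp
  finally have "L2_norm lborel ?d = 0" by simp
  then have "AE x in lborel. ?d x = 0" using dL by (simp add: L2_norm_eq_0_iff)
  then show "AE x in lborel. R' \<phi> x = R \<phi> x" by simp
qed

text \<open>Two continuous operators on \<open>L\<^sup>2\<close> that agree on Schwartz functions agree everywhere.\<close>

lemma L2_extension_unique:
  fixes f :: "real^'d::finite \<Rightarrow> complex"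
  assumes V: "continuous_map (L2_topology lborel) (L2_topology P) V"
    and V': "continuous_map (L2_topology lborel) (L2_topology P) V'"
    and eq: "\<And>\<phi>. \<phi> \<in> schwartz \<Longrightarrow> AE \<omega> in P. V' \<phi> \<omega> = V \<phi> \<omega>"
    and f: "f \<in> L2 lborel"
  shows "AE \<omega> in P. V' f \<omega> = V f \<omega>"
proof -
  have L2: "S g \<in> L2 P" if "continuous_map (L2_topology lborel) (L2_topology P) S" "g \<in> L2 lborel"
    for S and g :: "real^'d \<Rightarrow> complex"
    using that by (simp add: continuous_map_L2_topology topspace_L2_topology)
  \<comment> \<open>Continuity at \<open>f\<close> in terms of norms.\<close>
  have nbhd: "\<exists>d>0. \<forall>g\<in>L2 lborel. L2_norm lborel (\<lambda>x. g x - f x) < d \<longrightarrow> L2_norm P (\<lambda>z. S g z - S f z) < e"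
    if S: "continuous_map (L2_topology lborel) (L2_topology P) S" and "0 < e" for S and e :: real
  proof -
    obtain U where U: "openin (L2_topology lborel) U" "f \<in> U" "\<forall>g\<in>U. L2_norm P (\<lambda>z. S g z - S f z) < e"
      using S f \<open>0 < e\<close> unfolding continuous_map_L2_topology topspace_L2_topology by meson
    have "\<exists>F d. finite F \<and> F \<subseteq> {L2_norm lborel} \<and> 0 < d \<and>
        (\<forall>g\<in>L2 lborel. (\<forall>p\<in>F. p (\<lambda>x. g x - f x) < d) \<longrightarrow> g \<in> U)"
      by (rule openin_seminorm_topology_nbhd)
        (use U in \<open>auto simp: L2_topology_def intro: L2_norm_triangle_diff\<close>)
    then obtain F d where "F \<subseteq> {L2_norm lborel}" "0 < d"
        "\<forall>g\<in>L2 lborel. (\<forall>p\<in>F. p (\<lambda>x. g x - f x) < d) \<longrightarrow> g \<in> U"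
      by (elim exE conjE)
    then show ?thesis using U(3) by (intro exI[of _ d]) auto
  qed
  have "L2_norm P (\<lambda>z. V' f z - V f z) \<le> e" if "0 < e" for e
  proof -
    from that have "0 < e / 2" by simp
    obtain d where d: "d > 0"
      "\<And>g. g \<in> L2 lborel \<Longrightarrow> L2_norm lborel (\<lambda>x. g x - f x) < d \<Longrightarrow> L2_norm P (\<lambda>z. V g z - V f z) < e / 2"
      using nbhd[OF V \<open>0 < e / 2\<close>] by blast
    obtain d' where d': "d' > 0"
      "\<And>g. g \<in> L2 lborel \<Longrightarrow> L2_norm lborel (\<lambda>x. g x - f x) < d' \<Longrightarrow> L2_norm P (\<lambda>z. V' g z - V' f z) < e / 2"
      using nbhd[OF V' \<open>0 < e / 2\<close>] by blast
    have "0 < min d d'" using d(1) d'(1) by simp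
    obtain g where g: "g \<in> schwartz" "L2_norm lborel (\<lambda>x. f x - g x) < min d d'"
      using schwartz_dense[OF f] \<open>0 < min d d'\<close> unfolding L2_closure_def by blast
    have gL: "g \<in> L2 lborel" by (rule schwartz_L2[OF g(1)])
    have gd: "L2_norm lborel (\<lambda>x. g x - f x) < d" "L2_norm lborel (\<lambda>x. g x - f x) < d'"
      using g(2) L2_norm_minus[of lborel f g] by auto
    note L = L2[OF V f] L2[OF V' f] L2[OF V gL] L2[OF V' gL]
    have "L2_norm P (\<lambda>z. V' f z - V f z) \<le> L2_norm P (\<lambda>z. V' f z - V' g z) + L2_norm P (\<lambda>z. V' g z - V f z)"
      by (rule L2_norm_triangle_diff[OF L(4,2,1)])
    also have "L2_norm P (\<lambda>z. V' g z - V f z) = L2_norm P (\<lambda>z. V g z - V f z)"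
      using eq[OF g(1)] L by (intro L2_norm_cong_AE L2_diff) auto
    also have "L2_norm P (\<lambda>z. V' f z - V' g z) = L2_norm P (\<lambda>z. V' g z - V' f z)" by (rule L2_norm_minus)
    finally show ?thesis using d(2)[OF gL gd(1)] d'(2)[OF gL gd(2)] by linarith
  qed
  then have "L2_norm P (\<lambda>z. V' f z - V f z) \<le> 0" by (rule field_le_epsilon[of _ 0, simplified])
  then have "L2_norm P (\<lambda>z. V' f z - V f z) = 0" by (simp add: antisym)
  then have "AE z in P. V' f z - V f z = 0" using L2[OF V f] L2[OF V' f] by (simp add: L2_norm_eq_0_iff L2_diff)
  then show ?thesis by simp
qed


section \<open>Representation of generalized stochastic processes\<close>

(* The probability space M is replaced by its product with an auxiliary space N, on which
   Z is read as the process depending on the first coordinate only. *)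

theorem theorem4p1:
  fixes M :: "'w measure"
    and Z :: "(real^'d::finite \<Rightarrow> complex) \<Rightarrow> 'w \<Rightarrow> complex"
  assumes "prob_space M"
    and "real_gesp M Z"
  shows "\<exists>(N :: (nat \<Rightarrow> real) measure)
            (L :: (real^'d \<Rightarrow> complex) \<Rightarrow> (real^'d \<Rightarrow> complex) \<Rightarrow> complex)
            (W :: (real^'d \<Rightarrow> complex) \<Rightarrow> 'w \<times> (nat \<Rightarrow> real) \<Rightarrow> complex).
          prob_space N \<and>
          linear_weak_continuous L \<and>
          real_white_noise (M \<Otimes>\<^sub>M N) W \<and>
          modification (M \<Otimes>\<^sub>M N) (\<lambda>\<phi> \<omega>. Z \<phi> (fst \<omega>)) (operator_noise (M \<Otimes>\<^sub>M N) L W)"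
proof -
  interpret M: prob_space M by fact
  have Z: "linear_continuous_L2 schwartz_topology M Z"
    and Z_mean: "\<And>\<phi>. \<phi> \<in> schwartz \<Longrightarrow> (LINT \<omega>|M. Z \<phi> \<omega>) = 0"
    and Z_real: "\<And>\<phi>. \<phi> \<in> schwartz \<Longrightarrow> (\<And>x. \<phi> x \<in> \<real>) \<Longrightarrow> AE \<omega> in M. Z \<phi> \<omega> \<in> \<real>"
    using assms(2) by (auto simp: real_gesp_def gesp_def)
  have ZL: "\<phi> \<in> schwartz \<Longrightarrow> Z \<phi> \<in> L2 M" for \<phi>
    using Z by (rule linear_continuous_schwartz_L2)
  have one: "(\<lambda>_. 1) \<in> L2 M" by (simp add: L2_def)
  \<comment> \<open>\<open>X\<close> spans the image of \<open>Z\<close>; it consists of real, centred, orthonormal or zero variables.\<close>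
  have "\<exists>X. orthosystem M X \<and> (\<forall>k z. X k z \<in> \<real>) \<and> (\<forall>k. (LINT z|M. X k z) = 0) \<and>
      (\<forall>k z. L2_norm M (X k) = 0 \<longrightarrow> X k z = 0) \<and> (\<forall>\<phi>\<in>schwartz. Z \<phi> \<in> L2_closure M (fun_span X))"
  proof (rule real_schwartz_separable_image[OF Z Z_real])
    fix y :: "nat \<Rightarrow> 'w \<Rightarrow> complex"
    assume y: "\<And>n. y n \<in> L2 M" "\<And>n z. y n z \<in> \<real>" "\<And>n. \<exists>f\<in>schwartz. AE z in M. y n z = Z f z"
      "\<And>f. f \<in> schwartz \<Longrightarrow> Z f \<in> L2_closure M (fun_span y)"
    let ?X = "gram_schmidt M y"
    have "L2_inner M (y n) (\<lambda>_. 1) = 0" for n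
    proof -
      obtain f where f: "f \<in> schwartz" "AE z in M. y n z = Z f z" using y(3) by blast
      have "L2_inner M (y n) (\<lambda>_. 1) = L2_inner M (Z f) (\<lambda>_. 1)"
        using f y(1) by (intro L2_inner_cong_AE ZL one) auto
      then show ?thesis using Z_mean[OF f(1)] by (simp add: L2_inner_def)
    qed
    then have "L2_inner M (?X k) (\<lambda>_. 1) = 0" for k
      by (rule gram_schmidt_orthogonal[of y M, OF y(1) one])
    then have mean: "(LINT z|M. ?X k z) = 0" for k by (simp add: L2_inner_def)
    have X: "orthosystem M ?X" by (rule orthosystem_gram_schmidt[of y M, OF y(1)])
    show ?thesis
    proof (intro exI[of _ ?X] conjI allI ballI impI X mean)
      show "?X k z \<in> \<real>" for k z by (rule gram_schmidt_real[of y M, OF y(1,2)])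
      show "?X k z = 0" if "L2_norm M (?X k) = 0" for k z by (rule gram_schmidt_zero[of y M, OF y(1) that])
      show "Z \<phi> \<in> L2_closure M (fun_span ?X)" if "\<phi> \<in> schwartz" for \<phi>
        by (rule L2_closure_fun_span_mono[OF gram_schmidt_span[of y M, OF y(1)] orthosystem_L2[OF X] y(4)[OF that]])
    qed
  qed
  then obtain X where X: "orthosystem M X" "\<forall>k z. X k z \<in> \<real>" "\<forall>k. (LINT z|M. X k z) = 0"
    "\<forall>k z. L2_norm M (X k) = 0 \<longrightarrow> X k z = 0" "\<forall>\<phi>\<in>schwartz. Z \<phi> \<in> L2_closure M (fun_span X)"
    by (elim exE conjE)
  note X = X(1) X(2-4)[rule_format] bspec[OF X(5)]
  \<comment> \<open>\<open>\<xi>\<close> agrees with \<open>X\<close> wherever \<open>X\<close> is nonzero, and is orthonormal throughout.\<close>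
  obtain N and \<xi> :: "nat \<Rightarrow> 'w \<times> (nat \<Rightarrow> real) \<Rightarrow> complex" where
    N: "prob_space N" and \<xi>: "orthosystem (M \<Otimes>\<^sub>M N) \<xi>" "\<forall>k. L2_norm (M \<Otimes>\<^sub>M N) (\<xi> k) = 1"
      "\<forall>k \<omega>. \<xi> k \<omega> \<in> \<real>" "\<forall>k. (LINT \<omega>|(M \<Otimes>\<^sub>M N). \<xi> k \<omega>) = 0"
      "\<forall>k. L2_norm M (X k) = 1 \<longrightarrow> \<xi> k = (\<lambda>\<omega>. X k (fst \<omega>))"
    using complete_to_orthonormal[OF assms(1) X(1,2,3)] by (elim exE conjE)
  note \<xi> = \<xi>(1) \<xi>(2-5)[rule_format]
  interpret N: prob_space N by fact
  interpret P: pair_prob_space M N ..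
  define P where "P = M \<Otimes>\<^sub>M N"
  note \<xi> = \<xi>[folded P_def]
  have \<xi>L: "\<xi> k \<in> L2 P" for k by (rule orthosystem_L2[OF \<xi>(1)])
  obtain e :: "nat \<Rightarrow> real^'d \<Rightarrow> complex" where e: "orthosystem lborel e" "\<And>k. L2_norm lborel (e k) = 1"
    "\<And>k x. e k x \<in> \<real>" "\<And>f. f \<in> L2 lborel \<Longrightarrow> f \<in> L2_closure lborel (fun_span e)"
    by (rule lborel_orthonormal_basis) blast
  have eL: "e k \<in> L2 lborel" for k by (rule orthosystem_L2[OF e(1)])

  \<comment> \<open>\<open>R\<close> transports the expansion of \<open>Z \<phi>\<close> along \<open>X\<close> to the basis \<open>e\<close>, and \<open>V\<close> transports
     expansions along \<open>e\<close> to \<open>\<xi>\<close>.\<close>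
  define c where "c \<phi> k = L2_inner M (Z \<phi>) (X k)" for \<phi> k
  define R where "R \<phi> = (SOME f. L2_sums lborel e (c \<phi>) f)" for \<phi>
  define V where "V f = (SOME Y. L2_sums P \<xi> (\<lambda>k. L2_inner lborel f (e k)) Y)" for f
  have R: "L2_sums lborel e (c \<phi>) (R \<phi>)" if "\<phi> \<in> schwartz" for \<phi>
    unfolding R_def c_def
    by (rule someI_ex[OF L2_sums_exists[OF e(1) bessel_summable[OF X(1) ZL[OF that]]]])
  have RL: "R \<phi> \<in> L2 lborel" if "\<phi> \<in> schwartz" for \<phi> by (rule L2_sums_L2[OF R[OF that]])
  have V: "L2_sums P \<xi> (\<lambda>k. L2_inner lborel f (e k)) (V f)" if "f \<in> L2 lborel" for f
    unfolding V_def 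
    by (rule someI_ex[OF L2_sums_exists[OF \<xi>(1) bessel_summable[OF e(1) that]]])
  have VL: "V f \<in> L2 P" if "f \<in> L2 lborel" for f by (rule L2_sums_L2[OF V[OF that]])
  have expand: "L2_sums lborel e (\<lambda>k. L2_inner lborel f (e k)) f" if "f \<in> L2 lborel" for f
    by (rule L2_sums_expansion[OF e(1) e(4)[OF that]])

  \<comment> \<open>Parseval's identity in both spaces makes \<open>V\<close> an isometry.\<close>
  have V_norm: "L2_norm P (\<lambda>\<omega>. V g \<omega> - V f \<omega>) = L2_norm lborel (\<lambda>x. g x - f x)"
    if f: "f \<in> L2 lborel" and g: "g \<in> L2 lborel" for f g
  proof -
    have "(L2_norm P (\<lambda>\<omega>. 1 * V g \<omega> + (-1) * V f \<omega>))\<^sup>2 = (L2_norm lborel (\<lambda>x. 1 * g x + (-1) * f x))\<^sup>2"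
      by (rule sums_unique2[OF L2_sums_norm[OF \<xi>(1,2) L2_sums_lincomb[OF \<xi>L V[OF g] V[OF f]]]
          L2_sums_norm[OF e(1,2) L2_sums_lincomb[OF eL expand[OF g] expand[OF f]]]])
    then show ?thesis by (simp add: power2_eq_iff_nonneg)
  qed
  have V_lin: "AE \<omega> in P. V (\<lambda>x. a * f x + b * g x) \<omega> = a * V f \<omega> + b * V g \<omega>"
    if f: "f \<in> L2 lborel" and g: "g \<in> L2 lborel" for f g a b
  proof (rule L2_sums_unique[OF \<xi>L _ L2_sums_lincomb[OF \<xi>L V[OF f] V[OF g]]])
    show "L2_sums P \<xi> (\<lambda>k. a * L2_inner lborel f (e k) + b * L2_inner lborel g (e k)) (V (\<lambda>x. a * f x + b * g x))"
      using V[OF L2_add[OF L2_scale[OF f, of a] L2_scale[OF g, of b]]] f g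
      by (simp add: L2_inner_add_left L2_scale eL L2_inner_scale_left)
  qed
  have V_cont: "continuous_map X (L2_topology P) (\<lambda>f. V (T f))"
    if "continuous_map X (L2_topology lborel) T" for X and T :: "(real^'d \<Rightarrow> complex) \<Rightarrow> real^'d \<Rightarrow> complex"
  proof (rule continuous_map_L2_dominated[OF that])
    have TL: "T f \<in> L2 lborel" if "f \<in> topspace X" for f
      using \<open>continuous_map X (L2_topology lborel) T\<close> that by (simp add: continuous_map_L2_topology)
    show "V (T f) \<in> L2 P" if "f \<in> topspace X" for f by (intro VL TL that)
    show "L2_norm P (\<lambda>z. V (T g) z - V (T f) z) \<le> L2_norm lborel (\<lambda>z. T g z - T f z)"
      if "f \<in> topspace X" "g \<in> topspace X" for f g
      using V_norm[OF TL TL] that by simp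
  qed
  have V_map: "linear_continuous_L2 (L2_topology lborel) P V"
    using V_lin V_cont[OF continuous_map_id[unfolded id_def]]
    by (simp add: linear_continuous_L2_def topspace_L2_topology)

  have R_map: "linear_continuous_L2 schwartz_topology lborel R"
    unfolding linear_continuous_L2_def topspace_schwartz_topology
  proof (intro conjI ballI allI)
    fix f g :: "real^'d \<Rightarrow> complex" and a b assume f: "f \<in> schwartz" and g: "g \<in> schwartz"
    have "c (\<lambda>x. a * f x + b * g x) k = a * c f k + b * c g k" for k
    proof -
      have XL: "X k \<in> L2 M" by (rule orthosystem_L2[OF X(1)])
      have "c (\<lambda>x. a * f x + b * g x) k = L2_inner M (\<lambda>z. a * Z f z + b * Z g z) (X k)"
        unfolding c_def using f g
        by (intro L2_inner_cong_AE XL ZL schwartz_lincomb L2_add L2_scale linear_continuous_L2_AE[OF Z])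
           (auto simp: topspace_schwartz_topology)
      also have "\<dots> = a * c f k + b * c g k"
        using ZL f g XL by (simp add: c_def L2_inner_add_left L2_scale L2_inner_scale_left)
      finally show ?thesis .
    qed
    then have "c (\<lambda>x. a * f x + b * g x) = (\<lambda>k. a * c f k + b * c g k)" by (rule ext)
    then have "L2_sums lborel e (\<lambda>k. a * c f k + b * c g k) (R (\<lambda>x. a * f x + b * g x))"
      using R[OF schwartz_lincomb[OF f g, of a b]] by simp
    from L2_sums_unique[OF eL this L2_sums_lincomb[OF eL R[OF f] R[OF g]]]
    show "AE x in lborel. R (\<lambda>x. a * f x + b * g x) x = a * R f x + b * R g x" .
  next
    have Zc: "continuous_map schwartz_topology (L2_topology M) Z" using Z by (simp add: linear_continuous_L2_def)
    show "continuous_map schwartz_topology (L2_topology lborel) R"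
    proof (rule continuous_map_L2_dominated[OF Zc], unfold topspace_schwartz_topology)
      fix f g :: "real^'d \<Rightarrow> complex" assume f: "f \<in> schwartz" and g: "g \<in> schwartz"
      let ?h = "\<lambda>z. 1 * Z g z + (-1) * Z f z"
      have h: "?h \<in> L2 M" by (intro L2_add L2_scale ZL f g)
      have "L2_inner M ?h (X k) = 1 * c g k + (-1) * c f k" for k
        using ZL[OF f] ZL[OF g] orthosystem_L2[OF X(1)]
        by (simp add: c_def L2_inner_diff_left del: mult_minus1)
      then have "(\<lambda>k. (cmod (L2_inner M ?h (X k)))\<^sup>2) sums (L2_norm lborel (\<lambda>x. 1 * R g x + (-1) * R f x))\<^sup>2"
        using L2_sums_norm[OF e(1,2) L2_sums_lincomb[OF eL R[OF g] R[OF f], of 1 "-1"]] by simp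
      \<comment> \<open>Bessel's inequality bounds the increments of \<open>R\<close> by those of \<open>Z\<close>.\<close>
      then have "(L2_norm lborel (\<lambda>x. 1 * R g x + (-1) * R f x))\<^sup>2 \<le> (L2_norm M ?h)\<^sup>2"
        by (rule LIMSEQ_le_const2[OF sums_def[THEN iffD1]]) 
           (intro exI[of _ 0] allI impI bessel(1)[OF X(1) h] finite_lessThan)
      then show "L2_norm lborel (\<lambda>z. R g z - R f z) \<le> L2_norm M (\<lambda>z. Z g z - Z f z)"
        using power2_le_imp_le[OF _ L2_norm_nonneg] by simp
    qed (rule RL)
  qed

  have noise: "real_white_noise P V"
    unfolding real_white_noise_def real_gesp_def gesp_def
  proof (intro conjI ballI impI)
    show "linear_continuous_L2 schwartz_topology P V"
      using V_lin V_cont[OF linear_continuous_schwartz_inclusion[unfolded linear_continuous_L2_def, THEN conjunct2]]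
      by (simp add: linear_continuous_L2_def topspace_schwartz_topology schwartz_L2)
  next
    fix \<phi> :: "real^'d \<Rightarrow> complex" assume ph: "\<phi> \<in> schwartz"
    have one: "(\<lambda>_. 1) \<in> L2 P" by (simp add: L2_def P_def)
    have "L2_inner P (V \<phi>) (\<lambda>_. 1) = 0"
      by (rule L2_sums_orthogonal[OF \<xi>L one _ V[OF schwartz_L2[OF ph]]]) (simp add: L2_inner_def \<xi>)
    then show "(LINT \<omega>|P. V \<phi> \<omega>) = 0" by (simp add: L2_inner_def)
  next
    fix \<phi> :: "real^'d \<Rightarrow> complex" assume ph: "\<phi> \<in> schwartz" and real: "\<forall>x. \<phi> x \<in> \<real>"
    have "L2_inner lborel \<phi> (e k) \<in> \<real>" for k
    proof -
      have "cnj (\<phi> x * cnj (e k x)) = \<phi> x * cnj (e k x)" for x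
        using real e(3)[of k x] by (simp add: Reals_cnj_iff)
      then have "cnj (L2_inner lborel \<phi> (e k)) = L2_inner lborel \<phi> (e k)"
        unfolding L2_inner_def by (simp only: Bochner_Integration.integral_cnj[symmetric])
      then show ?thesis by (simp add: Reals_cnj_iff)
    qed
    then show "AE \<omega> in P. V \<phi> \<omega> \<in> \<real>"
      by (rule L2_sums_real[OF \<xi>L \<xi>(3) _ V[OF schwartz_L2[OF ph]]])
  next
    fix \<phi> \<psi> :: "real^'d \<Rightarrow> complex" assume "\<phi> \<in> schwartz" "\<psi> \<in> schwartz"
    then have L: "\<phi> \<in> L2 lborel" "\<psi> \<in> L2 lborel" by (auto intro: schwartz_L2)
    show "(LINT \<omega>|P. V \<phi> \<omega> * cnj (V \<psi> \<omega>)) = (LINT x|lborel. \<phi> x * cnj (\<psi> x))"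
      unfolding L2_inner_def[symmetric]
      by (rule sums_unique2[OF L2_sums_inner[OF \<xi>(1,2) V[OF L(1)] V[OF L(2)]]
          L2_sums_inner[OF e(1,2) expand[OF L(1)] expand[OF L(2)]]])
  qed

  \<comment> \<open>The noise \<open>L V\<close> is built from arbitrary choices of the operator with adjoint \<open>L\<close> and of the
     extension of \<open>V\<close>; both are determined almost everywhere, so they may be replaced by \<open>R\<close> and
     \<open>V\<close>.\<close>
  define L where "L = (\<lambda>f \<phi>. pairing f (R \<phi>))"
  define E where "E = L2_extension P V"
  have "linear_continuous_L2 (L2_topology lborel) P E \<and> (\<forall>\<phi>\<in>schwartz. AE \<omega> in P. E \<phi> \<omega> = V \<phi> \<omega>)"
    unfolding E_def L2_extension_def by (rule someI[of _ V]) (simp add: V_map)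
  then have E: "continuous_map (L2_topology lborel) (L2_topology P) E"
    "\<And>\<phi>. \<phi> \<in> schwartz \<Longrightarrow> AE \<omega> in P. E \<phi> \<omega> = V \<phi> \<omega>"
    by (auto simp: linear_continuous_L2_def)
  have V_map': "continuous_map (L2_topology lborel) (L2_topology P) V"
    using V_map by (simp add: linear_continuous_L2_def)

  have "AE \<omega> in P. Z \<phi> (fst \<omega>) = operator_noise P L V \<phi> \<omega>" if ph: "\<phi> \<in> schwartz" for \<phi>
  proof -
    let ?R' = "predual_operator L"
    note R' = predual_operator_adjoint[OF R_map ph, folded L_def]
    have "AE \<omega> in P. E (?R' \<phi>) \<omega> = V (?R' \<phi>) \<omega>"
      by (rule L2_extension_unique[OF V_map' E R'(1)])
    moreover have "AE \<omega> in P. V (?R' \<phi>) \<omega> = V (R \<phi>) \<omega>"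
    proof -
      have "L2_norm lborel (\<lambda>x. ?R' \<phi> x - R \<phi> x) = 0"
        using R' RL[OF ph] by (subst L2_norm_eq_0_iff) (auto intro: L2_diff)
      then have "L2_norm P (\<lambda>\<omega>. V (?R' \<phi>) \<omega> - V (R \<phi>) \<omega>) = 0"
        using V_norm[OF RL[OF ph] R'(1)] by simp
      then have "AE \<omega> in P. V (?R' \<phi>) \<omega> - V (R \<phi>) \<omega> = 0"
        using VL R'(1) RL[OF ph] by (simp add: L2_norm_eq_0_iff L2_diff)
      then show ?thesis by simp
    qed
    moreover have "AE \<omega> in P. V (R \<phi>) \<omega> = Z \<phi> (fst \<omega>)"
    proof (rule L2_sums_unique[OF \<xi>L])
      have "L2_inner lborel (R \<phi>) (e k) = c \<phi> k" for k
        by (rule L2_sums_coeff[OF e(1) R[OF ph] e(2)])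
      then show "L2_sums P \<xi> (c \<phi>) (V (R \<phi>))" using V[OF RL[OF ph]] by simp
      have "L2_sums M X (c \<phi>) (Z \<phi>)"
        unfolding c_def by (rule L2_sums_expansion[OF X(1) X(5)[OF ph]])
      \<comment> \<open>Where \<open>\<xi> k\<close> differs from \<open>X k\<close>, the coefficient vanishes.\<close>
      moreover have c\<xi>: "c \<phi> k * \<xi> k \<omega> = c \<phi> k * X k (fst \<omega>)" for k \<omega>
        using orthosystem_coeff_norm[OF X(1) ZL[OF ph], of k] X(1) \<xi>(5)[of k]
        by (cases "L2_norm M (X k) = 1") (auto simp: c_def orthosystem_def)
      moreover note fst = measurable_fst[of M N, folded P_def] N.distr_pair_fst[of M, folded P_def]
      moreover have "L2_norm P (\<lambda>\<omega>. Z \<phi> (fst \<omega>) - (\<Sum>k<n. c \<phi> k * X k (fst \<omega>))) =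
          L2_norm M (\<lambda>z. Z \<phi> z - (\<Sum>k<n. c \<phi> k * X k z))" for n
        using L2_norm_compose[OF fst, of "\<lambda>z. Z \<phi> z - (\<Sum>k<n. c \<phi> k * X k z)"]
        by (simp add: L2_diff ZL ph orthosystem_sum_L2[OF X(1)])
      ultimately show "L2_sums P \<xi> (c \<phi>) (\<lambda>\<omega>. Z \<phi> (fst \<omega>))"
        using L2_compose[OF fst ZL[OF ph]] unfolding L2_sums_def c\<xi> by simp
    qed
    ultimately show ?thesis unfolding operator_noise_def E_def by eventually_elim simp
  qed
  then have "modification P (\<lambda>\<phi> \<omega>. Z \<phi> (fst \<omega>)) (operator_noise P L V)"
    by (simp add: modification_def)
  moreover have "linear_weak_continuous L"
    unfolding L_def by (rule linear_weak_continuous_adjoint[OF R_map])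
  ultimately show ?thesis using N noise unfolding P_def by blast
qed

end
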